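(* Let $P\ne\tilde P$ be points of $\mathbb P$, $u$ a coordinate with $u(\tilde P)=0$, $u(P)=\infty$, and $\tilde u=1/u$. Under the identifications $U\mathfrak g_P/\langle U^+\mathbf g\rangle=U\mathfrak g_{P,-}$ and $U\mathfrak g_{\tilde P}/\langle U^+\mathbf g\rangle=U\mathfrak g_{\tilde P,-}$, for $\nu$ a meromorphic map $\mathbb P\to\mathbf g$ and $z\in\mathbb P\setminus\{P,\tilde P\}$ not a pole of $\nu$, one has the equalities $$\tilde\epsilon^{\nu(z)}(z)=\epsilon^{\nu(z)}(z)-\nu(z)\frac{d\tilde u_z}{\tilde u(z)}:\ U\mathfrak g_{P,\tilde P}/\langle U^+\mathbf g\rangle\to\{U\mathfrak g_{P,\tilde P}/\langle U^+\mathbf g\rangle\}\otimes K_z,$$ $$\tilde\iota^{\nu(z)}(z)=\iota^{\nu(z)}(z)+\nu(z)\frac{d\tilde u_z}{\tilde u(z)}:\ U\mathfrak g^z_{P,\tilde P}/\langle U^+\mathbf g\rangle\to\{U\mathfrak g^z_{P,\tilde P}/\langle U^+\mathbf g\rangle\}\otimes K_z .$$ In particular $\tilde j^{\nu(z)}(z)=j^{\nu(z)}(z)$.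
   Context: $\mathbb P$ is a complex projective line with canonical bundle $K$; a coordinate is a meromorphic function with exactly one pole, which is simple. $\mathbf g$ is a complex Lie algebra with a nondegenerate invariant symmetric bilinear form $(\cdot,\cdot)$. $\mathfrak g_P$ is the Lie algebra of meromorphic maps $\mathbb P\to\mathbf g$ regular at $P$, $\mathfrak g_{P,-}\subset\mathfrak g_P$ the ideal of those vanishing at $P$; $\mathbf g\subset\mathfrak g_P$ as constant maps. $\mathfrak g_{P,\tilde P}$ is the algebra of maps regular at both $P$ and $\tilde P$; a superscript $z$ means moreover regular at $z$. $U^+\mathbf g\subset U\mathbf g$ is the augmentation ideal and $\langle U^+\mathbf g\rangle$ the left ideal it generates; by PBW the inclusion induces $U\mathfrak g_{P,-}\cong U\mathfrak g_P/\langle U^+\mathbf g\rangle$ (and similarly with superscript $z$ or with $\tilde P$), and $U\mathfrak g_{P,\tilde P}/\langle U^+\mathbf g\rangle$ is a subspace of both $U\mathfrak g_P/\langle U^+\mathbf g\rangle$ and $U\mathfrak g_{\tilde P}/\langle U^+\mathbf g\rangle$. In the equalities $\nu(z)\in\mathbf g$ acts by left multiplication. For $a\in\mathbf g$ and $z\ne P$: $\epsilon^a(z):U\mathfrak g_{P,-}\to U\mathfrak g_{P,-}\otimes K_z$ is left multiplication by $\frac{a}{u-u(z)}\otimes du_z$, and $\iota^a(z):U\mathfrak g_{P,-}^z\to U\mathfrak g_{P,-}^z\otimes K_z$ is defined (simultaneously for all $a$) by $\iota^a(z)\mathbf 1=0$ and, for $\alpha\in\mathfrak g_{P,-}^z$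 acting by left multiplication, $$\iota^a(z)\circ\alpha-\alpha\circ\iota^a(z)=-[\epsilon^a(z),\alpha]-(a,d\alpha(z))+\iota^{[a,\alpha(z)]}(z)+\epsilon^{[a,\alpha(z)]}(z).$$ $j^a(z)=\epsilon^a(z)+\iota^a(z)$. The fields $\tilde\epsilon,\tilde\iota,\tilde j$ are defined in the same way with $P$ replaced by $\tilde P$ and $u$ by $\tilde u$, so $\tilde\epsilon^a(z)$ is left multiplication by $\frac{a}{\tilde u-\tilde u(z)}\otimes d\tilde u_z$. *)

theory Defs
  imports
    "HOL-Complex_Analysis.Complex_Analysis"
    "HOL-Library.Poly_Mapping"
    "HOL-Library.Set_Algebras"
    "HOL-Library.FuncSet"
begin

section \<open>Complex Lie algebras\<close>

class complex_lie_algebra = ab_group_add +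
  fixes scaleC :: "complex \<Rightarrow> 'a \<Rightarrow> 'a"  (infixr \<open>*\<^sub>C\<close> 75)
    and lie :: "'a \<Rightarrow> 'a \<Rightarrow> 'a"
  assumes scaleC_add_right: "c *\<^sub>C (x + y) = c *\<^sub>C x + c *\<^sub>C y"
    and scaleC_add_left: "(c + d) *\<^sub>C x = c *\<^sub>C x + d *\<^sub>C x"
    and scaleC_scaleC: "c *\<^sub>C d *\<^sub>C x = (c * d) *\<^sub>C x"
    and scaleC_one: "1 *\<^sub>C x = x"
    and lie_add_left: "lie (x + y) w = lie x w + lie y w"
    and lie_add_right: "lie x (y + w) = lie x y + lie x w"
    and lie_scaleC_left: "lie (c *\<^sub>C x) y = c *\<^sub>C lie x y"
    and lie_scaleC_right: "lie x (c *\<^sub>C y) = c *\<^sub>C lie x y"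
    and lie_self: "lie x x = 0"
    and jacobi: "lie x (lie y w) + lie y (lie w x) + lie w (lie x y) = 0"

class metric_lie_algebra = complex_lie_algebra +
  fixes inv_form :: "'a \<Rightarrow> 'a \<Rightarrow> complex"
  assumes inv_form_add_left: "inv_form (x + y) w = inv_form x w + inv_form y w"
    and inv_form_scaleC_left: "inv_form (c *\<^sub>C x) y = c * inv_form x y"
    and inv_form_sym: "inv_form x y = inv_form y x"
    and inv_form_invariant: "inv_form (lie x y) w = inv_form x (lie y w)"
    and inv_form_nondegenerate: "(\<And>y. inv_form x y = 0) \<Longrightarrow> x = 0"

section \<open>The projective line and meromorphic functions on it\<close>

datatype cp1 = Fin complex | Inf

text \<open>The local parametrization of the projective line centred at a point; its inverse
  \<open>t\<close> is a local coordinate with \<open>t = 0\<close> at that point.\<close>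

fun chart :: "cp1 \<Rightarrow> complex \<Rightarrow> cp1" where
  "chart (Fin c) w = Fin (c + w)"
| "chart Inf w = (if w = 0 then Inf else Fin (1 / w))"

text \<open>The value at a pole, and more generally at finitely many points, is immaterial here.\<close>

definition mero_fun :: "(cp1 \<Rightarrow> complex) \<Rightarrow> bool" where
  "mero_fun f \<longleftrightarrow> (\<forall>x. (\<lambda>w. f (chart x w)) meromorphic_on {0})"

definition holo_at :: "cp1 \<Rightarrow> (cp1 \<Rightarrow> complex) \<Rightarrow> bool" where
  "holo_at x f \<longleftrightarrow> (\<lambda>w. f (chart x w)) analytic_on {0}"

text \<open>The coordinate \<open>t\<close> of \<^term>\<open>chart x\<close> gives the basis \<open>dt\<close> of the canonical
  line \<open>K\<close> at \<open>x\<close>. By means of this basis \<open>K\<close> at \<open>x\<close> is identified with the complex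
  numbers, and the tensor product of a vector space with it with the vector space itself.
  Thus \<open>df x f\<close> is the differential of \<open>f\<close> at \<open>x\<close>.\<close>

definition df :: "cp1 \<Rightarrow> (cp1 \<Rightarrow> complex) \<Rightarrow> complex" where
  "df x f = deriv (\<lambda>w. f (chart x w)) 0"

definition pole_at :: "cp1 \<Rightarrow> (cp1 \<Rightarrow> complex) \<Rightarrow> bool" where
  "pole_at x f \<longleftrightarrow> is_pole (\<lambda>w. f (chart x w)) 0"

text \<open>A coordinate with pole at \<open>P\<close>. By the convention of \<^const>\<open>nicely_meromorphic_on\<close>,
  a coordinate takes the dummy value \<open>0\<close> at its pole and its true value everywhere else.
  Since \<open>1 / 0 = 0\<close>, the pointwise inverse follows the same convention.\<close>

definition coordinate :: "cp1 \<Rightarrow> (cp1 \<Rightarrow> complex) \<Rightarrow> bool" where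
  "coordinate P u \<longleftrightarrow>
     (\<forall>x. (\<lambda>w. u (chart x w)) nicely_meromorphic_on {0}) \<and>
     (\<forall>x. pole_at x u \<longleftrightarrow> x = P) \<and>
     zorder (\<lambda>w. u (chart P w)) 0 = -1"

section \<open>Meromorphic maps to a Lie algebra\<close>

definition lincomb :: "((cp1 \<Rightarrow> complex) \<times> 'g::complex_lie_algebra) list \<Rightarrow> cp1 \<Rightarrow> 'g" where
  "lincomb fs x = (\<Sum>(f, a)\<leftarrow>fs. f x *\<^sub>C a)"

definition mero_map :: "(cp1 \<Rightarrow> 'g::complex_lie_algebra) \<Rightarrow> bool" where
  "mero_map \<alpha> \<longleftrightarrow> (\<exists>fs. (\<forall>(f, a)\<in>set fs. mero_fun f) \<and> \<alpha> = lincomb fs)"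

definition mero_eq :: "(cp1 \<Rightarrow> 'g::complex_lie_algebra) \<Rightarrow> (cp1 \<Rightarrow> 'g) \<Rightarrow> bool" where
  "mero_eq \<alpha> \<beta> \<longleftrightarrow> mero_map \<alpha> \<and> mero_map \<beta> \<and> finite {x. \<alpha> x \<noteq> \<beta> x}"

lemma mero_map_0: "mero_map (\<lambda>_. 0)"
  unfolding mero_map_def by (rule exI[of _ "[]"]) (auto simp: lincomb_def fun_eq_iff)

lemma mero_map_add:
  assumes "mero_map \<alpha>" "mero_map \<beta>" shows "mero_map (\<lambda>x. \<alpha> x + \<beta> x)"
proof -
  obtain fs gs where *: "\<forall>(f, a)\<in>set fs. mero_fun f" "\<alpha> = lincomb fs"
      "\<forall>(f, a)\<in>set gs. mero_fun f" "\<beta> = lincomb gs"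
    using assms unfolding mero_map_def by metis
  show ?thesis
    unfolding mero_map_def
    by (rule exI[of _ "fs @ gs"]) (use * in \<open>auto simp: lincomb_def fun_eq_iff\<close>)
qed

lemma scaleC_zero_right [simp]: "c *\<^sub>C (0::'a::complex_lie_algebra) = 0"
  using scaleC_add_right[of c "0::'a" 0] by simp

lemma scaleC_zero_left [simp]: "0 *\<^sub>C (x::'a::complex_lie_algebra) = 0"
  using scaleC_add_left[of 0 0 x] by simp

lemma scaleC_minus_left: "(- c) *\<^sub>C (x::'a::complex_lie_algebra) = - (c *\<^sub>C x)"
  using scaleC_add_left[of c "- c" x] by (simp add: eq_neg_iff_add_eq_0 add.commute)

lemma lie_zero_left [simp]: "lie (0::'a::complex_lie_algebra) x = 0"
  using lie_add_left[of "0::'a" 0 x] by simp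

lemma lie_zero_right [simp]: "lie x (0::'a::complex_lie_algebra) = 0"
  using lie_add_right[of x "0::'a" 0] by simp

lemma mero_fun_times:
  assumes "mero_fun f" "mero_fun g" shows "mero_fun (\<lambda>x. f x * g x)"
  using assms unfolding mero_fun_def by (auto intro!: meromorphic_intros)

lemma mero_fun_const: "mero_fun (\<lambda>_. c)"
  unfolding mero_fun_def by (auto intro!: meromorphic_intros)

lemma mero_map_const: "mero_map (\<lambda>_. a)"
  unfolding mero_map_def
  by (rule exI[of _ "[(\<lambda>_. 1, a)]"]) (auto simp: lincomb_def scaleC_one mero_fun_const)

lemma mero_map_scale:
  assumes "mero_fun f" "mero_map \<alpha>" shows "mero_map (\<lambda>x. f x *\<^sub>C \<alpha> x)"
proof -
  obtain fs where *: "\<forall>(f, a)\<in>set fs. mero_fun f" "\<alpha> = lincomb fs"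
    using assms unfolding mero_map_def by metis
  have "lincomb (map (\<lambda>(g, a). (\<lambda>x. f x * g x, a)) gs) x = f x *\<^sub>C lincomb gs x"
    for gs :: "((cp1 \<Rightarrow> complex) \<times> 'a) list" and x
    by (induction gs) (auto simp: lincomb_def scaleC_add_right scaleC_scaleC)
  then show ?thesis
    unfolding mero_map_def
    by (intro exI[of _ "map (\<lambda>(g, a). (\<lambda>x. f x * g x, a)) fs"])
       (use * assms(1) in \<open>auto simp: fun_eq_iff intro!: mero_fun_times\<close>)
qed

lemma mero_map_lie_const:
  assumes "mero_map \<beta>" shows "mero_map (\<lambda>x. lie a (\<beta> x))"
proof -
  obtain fs where *: "\<forall>(f, a)\<in>set fs. mero_fun f" "\<beta> = lincomb fs"
    using assms unfolding mero_map_def by metis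
  have "lincomb (map (\<lambda>(g, b). (g, lie a b)) gs) x = lie a (lincomb gs x)"
    for gs :: "((cp1 \<Rightarrow> complex) \<times> 'a) list" and x
    by (induction gs) (auto simp: lincomb_def lie_add_right lie_scaleC_right)
  then show ?thesis
    unfolding mero_map_def
    by (intro exI[of _ "map (\<lambda>(g, b). (g, lie a b)) fs"])
       (use * in \<open>auto simp: fun_eq_iff\<close>)
qed

lemma mero_map_lie:
  assumes "mero_map \<alpha>" "mero_map \<beta>" shows "mero_map (\<lambda>x. lie (\<alpha> x) (\<beta> x))"
proof -
  obtain fs where *: "\<forall>(f, a)\<in>set fs. mero_fun f" "\<alpha> = lincomb fs"
    using assms unfolding mero_map_def by metis
  have "mero_map (\<lambda>x. lie (lincomb gs x) (\<beta> x))" if "\<forall>(f, a)\<in>set gs. mero_fun f"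
    for gs :: "((cp1 \<Rightarrow> complex) \<times> 'a) list"
    using that
  proof (induction gs)
    case Nil
    then show ?case by (simp add: lincomb_def mero_map_0)
  next
    case (Cons p gs)
    obtain f a where p: "p = (f, a)" by force
    have "mero_map (\<lambda>x. f x *\<^sub>C lie a (\<beta> x) + lie (lincomb gs x) (\<beta> x))"
      using Cons p by (intro mero_map_add mero_map_scale mero_map_lie_const assms) auto
    then show ?case
      by (simp add: p lincomb_def lie_add_left lie_scaleC_left)
  qed
  with * show ?thesis by simp
qed

text \<open>The type of meromorphic maps from the projective line to \<open>'g\<close>, that is, of elements
  of the tensor product of \<open>'g\<close> with the field of meromorphic functions. Since such a map
  has no values at its poles, maps that agree off a finite set are identified.\<close>

quotient_type (overloaded) 'g mero = "cp1 \<Rightarrow> 'g::complex_lie_algebra" / partial: mero_eq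
proof (rule part_equivpI)
  show "\<exists>x :: cp1 \<Rightarrow> 'g. mero_eq x x"
    by (rule exI[of _ "\<lambda>_. 0"]) (auto simp: mero_eq_def mero_map_0)
  show "symp (mero_eq :: (cp1 \<Rightarrow> 'g) \<Rightarrow> _)"
    unfolding mero_eq_def by (rule sympI) (metis (mono_tags, lifting) Collect_cong)
  show "transp (mero_eq :: (cp1 \<Rightarrow> 'g) \<Rightarrow> _)"
  proof (rule transpI)
    fix \<alpha> \<beta> \<gamma> :: "cp1 \<Rightarrow> 'g"
    assume *: "mero_eq \<alpha> \<beta>" "mero_eq \<beta> \<gamma>"
    have "{x. \<alpha> x \<noteq> \<gamma> x} \<subseteq> {x. \<alpha> x \<noteq> \<beta> x} \<union> {x. \<beta> x \<noteq> \<gamma> x}" by auto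
    then show "mero_eq \<alpha> \<gamma>"
      using * unfolding mero_eq_def by (metis finite_UnI finite_subset)
  qed
qed

lemma mero_eq_map1:
  assumes "mero_eq \<alpha> \<beta>" "\<And>\<alpha>. mero_map \<alpha> \<Longrightarrow> mero_map (\<lambda>x. F (\<alpha> x))"
  shows "mero_eq (\<lambda>x. F (\<alpha> x)) (\<lambda>x. F (\<beta> x))"
  using assms unfolding mero_eq_def
  by (metis (mono_tags, lifting) finite_subset mem_Collect_eq subsetI)

lemma mero_eq_map2:
  assumes "mero_eq \<alpha> \<beta>" "mero_eq \<gamma> \<delta>"
    "\<And>\<alpha> \<gamma>. mero_map \<alpha> \<Longrightarrow> mero_map \<gamma> \<Longrightarrow> mero_map (\<lambda>x. F (\<alpha> x) (\<gamma> x))"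
  shows "mero_eq (\<lambda>x. F (\<alpha> x) (\<gamma> x)) (\<lambda>x. F (\<beta> x) (\<delta> x))"
proof -
  have "{x. F (\<alpha> x) (\<gamma> x) \<noteq> F (\<beta> x) (\<delta> x)} \<subseteq> {x. \<alpha> x \<noteq> \<beta> x} \<union> {x. \<gamma> x \<noteq> \<delta> x}" by auto
  then show ?thesis
    using assms unfolding mero_eq_def by (metis (no_types, lifting) finite_UnI finite_subset)
qed

lemma mero_map_scale_const: "mero_map \<alpha> \<Longrightarrow> mero_map (\<lambda>x. c *\<^sub>C \<alpha> x)"
  by (intro mero_map_scale mero_fun_const)

lemma mero_map_minus:
  assumes "mero_map \<alpha>" shows "mero_map (\<lambda>x. - \<alpha> x)"
  using mero_map_scale_const[OF assms, of "- 1"] by (simp add: scaleC_minus_left scaleC_one)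

lemma mero_map_diff:
  assumes "mero_map \<alpha>" "mero_map \<beta>" shows "mero_map (\<lambda>x. \<alpha> x - \<beta> x)"
  using mero_map_add[OF assms(1) mero_map_minus[OF assms(2)]] by simp

lemma mero_eqI: "mero_map \<alpha> \<Longrightarrow> \<alpha> = \<beta> \<Longrightarrow> mero_eq \<alpha> \<beta>"
  by (simp add: mero_eq_def)

instantiation mero :: (complex_lie_algebra) complex_lie_algebra
begin

lift_definition zero_mero :: "'a mero" is "\<lambda>_. 0"
  by (simp add: mero_eq_def mero_map_0)

lift_definition plus_mero :: "'a mero \<Rightarrow> 'a mero \<Rightarrow> 'a mero" is "\<lambda>\<alpha> \<beta> x. \<alpha> x + \<beta> x"
  by (rule mero_eq_map2) (auto intro: mero_map_add)

lift_definition minus_mero :: "'a mero \<Rightarrow> 'a mero \<Rightarrow> 'a mero" is "\<lambda>\<alpha> \<beta> x. \<alpha> x - \<beta> x"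
  by (rule mero_eq_map2) (auto intro: mero_map_diff)

lift_definition uminus_mero :: "'a mero \<Rightarrow> 'a mero" is "\<lambda>\<alpha> x. - \<alpha> x"
  by (rule mero_eq_map1) (auto intro: mero_map_minus)

lift_definition scaleC_mero :: "complex \<Rightarrow> 'a mero \<Rightarrow> 'a mero" is "\<lambda>c \<alpha> x. c *\<^sub>C \<alpha> x"
  by (rule mero_eq_map1) (auto intro: mero_map_scale_const)

lift_definition lie_mero :: "'a mero \<Rightarrow> 'a mero \<Rightarrow> 'a mero" is "\<lambda>\<alpha> \<beta> x. lie (\<alpha> x) (\<beta> x)"
  by (rule mero_eq_map2) (auto intro: mero_map_lie)

instance
proof
  note closed = mero_map_0 mero_map_add mero_map_diff mero_map_minus mero_map_scale_const mero_map_lie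
  fix \<alpha> \<beta> \<gamma> :: "'a mero" and c d :: complex
  show "\<alpha> + \<beta> + \<gamma> = \<alpha> + (\<beta> + \<gamma>)"
    by transfer (intro mero_eqI closed; simp add: mero_eq_def add.assoc closed)
  show "\<alpha> + \<beta> = \<beta> + \<alpha>"
    by transfer (intro mero_eqI closed; simp add: mero_eq_def add.commute closed)
  show "0 + \<alpha> = \<alpha>"
    by transfer (intro mero_eqI closed; simp add: mero_eq_def closed)
  show "- \<alpha> + \<alpha> = 0"
    by transfer (intro mero_eqI closed; simp add: mero_eq_def closed)
  show "\<alpha> - \<beta> = \<alpha> + - \<beta>"
    by transfer (intro mero_eqI closed; simp add: mero_eq_def closed)
  show "c *\<^sub>C (\<alpha> + \<beta>) = c *\<^sub>C \<alpha> + c *\<^sub>C \<beta>"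
    by transfer (intro mero_eqI closed; simp add: mero_eq_def scaleC_add_right closed)
  show "(c + d) *\<^sub>C \<alpha> = c *\<^sub>C \<alpha> + d *\<^sub>C \<alpha>"
    by transfer (intro mero_eqI closed; simp add: mero_eq_def scaleC_add_left closed)
  show "c *\<^sub>C d *\<^sub>C \<alpha> = (c * d) *\<^sub>C \<alpha>"
    by transfer (intro mero_eqI closed; simp add: mero_eq_def scaleC_scaleC closed)
  show "1 *\<^sub>C \<alpha> = \<alpha>"
    by transfer (intro mero_eqI closed; simp add: mero_eq_def scaleC_one closed)
  show "lie (\<alpha> + \<beta>) \<gamma> = lie \<alpha> \<gamma> + lie \<beta> \<gamma>"
    by transfer (intro mero_eqI closed; simp add: mero_eq_def lie_add_left closed)
  show "lie \<alpha> (\<beta> + \<gamma>) = lie \<alpha> \<beta> + lie \<alpha> \<gamma>"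
    by transfer (intro mero_eqI closed; simp add: mero_eq_def lie_add_right closed)
  show "lie (c *\<^sub>C \<alpha>) \<beta> = c *\<^sub>C lie \<alpha> \<beta>"
    by transfer (intro mero_eqI closed; simp add: mero_eq_def lie_scaleC_left closed)
  show "lie \<alpha> (c *\<^sub>C \<beta>) = c *\<^sub>C lie \<alpha> \<beta>"
    by transfer (intro mero_eqI closed; simp add: mero_eq_def lie_scaleC_right closed)
  show "lie \<alpha> \<alpha> = 0"
    by transfer (intro mero_eqI closed; simp add: mero_eq_def lie_self closed)
  show "lie \<alpha> (lie \<beta> \<gamma>) + lie \<beta> (lie \<gamma> \<alpha>) + lie \<gamma> (lie \<alpha> \<beta>) = 0"
    by transfer (intro mero_eqI closed; simp add: mero_eq_def jacobi closed)
qed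

end

definition mero_of :: "((cp1 \<Rightarrow> complex) \<times> 'g::complex_lie_algebra) list \<Rightarrow> 'g mero" where
  "mero_of fs = abs_mero (lincomb fs)"

definition holo_repr :: "cp1 \<Rightarrow> ((cp1 \<Rightarrow> complex) \<times> 'g::complex_lie_algebra) list \<Rightarrow> 'g mero \<Rightarrow> bool" where
  "holo_repr x fs \<alpha> \<longleftrightarrow> (\<forall>(f, a)\<in>set fs. mero_fun f \<and> holo_at x f) \<and> \<alpha> = mero_of fs"

definition regular_at :: "cp1 \<Rightarrow> 'g::complex_lie_algebra mero \<Rightarrow> bool" where
  "regular_at x \<alpha> \<longleftrightarrow> (\<exists>fs. holo_repr x fs \<alpha>)"

definition val :: "'g::complex_lie_algebra mero \<Rightarrow> cp1 \<Rightarrow> 'g" where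
  "val \<alpha> x = (THE v. \<exists>fs. holo_repr x fs \<alpha> \<and> v = (\<Sum>(f, a)\<leftarrow>fs. f x *\<^sub>C a))"

definition dval :: "'g::complex_lie_algebra mero \<Rightarrow> cp1 \<Rightarrow> 'g" where
  "dval \<alpha> x = (THE v. \<exists>fs. holo_repr x fs \<alpha> \<and> v = (\<Sum>(f, a)\<leftarrow>fs. df x f *\<^sub>C a))"

definition const_map :: "'g::complex_lie_algebra \<Rightarrow> 'g mero" where
  "const_map a = mero_of [(\<lambda>_. 1, a)]"

text \<open>\<open>maps S\<close> consists of the maps regular at all points of \<open>S\<close>, and \<open>maps0 P S\<close> of the
  maps regular at \<open>P\<close> and at all points of \<open>S\<close> that vanish at \<open>P\<close>.\<close>

definition maps :: "cp1 set \<Rightarrow> 'g::complex_lie_algebra mero set" where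
  "maps S = {\<alpha>. \<forall>x\<in>S. regular_at x \<alpha>}"

definition maps0 :: "cp1 \<Rightarrow> cp1 set \<Rightarrow> 'g::complex_lie_algebra mero set" where
  "maps0 P S = {\<alpha> \<in> maps (insert P S). val \<alpha> P = 0}"

section \<open>Enveloping algebras\<close>

datatype 'a free_mon = Word (letters: "'a list")

instantiation free_mon :: (type) monoid_add
begin

definition zero_free_mon :: "'a free_mon" where "0 = Word []"

definition plus_free_mon :: "'a free_mon \<Rightarrow> 'a free_mon \<Rightarrow> 'a free_mon" where
  "v + w = Word (letters v @ letters w)"

instance by standard (auto simp: zero_free_mon_def plus_free_mon_def)

end

text \<open>The free associative unital algebra on the set \<open>'a\<close>, as the monoid algebra of the free
  monoid; its product is the convolution product of \<^typ>\<open>'a free_mon \<Rightarrow>\<^sub>0 complex\<close>.\<close>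

type_synonym 'a free_alg = "'a free_mon \<Rightarrow>\<^sub>0 complex"

definition scal :: "complex \<Rightarrow> 'a free_alg" where
  "scal c = Poly_Mapping.single 0 c"

definition gen :: "'a \<Rightarrow> 'a free_alg" where
  "gen x = Poly_Mapping.single (Word [x]) 1"

definition free_on :: "'a set \<Rightarrow> 'a free_alg set" where
  "free_on h = {p. \<forall>w\<in>Poly_Mapping.keys p. set (letters w) \<subseteq> h}"

definition env_rels :: "'a::complex_lie_algebra set \<Rightarrow> 'a free_alg set" where
  "env_rels h =
     {gen (x + y) - (gen x + gen y) | x y. x \<in> h \<and> y \<in> h} \<union>
     {gen (c *\<^sub>C x) - scal c * gen x | c x. x \<in> h} \<union>
     {gen (lie x y) - (gen x * gen y - gen y * gen x) | x y. x \<in> h \<and> y \<in> h}"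

text \<open>The two-sided ideal of \<^term>\<open>free_on h\<close> generated by the relations.\<close>

inductive_set env_ideal :: "'a::complex_lie_algebra set \<Rightarrow> 'a free_alg set"
  for h :: "'a set" where
  zero: "0 \<in> env_ideal h"
| step: "x \<in> env_ideal h \<Longrightarrow> p \<in> free_on h \<Longrightarrow> r \<in> env_rels h \<Longrightarrow> q \<in> free_on h
    \<Longrightarrow> x + p * r * q \<in> env_ideal h"

text \<open>The universal enveloping algebra of a Lie subalgebra \<open>h\<close> of the ambient type, as the
  quotient of \<^term>\<open>free_on h\<close> by \<^term>\<open>env_ideal h\<close>. Here and below, the elements of a
  quotient by \<open>J\<close> are the cosets \<^term>\<open>p +o J\<close>. Sums of cosets are sums of sets. Left
  multiplication by \<open>p\<close> takes a coset \<open>X\<close> of \<open>J\<close> to \<^term>\<open>p *o X + J\<close>. If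
  \<open>J \<subseteq> J'\<close>, the canonical map from cosets of \<open>J\<close> to cosets of \<open>J'\<close> takes \<open>X\<close>
  to \<^term>\<open>X + J'\<close>.\<close>

definition env :: "'a::complex_lie_algebra set \<Rightarrow> 'a free_alg set set" where
  "env h = (\<lambda>p. p +o env_ideal h) ` free_on h"

definition lmul :: "'a free_alg set \<Rightarrow> 'a free_alg \<Rightarrow> 'a free_alg set \<Rightarrow> 'a free_alg set" where
  "lmul J p X = p *o X + J"

definition coset_minus :: "'a free_alg set \<Rightarrow> 'a free_alg set \<Rightarrow> 'a free_alg set"
    (infixl \<open>\<ominus>\<close> 65) where
  "X \<ominus> Y = X + (- 1) *o Y"

text \<open>For subalgebras \<open>k \<subseteq> h\<close>, the preimage in \<^term>\<open>free_on h\<close> of the left ideal of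
  \<open>env h\<close> generated by the augmentation ideal of \<open>env k\<close>. The augmentation annihilates
  all generators, so that it takes \<open>q\<close> to the coefficient of the empty word in \<open>q\<close>.\<close>

inductive_set aug_left_ideal :: "'a::complex_lie_algebra set \<Rightarrow> 'a set \<Rightarrow> 'a free_alg set"
  for h k :: "'a set" where
  base: "x \<in> env_ideal h \<Longrightarrow> x \<in> aug_left_ideal h k"
| step: "x \<in> aug_left_ideal h k \<Longrightarrow> p \<in> free_on h \<Longrightarrow> q \<in> free_on k
    \<Longrightarrow> Poly_Mapping.lookup q 0 = 0 \<Longrightarrow> x + p * q \<in> aug_left_ideal h k"

text \<open>The quotient of the enveloping algebra of \<^term>\<open>maps S\<close> by the left ideal generated
  by the augmentation ideal of the enveloping algebra of the constant maps.\<close>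

definition vac_ideal :: "cp1 set \<Rightarrow> 'g::complex_lie_algebra mero free_alg set" where
  "vac_ideal S = aug_left_ideal (maps S) (range const_map)"

definition vac :: "cp1 set \<Rightarrow> 'g::complex_lie_algebra mero free_alg set set" where
  "vac S = (\<lambda>p. p +o vac_ideal S) ` free_on (maps S)"

section \<open>The fields\<close>

text \<open>The element of \<open>maps0 P {}\<close> (tensor \<open>K\<close> at \<open>z\<close>, see above) that defines \<open>\<epsilon>\<close>.\<close>

definition eps_elt :: "(cp1 \<Rightarrow> complex) \<Rightarrow> cp1 \<Rightarrow> 'g::complex_lie_algebra \<Rightarrow> 'g mero free_alg" where
  "eps_elt u z a = scal (df z u) * gen (mero_of [(\<lambda>x. 1 / (u x - u z), a)])"

definition eps :: "cp1 \<Rightarrow> (cp1 \<Rightarrow> complex) \<Rightarrow> cp1 \<Rightarrow> 'g::complex_lie_algebra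
    \<Rightarrow> 'g mero free_alg set \<Rightarrow> 'g mero free_alg set" where
  "eps P u z a X = lmul (env_ideal (maps0 P {})) (eps_elt u z a) X"

text \<open>The defining commutation relation of \<open>\<iota>\<close> is an equality of maps from
  \<open>env (maps0 P {z})\<close> to \<open>env (maps0 P {})\<close>, since the individual terms containing
  \<open>\<epsilon>\<close> take values only in the latter. Elements of the former are taken to the latter by
  \<open>j\<close>.\<close>

definition is_iota :: "cp1 \<Rightarrow> (cp1 \<Rightarrow> complex) \<Rightarrow> cp1
    \<Rightarrow> ('g::metric_lie_algebra \<Rightarrow> 'g mero free_alg set \<Rightarrow> 'g mero free_alg set) \<Rightarrow> bool" where
  "is_iota P u z \<iota> \<longleftrightarrow>
    (let Uz = env (maps0 P {z}); Iz = env_ideal (maps0 P {z});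
         I = env_ideal (maps0 P {}); j = (\<lambda>X. X + I)
     in (\<forall>a. \<iota> a \<in> Uz \<rightarrow>\<^sub>E Uz) \<and>
        (\<forall>a. \<forall>X\<in>Uz. \<forall>Y\<in>Uz. \<iota> a (X + Y) = \<iota> a X + \<iota> a Y) \<and>
        (\<forall>a c. \<forall>X\<in>Uz. \<iota> a (lmul Iz (scal c) X) = lmul Iz (scal c) (\<iota> a X)) \<and>
        (\<forall>a. \<iota> a (1 +o Iz) = 0 +o Iz) \<and>
        (\<forall>a. \<forall>\<alpha>\<in>maps0 P {z}. \<forall>X\<in>Uz.
           j (\<iota> a (lmul Iz (gen \<alpha>) X)) \<ominus> j (lmul Iz (gen \<alpha>) (\<iota> a X)) =
           (0 +o I) \<ominus> (eps P u z a (j (lmul Iz (gen \<alpha>) X)) \<ominus> lmul I (gen \<alpha>) (eps P u z a (j X)))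
             \<ominus> lmul I (scal (inv_form a (dval \<alpha> z))) (j X)
             + j (\<iota> (lie a (val \<alpha> z)) X)
             + eps P u z (lie a (val \<alpha> z)) (j X)))"

definition iota :: "cp1 \<Rightarrow> (cp1 \<Rightarrow> complex) \<Rightarrow> cp1
    \<Rightarrow> 'g::metric_lie_algebra \<Rightarrow> 'g mero free_alg set \<Rightarrow> 'g mero free_alg set" where
  "iota P u z = (THE \<iota>. is_iota P u z \<iota>)"

definition cur :: "cp1 \<Rightarrow> (cp1 \<Rightarrow> complex) \<Rightarrow> cp1
    \<Rightarrow> 'g::metric_lie_algebra \<Rightarrow> 'g mero free_alg set \<Rightarrow> 'g mero free_alg set" where
  "cur P u z a X = eps P u z a (X + env_ideal (maps0 P {})) + (iota P u z a X + env_ideal (maps0 P {}))"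

section \<open>The identifications\<close>

text \<open>The map \<open>env (maps0 P S) \<rightarrow> vac (insert P S)\<close> induced by the inclusion, which is an
  isomorphism by Poincare-Birkhoff-Witt.\<close>

definition pbw :: "cp1 \<Rightarrow> cp1 set \<Rightarrow> 'g::complex_lie_algebra mero free_alg set \<Rightarrow> 'g mero free_alg set" where
  "pbw P S X = X + vac_ideal (insert P S)"

text \<open>For \<open>P \<in> T\<close> and \<open>insert P S \<subseteq> T\<close>, the inclusion of \<open>vac T\<close> in
  \<open>vac (insert P S)\<close>, followed by the identification of the latter with
  \<open>env (maps0 P S)\<close>.\<close>

definition vac_emb :: "cp1 \<Rightarrow> cp1 set \<Rightarrow> 'g::complex_lie_algebra mero free_alg set \<Rightarrow> 'g mero free_alg set" where
  "vac_emb P S X = inv_into (env (maps0 P S)) (pbw P S) (X + vac_ideal (insert P S))"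

text \<open>An operator \<open>A\<close> from \<open>env (maps0 P S)\<close> to \<open>env (maps0 P S')\<close> restricts to an
  operator from \<open>vac T\<close> to \<open>vac T'\<close> if it takes the subspace \<open>vac T\<close> of the former to
  the subspace \<open>vac T'\<close> of the latter; \<open>restrict_op\<close> is that restriction.\<close>

definition restricts :: "cp1 \<Rightarrow> cp1 set \<Rightarrow> cp1 set \<Rightarrow> cp1 set \<Rightarrow> cp1 set
    \<Rightarrow> ('g::complex_lie_algebra mero free_alg set \<Rightarrow> 'g mero free_alg set) \<Rightarrow> bool" where
  "restricts P S S' T T' A \<longleftrightarrow>
     (\<forall>X\<in>vac T. A (vac_emb P S X) \<in> vac_emb P S' ` vac T')"

definition restrict_op :: "cp1 \<Rightarrow> cp1 set \<Rightarrow> cp1 set \<Rightarrow> cp1 set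
    \<Rightarrow> ('g::complex_lie_algebra mero free_alg set \<Rightarrow> 'g mero free_alg set)
    \<Rightarrow> 'g mero free_alg set \<Rightarrow> 'g mero free_alg set" where
  "restrict_op P S S' T' A X = inv_into (vac T') (vac_emb P S') (A (vac_emb P S X))"

end

theory Submission
  imports Defs
begin

text \<open>On words the recursion that defines \<open>\<iota>\<close> makes sense for arbitrary maps regular at \<open>z\<close>. With the
  function \<open>s = du / (u - u z)\<close>, where \<open>du\<close> is the differential of \<open>u\<close> at \<open>z\<close>, and
  \<open>\<gamma> a \<alpha> = s [a, \<alpha> z - \<alpha>]\<close>, it reads
  \<open>\<iota> a (\<alpha> w) = \<alpha> (\<iota> a w) + (\<gamma> a \<alpha>) w - (a, d\<alpha> z) w + \<iota> [a, \<alpha> z] w\<close>, because the terms with \<open>\<epsilon>\<close>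
  combine to left multiplication by \<open>\<gamma> a \<alpha>\<close>, a map that is regular at \<open>z\<close> since the zero of
  \<open>\<alpha> z - \<alpha>\<close> cancels the pole of \<open>s\<close>. By the Jacobi identity and the invariance of the form, this
  operator on words descends to the enveloping algebra of every Lie algebra of maps regular at
  \<open>z\<close> that is closed under all \<open>\<gamma> a\<close> (\<open>ann_op_env_ideal\<close>). Since \<open>\<gamma> a\<close> annihilates constants, the
  operator also preserves the left ideal generated by the constants (\<open>ann_op_aug_left_ideal\<close>).
  Hence \<open>\<iota>\<close> is given by one formula on all the spaces in question, and so is \<open>\<epsilon>\<close>. Passing from \<open>u\<close>
  to \<open>1 / u\<close> replaces \<open>s\<close> by \<open>s - c\<close>, where \<open>c\<close> is the logarithmic differential of \<open>1 / u\<close> at \<open>z\<close>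
  (\<open>kernel_inverse\<close>). This is the assertion about \<open>\<epsilon>\<close>. The one about \<open>\<iota>\<close> follows by induction on
  words, as \<open>\<iota> a + c a\<close> satisfies the recursion for \<open>s - c\<close> modulo that left ideal
  (\<open>ann_op_change_kernel\<close>). In the sum of \<open>\<epsilon>\<close> and \<open>\<iota>\<close> the corrections cancel.

  The identifications rest on two algebraic facts. First, the maps regular at \<open>P\<close> are the
  semidirect product of the constants and the ideal of maps vanishing at \<open>P\<close>. Therefore the
  enveloping algebra of that ideal carries an action of all maps regular at \<open>P\<close> in which the
  constants act by derivations, and applying a word to the unit gives the inverse \<open>straighten\<close>
  of the map from this enveloping algebra to the quotient by the left ideal.

  Second, the enveloping algebra of a subalgebra of the maps vanishing at \<open>P\<close> embeds into the
  enveloping algebra of the larger algebra (\<open>env_ideal_maps0_Int\<close>). This makes the inclusions of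
  the vacuum spaces injective and determines \<open>\<iota>\<close>, whose defining relation only holds in the
  larger algebra. It is derived from a criterion: the enveloping algebra of \<open>k\<close> embeds into that
  of \<open>h\<close> if the linear forms on the latter that annihilate \<open>1\<close> separate the elements of \<open>k\<close>
  (\<open>env_ideal_Int_free_on\<close>). On elements of degree \<open>n\<close>, the product of \<open>n\<close> such forms with respect
  to the shuffle coproduct depends only on the symmetrization of the part of degree \<open>n\<close>, so that
  this part can be replaced by terms of lower degree if all the products vanish. For maps,
  such forms come from the cocycle \<open>\<alpha> \<mapsto> d\<alpha>\<close>: the word \<open>\<alpha>1 ... \<alpha>n\<close> is sent to the value of
  \<open>[\<alpha>1, [..., [\<alpha>n-1, d\<alpha>n]]]\<close> at a point. They separate the maps vanishing at \<open>P\<close>, as a map with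
  zero differential is constant.\<close>

section \<open>The free algebra\<close>

text \<open>The word \<open>w\<close> as an element of the free algebra.\<close>
definition mon :: "'a list \<Rightarrow> 'a free_alg" where
  "mon w = Poly_Mapping.single (Word w) 1"

lemma mon_Nil: "mon [] = 1"
  by (simp add: mon_def flip: zero_free_mon_def)

lemma mon_append: "mon (v @ w) = mon v * mon w"
  by (simp add: mon_def mult_single plus_free_mon_def)

lemma gen_eq_mon: "gen x = mon [x]"
  by (simp add: gen_def mon_def)

lemma mon_Cons: "mon (x # w) = gen x * mon w"
  using mon_append[of "[x]" w] by (simp add: gen_eq_mon)

lemma scal_0 [simp]: "scal 0 = 0" and scal_1 [simp]: "scal 1 = 1"
  by (simp_all add: scal_def)

lemma scal_add: "scal (c + d) = scal c + scal d"
  and scal_diff: "scal (c - d) = scal c - scal d"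
  and scal_minus: "scal (- c) = - scal c"
  and scal_mult: "scal (c * d) = scal c * scal d"
  by (simp_all add: scal_def single_add single_diff single_uminus mult_single)

lemma free_alg_expand:
  "p = (\<Sum>w\<in>Poly_Mapping.keys p. scal (Poly_Mapping.lookup p w) * mon (letters w))"
proof -
  have *: "scal c * mon (letters w) = Poly_Mapping.single w c" for c and w :: "'a free_mon"
    by (simp add: scal_def mon_def mult_single)
  show ?thesis
    unfolding * by (rule poly_mapping_eqI)
      (auto simp: lookup_sum lookup_single when_def in_keys_iff sum.delta')
qed

lemma scal_mult_mon_commute: "scal c * mon w = mon w * scal c"
  by (simp add: scal_def mon_def mult_single)

lemma scal_commute: "scal c * p = p * scal c"
proof -
  have "scal c * (scal d * mon w) = scal d * mon w * scal c" for d and w :: "'a list"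
  proof -
    have "scal c * (scal d * mon w) = scal (c * d) * mon w"
      by (simp add: scal_mult mult.assoc)
    also have "\<dots> = scal (d * c) * mon w"
      by (simp add: mult.commute)
    also have "\<dots> = scal d * mon w * scal c"
      by (simp add: scal_mult mult.assoc scal_mult_mon_commute[of c w])
    finally show ?thesis .
  qed
  then have "scal c * (\<Sum>w\<in>Poly_Mapping.keys p. scal (Poly_Mapping.lookup p w) * mon (letters w)) =
      (\<Sum>w\<in>Poly_Mapping.keys p. scal (Poly_Mapping.lookup p w) * mon (letters w)) * scal c"
    unfolding sum_distrib_left sum_distrib_right by (intro sum.cong refl)
  then show ?thesis by (simp only: free_alg_expand[symmetric])
qed

lemma scal_left_commute: "p * (scal c * q) = scal c * (p * q)"
  by (metis mult.assoc scal_commute)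

text \<open>Linear subspaces. Scalars act by multiplication with \<^const>\<open>scal\<close>.\<close>
definition lsub :: "'a free_alg set \<Rightarrow> bool" where
  "lsub V \<longleftrightarrow> 0 \<in> V \<and> (\<forall>x\<in>V. \<forall>y\<in>V. x + y \<in> V) \<and> (\<forall>c. \<forall>x\<in>V. scal c * x \<in> V)"

lemma lsubI:
  assumes "0 \<in> V" "\<And>x y. x \<in> V \<Longrightarrow> y \<in> V \<Longrightarrow> x + y \<in> V" "\<And>c x. x \<in> V \<Longrightarrow> scal c * x \<in> V"
  shows "lsub V"
  using assms by (auto simp: lsub_def)

lemma lsub_0: "lsub V \<Longrightarrow> 0 \<in> V"
  and lsub_add: "lsub V \<Longrightarrow> x \<in> V \<Longrightarrow> y \<in> V \<Longrightarrow> x + y \<in> V"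
  and lsub_scal: "lsub V \<Longrightarrow> x \<in> V \<Longrightarrow> scal c * x \<in> V"
  by (auto simp: lsub_def)

lemma lsub_minus: "lsub V \<Longrightarrow> x \<in> V \<Longrightarrow> - x \<in> V"
  using lsub_scal[of V x "-1"] by (simp add: scal_minus)

lemma lsub_diff: "lsub V \<Longrightarrow> x \<in> V \<Longrightarrow> y \<in> V \<Longrightarrow> x - y \<in> V"
  using lsub_add[of V x "- y"] lsub_minus[of V y] by simp

lemma lsub_sum: "lsub V \<Longrightarrow> (\<And>i. i \<in> A \<Longrightarrow> f i \<in> V) \<Longrightarrow> sum f A \<in> V"
  by (induction A rule: infinite_finite_induct) (auto intro: lsub_0 lsub_add)

lemma lsub_minus_commute: "lsub V \<Longrightarrow> x - y \<in> V \<Longrightarrow> y - x \<in> V"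
  using lsub_minus[of V "x - y"] by simp

lemmas lsub_closed = lsub_0 lsub_add lsub_scal lsub_minus lsub_diff lsub_sum

text \<open>The span of a set of words.\<close>
definition wspan :: "'a list set \<Rightarrow> 'a free_alg set" where
  "wspan L = {p. \<forall>w\<in>Poly_Mapping.keys p. letters w \<in> L}"

lemma wspan_lsub: "lsub (wspan L)"
proof (rule lsubI)
  fix x y assume "x \<in> wspan L" "y \<in> wspan L"
  then show "x + y \<in> wspan L"
    using keys_add[of x y] unfolding wspan_def by blast
next
  fix c x assume "x \<in> wspan L"
  moreover have "Poly_Mapping.keys (scal c * x) \<subseteq> Poly_Mapping.keys x"
    unfolding scal_def mult_map_scale_conv_mult[symmetric]
    by (auto simp: in_keys_iff Poly_Mapping.map.rep_eq)
  ultimately show "scal c * x \<in> wspan L"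
    unfolding wspan_def by blast
qed (simp add: wspan_def)

lemma mon_in_wspan [simp]: "mon w \<in> wspan L \<longleftrightarrow> w \<in> L"
  by (simp add: wspan_def mon_def)

lemma wspan_span:
  assumes "p \<in> wspan L" "lsub V" "\<And>w. w \<in> L \<Longrightarrow> mon w \<in> V" shows "p \<in> V"
proof -
  have "(\<Sum>w\<in>Poly_Mapping.keys p. scal (Poly_Mapping.lookup p w) * mon (letters w)) \<in> V"
    using assms unfolding wspan_def by (intro lsub_sum lsub_scal) auto
  then show ?thesis by (simp flip: free_alg_expand)
qed

lemma free_on_eq_wspan: "free_on h = wspan {w. set w \<subseteq> h}"
  by (simp add: free_on_def wspan_def)

lemma free_on_lsub: "lsub (free_on h)"
  unfolding free_on_eq_wspan by (rule wspan_lsub)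

lemma free_on_mult:
  assumes "p \<in> free_on h" "q \<in> free_on h" shows "p * q \<in> free_on h"
proof -
  have "set (letters w) \<subseteq> h" if w: "w \<in> Poly_Mapping.keys (p * q)" for w
  proof -
    obtain u v where "w = u + v" "u \<in> Poly_Mapping.keys p" "v \<in> Poly_Mapping.keys q"
      using subsetD[OF keys_mult w] by auto
    with assms show ?thesis
      by (auto simp: free_on_def plus_free_mon_def)
  qed
  then show ?thesis by (auto simp: free_on_def)
qed

lemma mon_in_free_on [simp]: "mon w \<in> free_on h \<longleftrightarrow> set w \<subseteq> h"
  by (simp add: free_on_def mon_def)

lemma gen_in_free_on [simp]: "gen x \<in> free_on h \<longleftrightarrow> x \<in> h"
  by (simp add: gen_eq_mon)

lemma one_in_free_on [simp]: "1 \<in> free_on h"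
  using mon_in_free_on[of "[]" h] by (simp add: mon_Nil)

lemma scal_in_free_on [simp]: "scal c \<in> free_on h"
  using lsub_scal[OF free_on_lsub one_in_free_on, of c h] by simp

lemma free_on_mono: "h \<subseteq> h' \<Longrightarrow> free_on h \<subseteq> free_on h'"
  by (auto simp: free_on_def)

lemmas free_on_closed = free_on_mult lsub_closed[OF free_on_lsub]

lemma free_on_span:
  assumes "p \<in> free_on h" "lsub V" "\<And>w. set w \<subseteq> h \<Longrightarrow> mon w \<in> V" shows "p \<in> V"
  using wspan_span[of p "{w. set w \<subseteq> h}" V] assms by (auto simp: free_on_eq_wspan)

text \<open>The linear extension of a function on words.\<close>
definition lin :: "('a list \<Rightarrow> 'b free_alg) \<Rightarrow> 'a free_alg \<Rightarrow> 'b free_alg" where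
  "lin F p = (\<Sum>w\<in>Poly_Mapping.keys p. scal (Poly_Mapping.lookup p w) * F (letters w))"

lemma lin_eq_sum:
  assumes "finite A" "Poly_Mapping.keys p \<subseteq> A"
  shows "lin F p = (\<Sum>w\<in>A. scal (Poly_Mapping.lookup p w) * F (letters w))"
  unfolding lin_def using assms by (intro sum.mono_neutral_left) (auto simp: in_keys_iff)

lemma lin_0 [simp]: "lin F 0 = 0"
  by (simp add: lin_def)

lemma lin_add: "lin F (p + q) = lin F p + lin F q"
proof -
  let ?A = "Poly_Mapping.keys p \<union> Poly_Mapping.keys q"
  show ?thesis
    using keys_add[of p q]
    by (simp add: lin_eq_sum[of ?A] lookup_add scal_add distrib_right sum.distrib)
qed

lemma lin_scal: "lin F (scal c * p) = scal c * lin F p"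
proof -
  have "Poly_Mapping.lookup (scal c * p) w = c * Poly_Mapping.lookup p w" for w
    unfolding scal_def mult_map_scale_conv_mult[symmetric]
    by (simp add: Poly_Mapping.map.rep_eq when_def)
  moreover then have "Poly_Mapping.keys (scal c * p) \<subseteq> Poly_Mapping.keys p"
    by (auto simp: in_keys_iff)
  ultimately show ?thesis
    by (simp add: lin_eq_sum[of "Poly_Mapping.keys p"] scal_mult sum_distrib_left mult.assoc)
qed

lemma lin_minus: "lin F (- p) = - lin F p"
  using lin_scal[of F "-1" p] by (simp add: scal_minus)

lemma lin_diff: "lin F (p - q) = lin F p - lin F q"
  using lin_add[of F p "- q"] by (simp add: lin_minus)

lemma lin_mon [simp]: "lin F (mon w) = F w"
  by (simp add: lin_def mon_def)

lemma lin_gen [simp]: "lin F (gen x) = F [x]"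
  by (simp add: gen_eq_mon)

lemma lsub_vimage:
  assumes "\<And>x y. G (x + y) = G x + G y" "\<And>c x. G (scal c * x) = scal c * G x" "lsub V"
  shows "lsub {p. G p \<in> V}"
proof (rule lsubI)
  show "0 \<in> {p. G p \<in> V}"
    using assms(2)[of 0 0] assms(3) by (simp add: lsub_0)
qed (use assms in \<open>auto intro: lsub_closed\<close>)

lemma lsub_lin_vimage: "lsub V \<Longrightarrow> lsub {p. lin F p \<in> V}"
  by (intro lsub_vimage) (auto simp: lin_add lin_scal)

lemma lsub_singleton_0: "lsub {0}"
  by (intro lsubI) auto

lemma free_on_lin_in:
  assumes "p \<in> free_on h" "lsub V" "\<And>w. set w \<subseteq> h \<Longrightarrow> F w \<in> V" shows "lin F p \<in> V"
  using free_on_span[OF assms(1) lsub_lin_vimage[OF assms(2), of F]] assms(3) by auto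

text \<open>To compare two linear maps on \<^term>\<open>free_on h\<close> modulo a subspace \<open>V\<close> it suffices to compare
  them on words.\<close>
lemma linear_eq_on_free:
  assumes "p \<in> free_on h"
    and "\<And>x y. G (x + y) = G x + G y" "\<And>c x. G (scal c * x) = scal c * G x"
    and "\<And>x y. H (x + y) = H x + H y" "\<And>c x. H (scal c * x) = scal c * H x"
    and "\<And>w. set w \<subseteq> h \<Longrightarrow> G (mon w) - H (mon w) \<in> V" "lsub V"
  shows "G p - H p \<in> V"
proof -
  have "lsub {p. G p - H p \<in> V}"
    by (intro lsub_vimage) (auto simp: assms(2-5) algebra_simps assms(7))
  from free_on_span[OF assms(1) this] assms(6) show ?thesis by auto
qed

section \<open>The ideals of the enveloping algebras\<close>

text \<open>Lie subalgebras of the ambient type.\<close>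
definition lie_sub :: "'a::complex_lie_algebra set \<Rightarrow> bool" where
  "lie_sub h \<longleftrightarrow> 0 \<in> h \<and> (\<forall>x\<in>h. \<forall>y\<in>h. x + y \<in> h \<and> lie x y \<in> h) \<and> (\<forall>c. \<forall>x\<in>h. c *\<^sub>C x \<in> h)"

lemma lie_sub_0: "lie_sub h \<Longrightarrow> 0 \<in> h"
  and lie_sub_add: "lie_sub h \<Longrightarrow> x \<in> h \<Longrightarrow> y \<in> h \<Longrightarrow> x + y \<in> h"
  and lie_sub_lie: "lie_sub h \<Longrightarrow> x \<in> h \<Longrightarrow> y \<in> h \<Longrightarrow> lie x y \<in> h"
  and lie_sub_scaleC: "lie_sub h \<Longrightarrow> x \<in> h \<Longrightarrow> c *\<^sub>C x \<in> h"
  by (auto simp: lie_sub_def)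

lemma lie_sub_minus: "lie_sub h \<Longrightarrow> x \<in> h \<Longrightarrow> - x \<in> h"
  using lie_sub_scaleC[of h x "-1"] by (simp add: scaleC_minus_left scaleC_one)

lemma lie_sub_diff: "lie_sub h \<Longrightarrow> x \<in> h \<Longrightarrow> y \<in> h \<Longrightarrow> x - y \<in> h"
  using lie_sub_add[of h x "- y"] by (simp add: lie_sub_minus)

lemmas lie_sub_closed = lie_sub_0 lie_sub_add lie_sub_lie lie_sub_scaleC lie_sub_minus lie_sub_diff

lemma env_ideal_add: "y \<in> env_ideal h \<Longrightarrow> x \<in> env_ideal h \<Longrightarrow> x + y \<in> env_ideal h"
  by (induction y rule: env_ideal.induct) (auto intro: env_ideal.intros simp flip: add.assoc)

lemma env_ideal_mult:
  "x \<in> env_ideal h \<Longrightarrow> p \<in> free_on h \<Longrightarrow> q \<in> free_on h \<Longrightarrow> p * x * q \<in> env_ideal h"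
proof (induction x rule: env_ideal.induct)
  case (step x p' r q')
  have "p * (x + p' * r * q') * q = p * x * q + (p * p') * r * (q' * q)"
    by (simp add: algebra_simps)
  then show ?case
    using step by (auto intro!: env_ideal.step free_on_mult)
qed (auto intro: env_ideal.zero)

lemma env_ideal_mult_left: "x \<in> env_ideal h \<Longrightarrow> p \<in> free_on h \<Longrightarrow> p * x \<in> env_ideal h"
  using env_ideal_mult[of x h p 1] by simp

lemma env_ideal_mult_right: "x \<in> env_ideal h \<Longrightarrow> q \<in> free_on h \<Longrightarrow> x * q \<in> env_ideal h"
  using env_ideal_mult[of x h 1 q] by simp

lemma env_ideal_lsub: "lsub (env_ideal h)"
  by (intro lsubI env_ideal.zero env_ideal_add env_ideal_mult_left) auto

lemmas env_ideal_closed = lsub_closed[OF env_ideal_lsub]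

lemma env_relsE:
  assumes "r \<in> env_rels h"
  obtains x y where "r = gen (x + y) - (gen x + gen y)" "x \<in> h" "y \<in> h"
    | c x where "r = gen (c *\<^sub>C x) - scal c * gen x" "x \<in> h"
    | x y where "r = gen (lie x y) - (gen x * gen y - gen y * gen x)" "x \<in> h" "y \<in> h"
  using assms unfolding env_rels_def by blast

lemma env_rels_in_env_ideal: "r \<in> env_rels h \<Longrightarrow> r \<in> env_ideal h"
  using env_ideal.step[OF env_ideal.zero, of 1 h r 1] by simp

lemma gen_add_env:
  assumes "x \<in> h" "y \<in> h" shows "gen (x + y) - (gen x + gen y) \<in> env_ideal h"
  using assms by (intro env_rels_in_env_ideal) (unfold env_rels_def, blast)

lemma gen_scaleC_env:
  assumes "x \<in> h" shows "gen (c *\<^sub>C x) - scal c * gen x \<in> env_ideal h"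
  using assms by (intro env_rels_in_env_ideal) (unfold env_rels_def, blast)

lemma gen_lie_env:
  assumes "x \<in> h" "y \<in> h" shows "gen (lie x y) - (gen x * gen y - gen y * gen x) \<in> env_ideal h"
  using assms by (intro env_rels_in_env_ideal) (unfold env_rels_def, blast)

lemma gen_0_env: "0 \<in> h \<Longrightarrow> gen 0 \<in> env_ideal h"
  using gen_scaleC_env[of 0 h 0] by simp

lemma gen_minus_env: "x \<in> h \<Longrightarrow> gen (- x) + gen x \<in> env_ideal h"
  using gen_scaleC_env[of x h "-1"] by (simp add: scaleC_minus_left scaleC_one scal_minus)

lemma gen_diff_env:
  assumes "lie_sub h" "x \<in> h" "y \<in> h" shows "gen (x - y) - (gen x - gen y) \<in> env_ideal h"
proof -
  have "gen (x + - y) - (gen x + gen (- y)) + (gen (- y) + gen y) \<in> env_ideal h"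
    using assms by (intro env_ideal_closed gen_add_env gen_minus_env lie_sub_minus)
  then show ?thesis by (simp add: algebra_simps)
qed

lemma env_rels_mono: "h \<subseteq> h' \<Longrightarrow> env_rels h \<subseteq> env_rels h'"
  unfolding env_rels_def by blast

text \<open>The ideal is spanned by the relations multiplied by words on both sides.\<close>
lemma env_ideal_subset:
  assumes "lsub V" and "\<And>u r v. set u \<subseteq> h \<Longrightarrow> set v \<subseteq> h \<Longrightarrow> r \<in> env_rels h \<Longrightarrow> mon u * r * mon v \<in> V"
  shows "env_ideal h \<subseteq> V"
proof
  fix x assume "x \<in> env_ideal h"
  then show "x \<in> V"
  proof (induction rule: env_ideal.induct)
    case (step x p r q)
    have V: "lsub {p. G p \<in> V}" if "\<And>x y. G (x + y) = G x + G y" "\<And>c x. G (scal c * x) = scal c * G x"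
      for G :: "'a free_alg \<Rightarrow> 'a free_alg"
      using lsub_vimage[OF that assms(1)] by blast
    have "mon u * r * q \<in> V" if "set u \<subseteq> h" for u
      using free_on_span[OF step(4) V[of "\<lambda>q. mon u * r * q"]] assms(2) that step
      by (simp add: distrib_left scal_left_commute)
    then have "p * r * q \<in> V"
      using free_on_span[OF step(2) V[of "\<lambda>p. p * r * q"]]
      by (simp add: distrib_right mult.assoc)
    with step show ?case by (intro lsub_add[OF assms(1)])
  qed (intro lsub_0 assms)
qed

lemma env_ideal_mono:
  assumes "h \<subseteq> h'" shows "env_ideal h \<subseteq> env_ideal h'"
  using assms env_rels_mono[OF assms]
  by (intro env_ideal_subset env_ideal_lsub env_ideal_mult env_rels_in_env_ideal) auto

lemma aug_left_ideal_add:
  "x \<in> aug_left_ideal h k \<Longrightarrow> y \<in> aug_left_ideal h k \<Longrightarrow> x + y \<in> aug_left_ideal h k"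
proof (induction x rule: aug_left_ideal.induct)
  case (base x)
  from base(2) show ?case
  proof (induction y rule: aug_left_ideal.induct)
    case (base y)
    with \<open>x \<in> env_ideal h\<close> show ?case by (intro aug_left_ideal.base env_ideal_add)
  qed (auto intro: aug_left_ideal.step simp flip: add.assoc)
next
  case (step x p q)
  then have "(x + y) + p * q \<in> aug_left_ideal h k" by (intro aug_left_ideal.step)
  then show ?case by (simp add: algebra_simps)
qed

lemma aug_left_ideal_mult:
  "x \<in> aug_left_ideal h k \<Longrightarrow> p \<in> free_on h \<Longrightarrow> p * x \<in> aug_left_ideal h k"
proof (induction x rule: aug_left_ideal.induct)
  case (base x)
  then show ?case by (intro aug_left_ideal.base env_ideal_mult_left)
next
  case (step x p' q)
  then have "p * x + (p * p') * q \<in> aug_left_ideal h k"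
    by (intro aug_left_ideal.step free_on_mult) auto
  then show ?case by (simp add: algebra_simps)
qed

lemma aug_left_ideal_lsub: "lsub (aug_left_ideal h k)"
  by (rule lsubI) (auto intro: aug_left_ideal_add aug_left_ideal_mult aug_left_ideal.base[OF env_ideal.zero])

lemma gen_in_aug_left_ideal:
  assumes "x \<in> k" shows "gen x \<in> aug_left_ideal h k"
proof -
  have "0 + 1 * gen x \<in> aug_left_ideal h k"
  proof (intro aug_left_ideal.step aug_left_ideal.base env_ideal.zero)
    show "Poly_Mapping.lookup (gen x) 0 = 0"
      by (simp add: gen_def lookup_single zero_free_mon_def)
  qed (use assms in auto)
  then show ?thesis by simp
qed

text \<open>A word of positive length in letters from \<open>k\<close> ends with such a letter, so that the left ideal is
  spanned by \<^term>\<open>env_ideal h\<close> and the words that end in \<open>k\<close>.\<close>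
lemma aug_left_ideal_subset:
  assumes V: "lsub V" and "env_ideal h \<subseteq> V" "k \<subseteq> h"
    and mult: "\<And>u x. set u \<subseteq> h \<Longrightarrow> x \<in> k \<Longrightarrow> mon u * gen x \<in> V"
  shows "aug_left_ideal h k \<subseteq> V"
proof
  fix x assume "x \<in> aug_left_ideal h k"
  then show "x \<in> V"
  proof (induction rule: aug_left_ideal.induct)
    case (step x p q)
    have *: "p * gen x \<in> V" if "p \<in> free_on h" "x \<in> k" for p x
    proof -
      have "lsub {p. p * gen x \<in> V}"
        by (intro lsub_vimage V) (auto simp: distrib_right mult.assoc)
      from free_on_span[OF that(1) this] that show ?thesis by (auto intro: mult)
    qed
    have "p * (scal c * mon w) \<in> V" if "w \<noteq> []" "set w \<subseteq> k" for w c
    proof -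
      have "mon w = mon (butlast w) * gen (last w)"
        using that by (simp add: gen_eq_mon flip: mon_append)
      moreover have "(p * scal c * mon (butlast w)) * gen (last w) \<in> V"
        using that step \<open>k \<subseteq> h\<close> in_set_butlastD[of _ w] last_in_set[of w]
        by (intro * free_on_mult) auto
      ultimately show ?thesis by (simp add: mult.assoc)
    qed
    moreover have "letters w \<noteq> []" "set (letters w) \<subseteq> k" if "w \<in> Poly_Mapping.keys q" for w
    proof -
      show "letters w \<noteq> []"
      proof
        assume "letters w = []"
        then have "w = 0" by (cases w) (simp add: zero_free_mon_def)
        with that step(4) show False by (simp add: in_keys_iff)
      qed
      show "set (letters w) \<subseteq> k"
        using that step(3) by (simp add: free_on_def)
    qed
    ultimately
    have "(\<Sum>w\<in>Poly_Mapping.keys q. p * (scal (Poly_Mapping.lookup q w) * mon (letters w))) \<in> V"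
      by (intro lsub_sum[OF V]) blast
    then have "p * q \<in> V"
      by (subst free_alg_expand[of q]) (simp add: sum_distrib_left)
    with step show ?case by (auto intro: lsub_add[OF V])
  qed (use assms in auto)
qed

section \<open>Cosets\<close>

lemma coset_eq_iff: "lsub J \<Longrightarrow> p +o J = q +o J \<longleftrightarrow> p - q \<in> J"
proof
  assume J: "lsub J" and "p +o J = q +o J"
  then have "p \<in> q +o J" using lsub_0[OF J] by (metis add.right_neutral set_plus_intro2)
  then show "p - q \<in> J" by (simp add: set_minus_plus)
next
  assume J: "lsub J" and pq: "p - q \<in> J"
  have "p + x = q + ((p - q) + x)" "q + x = p + (x - (p - q))" for x by auto
  then show "p +o J = q +o J"
    unfolding elt_set_plus_def using pq J by (blast intro: lsub_add lsub_diff)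
qed

lemma coset_add_ideal:
  assumes "lsub J" "lsub J'" "J \<subseteq> J'" shows "(p +o J) + J' = p +o J'"
proof -
  have "J + J' = J'"
    using assms by (auto simp: set_plus_def lsub_0 intro: lsub_add) (metis add_0 lsub_0 set_plus_intro)
  then show ?thesis by (simp add: set_plus_rearrange3)
qed

lemma coset_add:
  assumes "lsub J" shows "(p +o J) + (q +o J) = (p + q) +o J"
  using coset_add_ideal[OF assms assms order_refl, of 0] by (simp add: set_plus_rearrange)

lemma lmul_coset:
  assumes "lsub J" "\<And>x. x \<in> J \<Longrightarrow> p * x \<in> J" shows "lmul J p (q +o J) = (p * q) +o J"
proof -
  have "p *o J + J = J"
    using assms by (auto simp: set_plus_def elt_set_times_def lsub_0 intro!: lsub_add)
      (metis add_0 lsub_0 mult_zero_right)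
  then show ?thesis by (simp add: lmul_def set_times_plus_distrib set_plus_rearrange3)
qed

lemma coset_diff:
  assumes "lsub J" shows "(p +o J) \<ominus> (q +o J) = (p - q) +o J"
proof -
  have "(-1) *o J = J"
    using assms by (auto simp: elt_set_times_def intro: lsub_minus) (metis lsub_minus minus_minus)
  then show ?thesis
    using coset_add[OF assms, of p "- q"] by (simp add: coset_minus_def set_times_plus_distrib)
qed

section \<open>Enveloping algebras of subalgebras\<close>

interpretation clie: vector_space "scaleC :: complex \<Rightarrow> 'a \<Rightarrow> 'a::complex_lie_algebra"
  by unfold_locales (auto simp: scaleC_add_right scaleC_add_left scaleC_scaleC scaleC_one)

text \<open>The linear forms on \<^term>\<open>free_on h\<close> that annihilate \<^term>\<open>env_ideal h\<close>, that is, the linear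
  forms on the enveloping algebra of \<open>h\<close>. A form is given by its values on words.\<close>
definition env_form :: "'a::complex_lie_algebra set \<Rightarrow> ('a list \<Rightarrow> complex) \<Rightarrow> bool" where
  "env_form h f \<longleftrightarrow> (\<forall>u v x y c. set u \<subseteq> h \<longrightarrow> set v \<subseteq> h \<longrightarrow> x \<in> h \<longrightarrow> y \<in> h \<longrightarrow>
     f (u @ (x + y) # v) = f (u @ x # v) + f (u @ y # v) \<and>
     f (u @ (c *\<^sub>C x) # v) = c * f (u @ x # v) \<and>
     f (u @ lie x y # v) = f (u @ x # y # v) - f (u @ y # x # v))"

lemma admI:
  assumes "\<And>u v x y. set u \<subseteq> h \<Longrightarrow> set v \<subseteq> h \<Longrightarrow> x \<in> h \<Longrightarrow> y \<in> h \<Longrightarrow>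
      f (u @ (x + y) # v) = f (u @ x # v) + f (u @ y # v)"
    and "\<And>u v x c. set u \<subseteq> h \<Longrightarrow> set v \<subseteq> h \<Longrightarrow> x \<in> h \<Longrightarrow> f (u @ (c *\<^sub>C x) # v) = c * f (u @ x # v)"
    and "\<And>u v x y. set u \<subseteq> h \<Longrightarrow> set v \<subseteq> h \<Longrightarrow> x \<in> h \<Longrightarrow> y \<in> h \<Longrightarrow>
      f (u @ lie x y # v) = f (u @ x # y # v) - f (u @ y # x # v)"
  shows "env_form h f"
  using assms unfolding env_form_def by blast

lemma
  assumes "env_form h f" "set u \<subseteq> h" "set v \<subseteq> h" "x \<in> h"
  shows env_form_add: "y \<in> h \<Longrightarrow> f (u @ (x + y) # v) = f (u @ x # v) + f (u @ y # v)"
    and env_form_scaleC: "f (u @ (c *\<^sub>C x) # v) = c * f (u @ x # v)"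
    and env_form_lie: "y \<in> h \<Longrightarrow> f (u @ lie x y # v) = f (u @ x # y # v) - f (u @ y # x # v)"
  using assms unfolding env_form_def by blast+

lemma env_form_mono:
  assumes "env_form h f" "k \<subseteq> h" shows "env_form k f"
  by (rule admI; (rule env_form_add[OF assms(1)] | rule env_form_scaleC[OF assms(1)] | rule env_form_lie[OF assms(1)]);
      use assms(2) in blast)

text \<open>The linear extension of a form on words. Its values are scalars embedded into the free algebra,
  so that all facts on \<^const>\<open>lin\<close> apply.\<close>
abbreviation ev :: "('a list \<Rightarrow> complex) \<Rightarrow> 'a free_alg \<Rightarrow> 'a free_alg" where
  "ev f \<equiv> lin (\<lambda>w. scal (f w))"

lemma ev_env_ideal:
  assumes f: "env_form h f" and p: "p \<in> env_ideal h" shows "ev f p = 0"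
proof -
  have "env_ideal h \<subseteq> {p. ev f p \<in> {0}}"
  proof (rule env_ideal_subset)
    fix u v r assume uv: "set u \<subseteq> h" "set v \<subseteq> h" and r: "r \<in> env_rels h"
    from r show "mon u * r * mon v \<in> {p. ev f p \<in> {0}}"
    proof (cases rule: env_relsE)
      case (1 x y)
      have "mon u * r * mon v = mon (u @ (x + y) # v) - (mon (u @ x # v) + mon (u @ y # v))"
        unfolding 1(1) by (simp add: mon_append mon_Cons algebra_simps)
      with 1 uv show ?thesis
        by (simp add: lin_diff lin_add env_form_add[OF f] scal_add)
    next
      case (2 c x)
      have "mon u * r * mon v = mon (u @ (c *\<^sub>C x) # v) - scal c * mon (u @ x # v)"
        unfolding 2(1) by (simp add: mon_append mon_Cons algebra_simps scal_left_commute)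
      with 2 uv show ?thesis
        by (simp add: lin_diff lin_scal env_form_scaleC[OF f] scal_mult)
    next
      case (3 x y)
      have "mon u * r * mon v = mon (u @ lie x y # v) - (mon (u @ x # y # v) - mon (u @ y # x # v))"
        unfolding 3(1) by (simp add: mon_append mon_Cons algebra_simps)
      with 3 uv show ?thesis
        by (simp add: lin_diff env_form_lie[OF f] scal_diff)
    qed
  qed (intro lsub_lin_vimage lsub_singleton_0)
  with p show ?thesis by auto
qed

subsection \<open>Convolution of linear forms\<close>

text \<open>The product of linear forms that is dual to the coproduct for which letters are primitive: the sum
  of \<open>f u * g v\<close> over all ways to split a word into complementary subwords \<open>u\<close> and \<open>v\<close>.\<close>
fun conv :: "('a list \<Rightarrow> complex) \<Rightarrow> ('a list \<Rightarrow> complex) \<Rightarrow> 'a list \<Rightarrow> complex" where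
  "conv f g [] = f [] * g []"
| "conv f g (x # w) = conv (\<lambda>u. f (x # u)) g w + conv f (\<lambda>v. g (x # v)) w"

lemma conv_cong:
  assumes "set w \<subseteq> h" "\<And>u. set u \<subseteq> h \<Longrightarrow> f u = f' u" "\<And>u. set u \<subseteq> h \<Longrightarrow> g u = g' u"
  shows "conv f g w = conv f' g' w"
  using assms
proof (induction w arbitrary: f f' g g')
  case (Cons x w)
  show ?case
    using Cons.prems by (auto intro!: arg_cong2[of _ _ _ _ "(+)"] Cons.IH)
qed simp

lemma conv_add_left: "conv (\<lambda>u. f u + f' u) g w = conv f g w + conv f' g w"
  and conv_add_right: "conv f (\<lambda>u. g u + g' u) w = conv f g w + conv f g' w"
  and conv_diff_left: "conv (\<lambda>u. f u - f' u) g w = conv f g w - conv f' g w"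
  and conv_diff_right: "conv f (\<lambda>u. g u - g' u) w = conv f g w - conv f g' w"
  and conv_scale_left: "conv (\<lambda>u. c * f u) g w = c * conv f g w"
  and conv_scale_right: "conv f (\<lambda>u. c * g u) w = c * conv f g w"
  by (induction w arbitrary: f f' g g') (simp_all add: algebra_simps)

lemma env_form_shift: "env_form h f \<Longrightarrow> x \<in> h \<Longrightarrow> env_form h (\<lambda>u. f (x # u))"
  by (rule admI)
     (use env_form_add[of h f "x # _"] env_form_scaleC[of h f "x # _"] env_form_lie[of h f "x # _"] in auto)

text \<open>Induction reduces the claim to a relation at the beginning of the word. There the cross terms
  cancel, since the commutator of primitive elements is primitive.\<close>
lemma env_form_conv:
  assumes "env_form h f" "env_form h g" shows "env_form h (conv f g)"
proof (rule admI)
  fix u v x y assume "set u \<subseteq> h" "set v \<subseteq> h" "x \<in> h" "y \<in> h"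
  then show "conv f g (u @ (x + y) # v) = conv f g (u @ x # v) + conv f g (u @ y # v)"
    using assms
  proof (induction u arbitrary: f g)
    case Nil
    have "conv (\<lambda>u. f ((x + y) # u)) g v = conv (\<lambda>u. f (x # u) + f (y # u)) g v"
         "conv f (\<lambda>u. g ((x + y) # u)) v = conv f (\<lambda>u. g (x # u) + g (y # u)) v"
      using Nil env_form_add[of h _ "[]"] by (auto intro!: conv_cong[of v h])
    then show ?case by (simp add: conv_add_left conv_add_right)
  qed (simp add: env_form_shift)
next
  fix u v x c assume "set u \<subseteq> h" "set v \<subseteq> h" "x \<in> h"
  then show "conv f g (u @ (c *\<^sub>C x) # v) = c * conv f g (u @ x # v)"
    using assms
  proof (induction u arbitrary: f g)
    case Nil
    have "conv (\<lambda>u. f ((c *\<^sub>C x) # u)) g v = conv (\<lambda>u. c * f (x # u)) g v"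
         "conv f (\<lambda>u. g ((c *\<^sub>C x) # u)) v = conv f (\<lambda>u. c * g (x # u)) v"
      using Nil env_form_scaleC[of h _ "[]"] by (auto intro!: conv_cong[of v h])
    then show ?case by (simp add: conv_scale_left conv_scale_right algebra_simps)
  qed (simp add: env_form_shift algebra_simps)
next
  fix u v x y assume "set u \<subseteq> h" "set v \<subseteq> h" "x \<in> h" "y \<in> h"
  then show "conv f g (u @ lie x y # v) = conv f g (u @ x # y # v) - conv f g (u @ y # x # v)"
    using assms
  proof (induction u arbitrary: f g)
    case Nil
    have "conv (\<lambda>u. f (lie x y # u)) g v = conv (\<lambda>u. f (x # y # u) - f (y # x # u)) g v"
         "conv f (\<lambda>u. g (lie x y # u)) v = conv f (\<lambda>u. g (x # y # u) - g (y # x # u)) v"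
      using Nil env_form_lie[of h _ "[]"] by (auto intro!: conv_cong[of v h])
    then show ?case by (simp add: conv_diff_left conv_diff_right)
  qed (simp add: env_form_shift)
qed

text \<open>The product of a list of forms. The empty product is the counit.\<close>
fun conv_list :: "('a list \<Rightarrow> complex) list \<Rightarrow> 'a list \<Rightarrow> complex" where
  "conv_list [] w = (if w = [] then 1 else 0)"
| "conv_list (f # fs) w = conv f (conv_list fs) w"

lemma env_form_conv_list: "(\<And>f. f \<in> set fs \<Longrightarrow> env_form h f) \<Longrightarrow> env_form h (conv_list fs)"
proof (induction fs)
  case Nil
  show ?case by (rule admI) auto
next
  case (Cons f fs)
  then have "env_form h (conv f (conv_list fs))" by (intro env_form_conv) auto
  then show ?case by (simp add: env_form_def)
qed

text \<open>All ways to remove one letter from a word, with the removed letter and the remaining word.\<close>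
fun picks :: "'a list \<Rightarrow> ('a \<times> 'a list) list" where
  "picks [] = []"
| "picks (x # w) = (x, w) # map (\<lambda>(y, r). (y, x # r)) (picks w)"

text \<open>The \<open>n!\<close> rearrangements, counted with multiplicity, of a word of length \<open>n\<close>.\<close>
primrec arrangements :: "nat \<Rightarrow> 'a list \<Rightarrow> 'a list list" where
  "arrangements 0 w = [[]]"
| "arrangements (Suc n) w = concat (map (\<lambda>(x, r). map ((#) x) (arrangements n r)) (picks w))"

text \<open>The product of the values of the \<open>i\<close>-th form on the \<open>i\<close>-th letter; zero if the lengths differ.\<close>
fun prod_form :: "('a list \<Rightarrow> complex) list \<Rightarrow> 'a list \<Rightarrow> complex" where
  "prod_form [] [] = 1"
| "prod_form (f # fs) (x # v) = f [x] * prod_form fs v"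
| "prod_form _ _ = 0"

lemma conv_zero:
  "(\<And>v. length v < m \<Longrightarrow> g v = 0) \<Longrightarrow> length w < m \<Longrightarrow> conv f g w = 0"
proof (induction w arbitrary: f g m)
  case (Cons x w)
  have "conv (\<lambda>u. f (x # u)) g w = 0"
    using Cons.prems by (intro Cons.IH[of m]) auto
  moreover have "conv f (\<lambda>v. g (x # v)) w = 0"
    using Cons.prems by (intro Cons.IH[of "m - 1"]) auto
  ultimately show ?case by simp
qed simp

text \<open>If \<open>g\<close> vanishes on words of length less than \<open>m\<close>, only the splitting that gives the whole word to
  \<open>g\<close> contributes on words of length \<open>m\<close>. If \<open>f\<close> annihilates the unit, only the splittings with one letter
  for \<open>f\<close> contribute on words of length \<open>m + 1\<close>.\<close>
lemma conv_head:
  "(\<And>v. length v < m \<Longrightarrow> g v = 0) \<Longrightarrow> length w = m \<Longrightarrow> conv f g w = f [] * g w"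
proof (induction w arbitrary: f g m)
  case (Cons x w)
  have "conv (\<lambda>u. f (x # u)) g w = 0"
    using Cons.prems by (intro conv_zero[of m]) auto
  moreover have "conv f (\<lambda>v. g (x # v)) w = f [] * g (x # w)"
    using Cons.prems by (intro Cons.IH[of "m - 1"]) auto
  ultimately show ?case by simp
qed simp

lemma conv_picks:
  assumes "f [] = 0"
  shows "(\<And>v. length v < m \<Longrightarrow> g v = 0) \<Longrightarrow> length w = Suc m \<Longrightarrow>
     conv f g w = (\<Sum>(x, r)\<leftarrow>picks w. f [x] * g r)"
proof (induction w arbitrary: g m)
  case (Cons x w)
  have 1: "conv (\<lambda>u. f (x # u)) g w = f [x] * g w"
    using Cons.prems by (subst conv_head[of m]) auto
  have 2: "conv f (\<lambda>v. g (x # v)) w = (\<Sum>(y, r)\<leftarrow>picks w. f [y] * g (x # r))"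
  proof (cases m)
    case 0
    with Cons.prems have "w = []" by simp
    with assms show ?thesis by simp
  next
    case (Suc m')
    with Cons.prems show ?thesis by (intro Cons.IH[of m']) auto
  qed
  from 1 2 show ?case by (simp add: o_def case_prod_unfold)
qed simp

text \<open>A product of \<open>n\<close> forms that annihilate the unit vanishes on words of length less than \<open>n\<close>.\<close>
lemma conv_list_low:
  "(\<And>f. f \<in> set fs \<Longrightarrow> f [] = 0) \<Longrightarrow> length w < length fs \<Longrightarrow> conv_list fs w = 0"
proof (induction fs arbitrary: w)
  case (Cons f fs)
  have IH: "conv_list fs v = 0" if "length v < length fs" for v
    using Cons that by auto
  show ?case
  proof (cases "length w < length fs")
    case True
    with conv_zero[OF IH] show ?thesis by simp
  next
    case False
    with Cons.prems have "length w = length fs" by simp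
    with conv_head[of "length fs" "conv_list fs" w f] IH Cons.prems show ?thesis by simp
  qed
qed simp

lemma sum_list_map_concat: "(\<Sum>x\<leftarrow>concat xss. g x) = (\<Sum>xs\<leftarrow>xss. \<Sum>x\<leftarrow>xs. g x)"
  by (induction xss) auto

text \<open>On words of length \<open>n\<close> it is the permanent of the values of the forms on the letters.\<close>
lemma conv_list_top:
  "(\<And>f. f \<in> set fs \<Longrightarrow> f [] = 0) \<Longrightarrow> length w = length fs \<Longrightarrow>
     conv_list fs w = (\<Sum>v\<leftarrow>arrangements (length fs) w. prod_form fs v)"
proof (induction fs arbitrary: w)
  case (Cons f fs)
  have len: "length r = length fs" if "(x, r) \<in> set (picks w)" for x r
  proof -
    have "length v = Suc (length r)" if "(x, r) \<in> set (picks v)" for v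
      using that by (induction v arbitrary: r) auto
    from this[OF that] Cons.prems show ?thesis by simp
  qed
  have "conv_list (f # fs) w = (\<Sum>(x, r)\<leftarrow>picks w. f [x] * conv_list fs r)"
    using Cons.prems by (simp, intro conv_picks[of _ "length fs"]) (auto intro: conv_list_low)
  also have "\<dots> = (\<Sum>(x, r)\<leftarrow>picks w. \<Sum>v\<leftarrow>arrangements (length fs) r. f [x] * prod_form fs v)"
    using Cons len
    by (intro arg_cong[of _ _ sum_list] map_cong refl) (auto simp: sum_list_const_mult)
  also have "\<dots> = (\<Sum>v\<leftarrow>arrangements (length (f # fs)) w. prod_form (f # fs) v)"
    by (simp add: sum_list_map_concat o_def case_prod_unfold)
  finally show ?case .
qed simp

subsection \<open>Symmetrization\<close>

text \<open>The span of the words in \<open>k\<close> of length less than \<open>n\<close>.\<close>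
definition low :: "'a set \<Rightarrow> nat \<Rightarrow> 'a free_alg set" where
  "low k n = wspan {w. set w \<subseteq> k \<and> length w < n}"

text \<open>The elements congruent to an element of degree less than \<open>n\<close> modulo the relations for \<open>k\<close>.\<close>
definition low_mod :: "'a::complex_lie_algebra set \<Rightarrow> nat \<Rightarrow> 'a free_alg set" where
  "low_mod k n = {p. \<exists>l\<in>low k n. p - l \<in> env_ideal k}"

lemma low_lsub: "lsub (low k n)"
  unfolding low_def by (rule wspan_lsub)

lemma mod_ideal_lsub:
  assumes "lsub W" "lsub J" shows "lsub {p. \<exists>l\<in>W. p - l \<in> J}"
proof (rule lsubI)
  show "0 \<in> {p. \<exists>l\<in>W. p - l \<in> J}"
    using lsub_0[OF assms(1)] lsub_0[OF assms(2)] by force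
next
  fix x y assume "x \<in> {p. \<exists>l\<in>W. p - l \<in> J}" "y \<in> {p. \<exists>l\<in>W. p - l \<in> J}"
  then obtain l m where *: "l \<in> W" "x - l \<in> J" "m \<in> W" "y - m \<in> J" by auto
  have "x + y - (l + m) = (x - l) + (y - m)" by simp
  also have "\<dots> \<in> J" using * by (intro lsub_add[OF assms(2)])
  finally show "x + y \<in> {p. \<exists>l\<in>W. p - l \<in> J}"
    using * lsub_add[OF assms(1)] by blast
next
  fix c x assume "x \<in> {p. \<exists>l\<in>W. p - l \<in> J}"
  then obtain l where *: "l \<in> W" "x - l \<in> J" by auto
  have "scal c * x - scal c * l = scal c * (x - l)" by (simp add: right_diff_distrib)
  also have "\<dots> \<in> J" using * by (intro lsub_scal[OF assms(2)])
  finally show "scal c * x \<in> {p. \<exists>l\<in>W. p - l \<in> J}"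
    using * lsub_scal[OF assms(1)] by blast
qed

lemma low_mod_lsub: "lsub (low_mod k n)"
  unfolding low_mod_def by (intro mod_ideal_lsub low_lsub env_ideal_lsub)

lemma low_gen_mult:
  assumes "x \<in> k" "l \<in> low k n" shows "gen x * l \<in> low k (Suc n)"
proof -
  have "lsub {l. gen x * l \<in> low k (Suc n)}"
    by (intro lsub_vimage low_lsub) (auto simp: distrib_left scal_left_commute)
  with assms(2) show ?thesis
    unfolding low_def by (rule wspan_span[THEN CollectD]) (use assms(1) in \<open>auto simp flip: mon_Cons\<close>)
qed

lemma low_mod_gen_mult:
  assumes "x \<in> k" "p \<in> low_mod k n" shows "gen x * p \<in> low_mod k (Suc n)"
proof -
  obtain l where l: "l \<in> low k n" "p - l \<in> env_ideal k" using assms by (auto simp: low_mod_def)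
  have "gen x * p - gen x * l = gen x * (p - l)" by (simp add: right_diff_distrib)
  also have "\<dots> \<in> env_ideal k" using l assms by (intro env_ideal_mult_left) auto
  finally show ?thesis unfolding low_mod_def using low_gen_mult[OF assms(1) l(1)] by blast
qed

lemma mon_swap_low_mod:
  assumes "lie_sub k" "x \<in> k" "y \<in> k" "set v \<subseteq> k"
  shows "mon (x # y # v) - mon (y # x # v) \<in> low_mod k (length v + 2)"
proof -
  have "mon (x # y # v) - mon (y # x # v) - mon (lie x y # v)
      = - ((gen (lie x y) - (gen x * gen y - gen y * gen x)) * mon v)"
    by (simp add: mon_Cons algebra_simps)
  also have "\<dots> \<in> env_ideal k"
    using assms by (intro env_ideal_closed(4) env_ideal_mult_right gen_lie_env) auto
  finally show ?thesis
    using assms unfolding low_mod_def low_def by (intro CollectI bexI[of _ "mon (lie x y # v)"])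
      (auto intro: lie_sub_lie)
qed

lemma picks_low_mod:
  assumes "lie_sub k"
  shows "set w \<subseteq> k \<Longrightarrow> (x, r) \<in> set (picks w) \<Longrightarrow>
    x \<in> set w \<and> set r \<subseteq> set w \<and> length w = Suc (length r) \<and> mon w - mon (x # r) \<in> low_mod k (length w)"
proof (induction w arbitrary: x r)
  case (Cons x0 w)
  from Cons.prems(2) consider "x = x0" "r = w"
    | r' where "(x, r') \<in> set (picks w)" "r = x0 # r'" by auto
  then show ?case
  proof cases
    case 1
    then show ?thesis by (auto simp: lsub_0[OF low_mod_lsub] simp del: picks.simps)
  next
    case 2
    have "set w \<subseteq> k" using Cons.prems by simp
    from Cons.IH[OF this 2(1)] have IH: "x \<in> set w" "set r' \<subseteq> set w" "length w = Suc (length r')"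
        "mon w - mon (x # r') \<in> low_mod k (length w)" by blast+
    have "gen x0 * (mon w - mon (x # r')) + (mon (x0 # x # r') - mon (x # x0 # r')) \<in> low_mod k (Suc (length w))"
    proof (intro lsub_add[OF low_mod_lsub] low_mod_gen_mult IH)
      show "mon (x0 # x # r') - mon (x # x0 # r') \<in> low_mod k (Suc (length w))"
        using IH Cons.prems mon_swap_low_mod[OF assms, of x0 x r'] by auto
    qed (use Cons.prems in auto)
    also have "gen x0 * (mon w - mon (x # r')) + (mon (x0 # x # r') - mon (x # x0 # r'))
        = mon (x0 # w) - mon (x # r)"
      using 2 by (simp add: mon_Cons algebra_simps)
    finally show ?thesis using 2 IH by auto
  qed
qed simp

lemma length_picks: "length (picks w) = length w"
  by (induction w) auto

text \<open>In the graded algebra associated with the enveloping algebra the letters commute.\<close>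
lemma arrangements_low_mod:
  assumes "lie_sub k"
  shows "set w \<subseteq> k \<Longrightarrow> length w = n \<Longrightarrow> v \<in> set (arrangements n w) \<Longrightarrow>
    set v \<subseteq> set w \<and> length v = n \<and> mon w - mon v \<in> low_mod k n"
proof (induction n arbitrary: w v)
  case (Suc n)
  then obtain x r v' where xr: "(x, r) \<in> set (picks w)" "v' \<in> set (arrangements n r)" "v = x # v'"
    by auto
  note p = picks_low_mod[OF assms Suc.prems(1) xr(1)]
  have IH: "set v' \<subseteq> set r" "length v' = n" "mon r - mon v' \<in> low_mod k n"
    using Suc.IH[of r v'] p xr Suc.prems by auto
  have "(mon w - mon (x # r)) + gen x * (mon r - mon v') \<in> low_mod k (Suc n)"
    using p IH Suc.prems by (intro lsub_add[OF low_mod_lsub] low_mod_gen_mult) auto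
  also have "(mon w - mon (x # r)) + gen x * (mon r - mon v') = mon w - mon v"
    using xr by (simp add: mon_Cons algebra_simps)
  finally show ?case using p IH xr by auto
qed (auto simp: lsub_0[OF low_mod_lsub] )

lemma length_arrangements: "length w = n \<Longrightarrow> length (arrangements n w) = fact n"
proof (induction n arbitrary: w)
  case (Suc n)
  have "length r = n" if "(x, r) \<in> set (picks w)" for x r
  proof -
    have "length v = Suc (length r)" if "(x, r) \<in> set (picks v)" for v
      using that by (induction v arbitrary: r) auto
    from this[OF that] Suc.prems show ?thesis by simp
  qed
  then have "map (\<lambda>(x, r). length (map ((#) x) (arrangements n r))) (picks w) = map (\<lambda>_. fact n) (picks w)"
    using Suc.IH by (intro map_cong refl) auto
  moreover have "length (arrangements (Suc n) w) =
      sum_list (map (\<lambda>(x, r). length (map ((#) x) (arrangements n r))) (picks w))"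
    by (simp add: length_concat o_def case_prod_unfold)
  ultimately have "length (arrangements (Suc n) w) = sum_list (map (\<lambda>_. fact n) (picks w))"
    by (simp only:)
  with Suc.prems show ?case by (simp add: sum_list_triv length_picks)
qed simp

subsection \<open>Multilinear forms separate words over a basis\<close>

lemma lie_sub_sum: "lie_sub k \<Longrightarrow> (\<And>x. x \<in> X \<Longrightarrow> f x \<in> k) \<Longrightarrow> sum f X \<in> k"
  by (induction X rule: infinite_finite_induct) (auto intro: lie_sub_closed)

lemma env_form_linear_sum:
  assumes k: "lie_sub k" and f: "env_form k f" and X: "finite X" "X \<subseteq> k"
  shows "f [\<Sum>x\<in>X. c x *\<^sub>C x] = (\<Sum>x\<in>X. c x * f [x])"
proof -
  have f0: "f [0] = 0"
    using env_form_scaleC[OF f, of "[]" "[]" 0 0] k by (simp add: lie_sub_0)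
  show ?thesis
    using X
  proof (induction X rule: finite_induct)
    case (insert x F)
    have "(\<Sum>x\<in>F. c x *\<^sub>C x) \<in> k"
      using insert.prems by (intro lie_sub_sum[OF k] lie_sub_scaleC[OF k]) auto
    with insert show ?case
      using env_form_add[OF f, of "[]" "[]" "c x *\<^sub>C x" "\<Sum>x\<in>F. c x *\<^sub>C x"]
        env_form_scaleC[OF f, of "[]" "[]" x "c x"] by (simp add: lie_sub_scaleC[OF k])
  qed (simp add: f0)
qed

text \<open>Multilinear forms in elements of \<open>\<Lambda>\<close> separate the linear combinations of words of length \<open>n\<close> in
  linearly independent letters. For the induction step, fix all forms but the first.\<close>
lemma prod_form_separates:
  assumes k: "lie_sub k" and X: "finite X" "X \<subseteq> k"
    and indep: "\<And>c. (\<Sum>x\<in>X. c x *\<^sub>C x) = 0 \<Longrightarrow> \<forall>x\<in>X. c x = 0"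
    and env_form: "\<And>f. f \<in> \<Lambda> \<Longrightarrow> env_form k f"
    and sep: "\<And>x. x \<in> k \<Longrightarrow> (\<And>f. f \<in> \<Lambda> \<Longrightarrow> f [x] = 0) \<Longrightarrow> x = 0"
  shows "(\<And>fs. set fs \<subseteq> \<Lambda> \<Longrightarrow> length fs = n \<Longrightarrow>
      (\<Sum>w | set w \<subseteq> X \<and> length w = n. C w * prod_form fs w) = 0) \<Longrightarrow>
    set w \<subseteq> X \<Longrightarrow> length w = n \<Longrightarrow> C w = 0"
proof (induction n arbitrary: C w)
  case 0
  have "{w :: 'a list. set w \<subseteq> X \<and> length w = 0} = {[]}" by auto
  with 0(1)[of "[]"] 0(3) show ?case by simp
next
  case (Suc n)
  let ?S = "\<lambda>n. {w. set w \<subseteq> X \<and> length w = n}"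
  obtain x0 w0 where w: "w = x0 # w0" "x0 \<in> X" "set w0 \<subseteq> X" "length w0 = n"
    using Suc.prems by (cases w) auto
  have img: "?S (Suc n) = (\<lambda>(x, w). x # w) ` (X \<times> ?S n)"
    by (auto simp: length_Suc_conv image_iff)
  have inj: "inj_on (\<lambda>(x, w). x # w) (X \<times> ?S n)"
    by (auto simp: inj_on_def)
  have "(\<Sum>w\<in>?S n. C (x0 # w) * prod_form fs w) = 0" if fs: "set fs \<subseteq> \<Lambda>" "length fs = n" for fs
  proof -
    define d where "d x = (\<Sum>w\<in>?S n. C (x # w) * prod_form fs w)" for x
    have "f [\<Sum>x\<in>X. d x *\<^sub>C x] = 0" if "f \<in> \<Lambda>" for f
    proof -
      have "0 = (\<Sum>w\<in>?S (Suc n). C w * prod_form (f # fs) w)"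
        using Suc.prems(1)[of "f # fs"] fs that by simp
      also have "\<dots> = (\<Sum>x\<in>X. \<Sum>w\<in>?S n. C (x # w) * prod_form (f # fs) (x # w))"
        unfolding img by (subst sum.reindex[OF inj]) (simp add: sum.cartesian_product case_prod_unfold)
      also have "\<dots> = (\<Sum>x\<in>X. d x * f [x])"
        by (simp add: d_def sum_distrib_right sum_distrib_left mult_ac)
      also have "\<dots> = f [\<Sum>x\<in>X. d x *\<^sub>C x]"
        using env_form_linear_sum[OF k env_form[OF that] X] by simp
      finally show ?thesis by simp
    qed
    moreover have "(\<Sum>x\<in>X. d x *\<^sub>C x) \<in> k"
      using X by (intro lie_sub_sum[OF k] lie_sub_scaleC[OF k]) auto
    ultimately have "(\<Sum>x\<in>X. d x *\<^sub>C x) = 0" by (intro sep)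
    with indep[of d] w show ?thesis by (simp add: d_def)
  qed
  then show ?case using Suc.IH[of "\<lambda>w. C (x0 # w)" w0] w by simp
qed

lemma basis_rewrite_gen:
  assumes k: "lie_sub k" and B: "B \<subseteq> k" "k \<subseteq> clie.span B" and x: "x \<in> k"
  obtains t c where "finite t" "t \<subseteq> B" "gen x - (\<Sum>b\<in>t. scal (c b) * gen b) \<in> env_ideal k"
proof -
  obtain t c where t: "finite t" "t \<subseteq> B" "x = (\<Sum>b\<in>t. c b *\<^sub>C b)"
    using subsetD[OF B(2) x] by (auto simp: clie.span_explicit)
  have "(\<Sum>b\<in>t. c b *\<^sub>C b) \<in> k \<and>
      gen (\<Sum>b\<in>t. c b *\<^sub>C b) - (\<Sum>b\<in>t. scal (c b) * gen b) \<in> env_ideal k"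
    using t(1,2)
  proof (induction t rule: finite_induct)
    case empty
    then show ?case by (simp add: lie_sub_0[OF k] gen_0_env)
  next
    case (insert b F)
    let ?s = "\<Sum>b\<in>F. c b *\<^sub>C b" and ?g = "\<Sum>b\<in>F. scal (c b) * gen b"
    have b: "b \<in> k" using insert B by auto
    have "(gen (c b *\<^sub>C b + ?s) - (gen (c b *\<^sub>C b) + gen ?s)) + (gen (c b *\<^sub>C b) - scal (c b) * gen b)
        + (gen ?s - ?g) \<in> env_ideal k"
      using insert b by (intro env_ideal_closed(2) gen_add_env gen_scaleC_env lie_sub_closed[OF k]) auto
    with insert b show ?case by (auto simp: algebra_simps intro: lie_sub_closed[OF k])
  qed
  with t that show ?thesis by blast
qed

text \<open>Modulo the relations, the letters of a word may be taken from a basis.\<close>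
lemma basis_rewrite:
  assumes k: "lie_sub k" and B: "B \<subseteq> k" "k \<subseteq> clie.span B" and p: "p \<in> low k n"
  shows "\<exists>q\<in>low B n. p - q \<in> env_ideal k"
proof -
  have "\<exists>q\<in>low B n. mon w - q \<in> env_ideal k" if "set w \<subseteq> k" "length w < n" for w
    using that
  proof (induction w arbitrary: n)
    case Nil
    then show ?case
      by (intro bexI[of _ "mon []"]) (auto simp: low_def env_ideal.zero)
  next
    case (Cons x w)
    then have "set w \<subseteq> k" "length w < n - 1" by auto
    from Cons.IH[OF this] obtain q where q: "q \<in> low B (n - 1)" "mon w - q \<in> env_ideal k"
      by blast
    obtain t c where t: "finite t" "t \<subseteq> B" "gen x - (\<Sum>b\<in>t. scal (c b) * gen b) \<in> env_ideal k"
      using basis_rewrite_gen[OF k B, of x] Cons.prems by auto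
    let ?g = "\<Sum>b\<in>t. scal (c b) * gen b"
    have "?g * q = (\<Sum>b\<in>t. scal (c b) * (gen b * q))"
      by (simp add: sum_distrib_right mult.assoc)
    also have "\<dots> \<in> low B n"
      using low_gen_mult[OF _ q(1)] t Cons.prems by (intro lsub_sum[OF low_lsub] lsub_scal[OF low_lsub]) auto
    finally have "?g * q \<in> low B n" .
    moreover have "(gen x - ?g) * mon w + ?g * (mon w - q) \<in> env_ideal k"
      using t q Cons.prems B
      by (intro env_ideal_closed(2) env_ideal_mult_left env_ideal_mult_right free_on_closed) auto
    then have "mon (x # w) - ?g * q \<in> env_ideal k"
      by (simp add: mon_Cons algebra_simps)
    ultimately show ?case by blast
  qed
  then show ?thesis
    using wspan_span[OF p[unfolded low_def] mod_ideal_lsub[OF low_lsub env_ideal_lsub, of B n k]] by auto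
qed

lemma ev_eq_0_imp_0:
  assumes k: "lie_sub k" and B: "B \<subseteq> k" "clie.independent B"
    and env_form: "\<And>f. f \<in> \<Lambda> \<Longrightarrow> env_form k f"
    and sep: "\<And>x. x \<in> k \<Longrightarrow> (\<And>f. f \<in> \<Lambda> \<Longrightarrow> f [x] = 0) \<Longrightarrow> x = 0"
    and T: "T \<in> wspan {w. set w \<subseteq> B \<and> length w = n}"
    and ev: "\<And>fs. set fs \<subseteq> \<Lambda> \<Longrightarrow> length fs = n \<Longrightarrow> ev (prod_form fs) T = 0"
  shows "T = 0"
proof -
  define X where "X = (\<Union>w\<in>Poly_Mapping.keys T. set (letters w))"
  have X: "finite X" "X \<subseteq> B" using T by (auto simp: X_def wspan_def)
  let ?S = "{w. set w \<subseteq> X \<and> length w = n}"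
  have S: "finite ?S" using finite_lists_length_eq[OF X(1)] by simp
  have keys: "Poly_Mapping.keys T \<subseteq> Word ` ?S"
  proof
    fix w assume "w \<in> Poly_Mapping.keys T"
    then have "letters w \<in> ?S" using T by (auto simp: X_def wspan_def)
    then show "w \<in> Word ` ?S" by (intro image_eqI[of _ _ "letters w"]) auto
  qed
  define C where "C w = Poly_Mapping.lookup T (Word w)" for w
  have sc: "scal a = 0 \<Longrightarrow> a = 0" for a
    by (metis lookup_single_eq lookup_zero scal_def)
  have scs: "(\<Sum>x\<in>A. scal (g x)) = scal (sum g A)" for g and A :: "'a list set"
    by (induction A rule: infinite_finite_induct) (auto simp: scal_add)
  have evT: "ev f T = scal (\<Sum>w\<in>?S. C w * f w)" for f
  proof -
    have "ev f T = (\<Sum>w\<in>?S. scal (C w) * scal (f w))"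
      using S keys by (subst lin_eq_sum[of "Word ` ?S"]) (auto simp: sum.reindex inj_on_def C_def)
    then show ?thesis by (simp add: scs flip: scal_mult)
  qed
  have "C w = 0" if "w \<in> ?S" for w
  proof (rule prod_form_separates[OF k X(1) _ _ env_form sep])
    show "\<forall>x\<in>X. c x = 0" if "(\<Sum>x\<in>X. c x *\<^sub>C x) = 0" for c
      using clie.independentD[OF B(2) X that] by blast
    show "(\<Sum>w | set w \<subseteq> X \<and> length w = n. C w * prod_form fs w) = 0" if "set fs \<subseteq> \<Lambda>" "length fs = n" for fs
      using ev[OF that] evT[of "prod_form fs"] sc by simp
  qed (use that X B in auto)
  then have "Poly_Mapping.keys T = {}"
    using keys by (fastforce simp: C_def in_keys_iff)
  then show ?thesis by (metis keys_zero poly_mapping_eqI not_in_keys_iff_lookup_eq_zero empty_iff)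
qed

lemma scal_list_sum: "scal (sum_list (map f xs)) = (\<Sum>x\<leftarrow>xs. scal (f x))"
  by (induction xs) (auto simp: scal_add)

lemma lin_list_sum: "lin F (sum_list (map f xs)) = (\<Sum>x\<leftarrow>xs. lin F (f x))"
  by (induction xs) (auto simp: lin_add)

lemma lsub_list_sum: "lsub V \<Longrightarrow> (\<And>x. x \<in> set xs \<Longrightarrow> f x \<in> V) \<Longrightarrow> sum_list (map f xs) \<in> V"
  by (induction xs) (auto intro: lsub_closed)

text \<open>An element of degree less than \<open>n\<close> on which all products of forms in \<open>\<Lambda>\<close> vanish is zero in the
  enveloping algebra. In the step from \<open>n\<close> to \<open>n + 1\<close>, written in a basis of \<open>k\<close>, the symmetrization
  of its part of degree \<open>n\<close> is zero (\<open>ev_eq_0_imp_0\<close>), and \<open>n!\<close> times the element is congruent to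
  this symmetrization up to lower degree (\<open>arrangements_low_mod\<close>).\<close>
theorem env_ideal_separated:
  assumes k: "lie_sub k"
    and env_form: "\<And>f. f \<in> \<Lambda> \<Longrightarrow> env_form k f" and f0: "\<And>f. f \<in> \<Lambda> \<Longrightarrow> f [] = 0"
    and sep: "\<And>x. x \<in> k \<Longrightarrow> (\<And>f. f \<in> \<Lambda> \<Longrightarrow> f [x] = 0) \<Longrightarrow> x = 0"
  shows "p \<in> low k n \<Longrightarrow> (\<And>fs. set fs \<subseteq> \<Lambda> \<Longrightarrow> ev (conv_list fs) p = 0) \<Longrightarrow> p \<in> env_ideal k"
proof (induction n arbitrary: p)
  case 0
  then have "p = 0"
    using wspan_span[of p "{}" "{0}"] lsub_singleton_0 by (simp add: low_def)
  then show ?case by (simp add: env_ideal.zero)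
next
  case (Suc n)
  obtain B where B: "B \<subseteq> k" "clie.independent B" "k \<subseteq> clie.span B"
    using clie.maximal_independent_subset[of k] by blast
  obtain q where q: "q \<in> low B (Suc n)" "p - q \<in> env_ideal k"
    using basis_rewrite[OF k B(1,3) Suc.prems(1)] by blast
  have adml: "env_form k (conv_list fs)" if "set fs \<subseteq> \<Lambda>" for fs
    using that env_form by (intro env_form_conv_list) auto
  have evq: "ev (conv_list fs) q = 0" if "set fs \<subseteq> \<Lambda>" for fs
    using ev_env_ideal[OF adml[OF that] q(2)] Suc.prems(2)[OF that] by (simp add: lin_diff)
  \<comment> \<open>\<open>T\<close> is the sum of all rearrangements of the part of \<open>q\<close> of degree \<open>n\<close>.\<close>
  define F where "F w = (if length w = n then \<Sum>v\<leftarrow>arrangements n w. mon v else 0)" for w :: "'a list"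
  define T where "T = lin F q"
  have qT: "scal (fact n) * q - T \<in> low_mod k n"
  proof -
    have "lsub {q. scal (fact n) * q - lin F q \<in> low_mod k n}"
      by (intro lsub_vimage low_mod_lsub) (simp_all add: lin_add lin_scal distrib_left right_diff_distrib
          scal_left_commute[of "scal (fact n)"])
    moreover have "scal (fact n) * mon w - F w \<in> low_mod k n" if w: "set w \<subseteq> B" "length w < Suc n" for w
    proof (cases "length w = n")
      case True
      have "scal (fact n) * mon w = (\<Sum>v\<leftarrow>arrangements n w. mon w)"
        using length_arrangements[OF True] by (simp add: sum_list_triv scal_def single_of_nat[symmetric])
      then have "scal (fact n) * mon w - F w = (\<Sum>v\<leftarrow>arrangements n w. mon w - mon v)"
        using True by (simp add: F_def sum_list_subtractf)
      also have "\<dots> \<in> low_mod k n"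
        using arrangements_low_mod[OF k _ True] w B by (intro lsub_list_sum low_mod_lsub) auto
      finally show ?thesis .
    next
      case False
      then have "scal (fact n) * mon w \<in> low k n"
        using w B by (intro lsub_scal[OF low_lsub]) (auto simp: low_def)
      then show ?thesis
        using False by (auto simp: F_def low_mod_def intro!: bexI[of _ "scal (fact n) * mon w"] env_ideal.zero)
    qed
    ultimately show ?thesis
      using wspan_span[OF q(1)[unfolded low_def], of "{q. scal (fact n) * q - lin F q \<in> low_mod k n}"]
      by (simp add: T_def)
  qed
  have "T = 0"
  proof (rule ev_eq_0_imp_0[OF k B(1,2) env_form sep])
    show "T \<in> wspan {w. set w \<subseteq> B \<and> length w = n}"
    proof -
      have "lin F q \<in> wspan {w. set w \<subseteq> B \<and> length w = n}"
      proof (rule wspan_span[OF q(1)[unfolded low_def] lsub_lin_vimage[OF wspan_lsub], THEN CollectD])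
        fix w assume "w \<in> {w. set w \<subseteq> B \<and> length w < Suc n}"
        then have w: "set w \<subseteq> B" "set w \<subseteq> k" using B by auto
        have "mon v \<in> wspan {w. set w \<subseteq> B \<and> length w = n}" if "length w = n" "v \<in> set (arrangements n w)" for v
          using arrangements_low_mod[OF k w(2) that] w by auto
        then have "F w \<in> wspan {w. set w \<subseteq> B \<and> length w = n}"
          by (auto simp: F_def lsub_0[OF wspan_lsub] intro!: lsub_list_sum wspan_lsub)
        then show "mon w \<in> {p. lin F p \<in> wspan {w. set w \<subseteq> B \<and> length w = n}}" by simp
      qed
      then show ?thesis by (simp add: T_def)
    qed
    fix fs assume fs: "set fs \<subseteq> \<Lambda>" "length fs = n"
    have "ev (prod_form fs) (lin F q) - ev (conv_list fs) q \<in> {0}"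
    proof -
      have "lsub {q. ev (prod_form fs) (lin F q) - ev (conv_list fs) q \<in> {0}}"
        by (intro lsub_vimage lsub_singleton_0) (auto simp: lin_add lin_scal algebra_simps)
      moreover have "ev (prod_form fs) (F w) - scal (conv_list fs w) = 0" if "length w < Suc n" for w
      proof (cases "length w = n")
        case True
        have "conv_list fs w = (\<Sum>v\<leftarrow>arrangements n w. prod_form fs v)"
          using conv_list_top[of fs w] True fs f0 by auto
        with True show ?thesis
          by (simp add: F_def lin_list_sum scal_list_sum)
      next
        case False
        with that fs f0 have "conv_list fs w = 0" by (intro conv_list_low) auto
        with False show ?thesis by (simp add: F_def)
      qed
      ultimately show ?thesis
        using wspan_span[OF q(1)[unfolded low_def], of "{q. ev (prod_form fs) (lin F q) - ev (conv_list fs) q \<in> {0}}"]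
        by simp
    qed
    with evq[OF fs(1)] show "ev (prod_form fs) T = 0" by (simp add: T_def)
  qed
  with qT obtain l where l: "l \<in> low k n" "scal (fact n) * q - l \<in> env_ideal k"
    by (auto simp: low_mod_def)
  have "l \<in> env_ideal k"
  proof (rule Suc.IH[OF l(1)])
    fix fs assume fs: "set fs \<subseteq> \<Lambda>"
    show "ev (conv_list fs) l = 0"
      using ev_env_ideal[OF adml[OF fs] l(2)] evq[OF fs] by (simp add: lin_diff lin_scal)
  qed
  with l have "(scal (fact n) * q - l) + l \<in> env_ideal k" by (intro env_ideal_add)
  then have "scal (fact n) * q \<in> env_ideal k" by simp
  then have "scal (1 / fact n) * (scal (fact n) * q) \<in> env_ideal k"
    by (rule env_ideal_closed(3))
  moreover have "scal (1 / fact n) * (scal (fact n) * q) = scal (1 / fact n * fact n) * q"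
    by (simp only: scal_mult mult.assoc)
  ultimately have "q \<in> env_ideal k" by simp
  with q have "(p - q) + q \<in> env_ideal k" by (intro env_ideal_add)
  then show ?case by simp
qed

text \<open>The enveloping algebra of \<open>k\<close> embeds into that of \<open>h\<close>.\<close>
theorem env_ideal_Int_free_on:
  assumes "lie_sub k" "k \<subseteq> h"
    and env_form: "\<And>f. f \<in> \<Lambda> \<Longrightarrow> env_form h f" and "\<And>f. f \<in> \<Lambda> \<Longrightarrow> f [] = 0"
    and "\<And>x. x \<in> k \<Longrightarrow> (\<And>f. f \<in> \<Lambda> \<Longrightarrow> f [x] = 0) \<Longrightarrow> x = 0"
    and "p \<in> free_on k" "p \<in> env_ideal h"
  shows "p \<in> env_ideal k"
proof -
  define n where "n = Suc (Max ((\<lambda>w. length (letters w)) ` Poly_Mapping.keys p))"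
  have "p \<in> low k n"
    using assms(6) by (auto simp: low_def wspan_def free_on_def n_def less_Suc_eq_le)
  moreover have "env_form k f" if "f \<in> \<Lambda>" for f
    using env_form[OF that] assms(2) by (rule env_form_mono)
  moreover have "ev (conv_list fs) p = 0" if "set fs \<subseteq> \<Lambda>" for fs
    using that env_form assms(7) by (intro ev_env_ideal[of h] env_form_conv_list) auto
  ultimately show ?thesis
    using env_ideal_separated[of k \<Lambda> p n] assms by auto
qed

section \<open>Linear functionals\<close>

text \<open>Linear functionals on \<open>'g\<close>. They separate points also in infinite dimension, and reduce statements on
  maps to \<open>'g\<close> to statements on scalar functions.\<close>
definition linear_form :: "('g::complex_lie_algebra \<Rightarrow> complex) \<Rightarrow> bool" where
  "linear_form \<xi> \<longleftrightarrow> (\<forall>x y. \<xi> (x + y) = \<xi> x + \<xi> y) \<and> (\<forall>c x. \<xi> (c *\<^sub>C x) = c * \<xi> x)"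

lemma linear_form_add: "linear_form \<xi> \<Longrightarrow> \<xi> (x + y) = \<xi> x + \<xi> y"
  and linear_form_scaleC: "linear_form \<xi> \<Longrightarrow> \<xi> (c *\<^sub>C x) = c * \<xi> x"
  by (auto simp: linear_form_def)

lemma linear_form_0: "linear_form \<xi> \<Longrightarrow> \<xi> 0 = 0"
  using linear_form_scaleC[of \<xi> 0 0] by simp

lemma linear_form_diff: "linear_form \<xi> \<Longrightarrow> \<xi> (x - y) = \<xi> x - \<xi> y"
  using linear_form_add[of \<xi> "x - y" y] by simp

lemma linear_form_separates:
  fixes x :: "'g::complex_lie_algebra"
  assumes "\<And>\<xi>. linear_form \<xi> \<Longrightarrow> \<xi> x = 0" shows "x = 0"
proof (rule ccontr)
  assume "x \<noteq> 0"
  then have ind: "clie.independent {x}" by simp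
  define B where "B = clie.extend_basis {x}"
  have B: "clie.independent B" "clie.span B = UNIV" "x \<in> B"
    unfolding B_def using clie.independent_extend_basis[OF ind] clie.span_extend_basis[OF ind]
      clie.extend_basis_superset[OF ind] by auto
  have "linear_form (\<lambda>y. clie.representation B y x)"
    unfolding linear_form_def using B by (simp add: clie.representation_add clie.representation_scale)
  from assms[OF this] show False
    using B by (simp add: clie.representation_basis)
qed

lemma linear_form_eqI: "(\<And>\<xi>. linear_form \<xi> \<Longrightarrow> \<xi> x = \<xi> y) \<Longrightarrow> x = y"
  using linear_form_separates[of "x - y"] by (simp add: linear_form_diff)

section \<open>Charts\<close>

lemma chart_0 [simp]: "chart x 0 = x"
  by (cases x) auto

lemma inj_chart: "inj (chart x)"
  by (cases x) (auto simp: inj_on_def split: if_splits)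

lemma eventually_chart_notin:
  assumes "finite F" shows "\<forall>\<^sub>F w in at 0. chart x w \<notin> F"
proof -
  have "finite (chart x -` F)" using assms inj_chart by (rule finite_vimageI)
  then have "finite (chart x -` F - {0})" by simp
  then have "\<forall>\<^sub>F w in at 0. w \<in> - (chart x -` F - {0}) - {0}"
    by (intro eventually_at_in_open open_Compl finite_imp_closed) auto
  then show ?thesis by eventually_elim auto
qed

lemma holo_at_isCont: "holo_at x f \<Longrightarrow> isCont (\<lambda>w. f (chart x w)) 0"
  unfolding holo_at_def by (rule analytic_at_imp_isCont)

lemma holo_at_agree:
  assumes "holo_at x f" "holo_at x g" "finite {y. f y \<noteq> g y}"
  shows "f x = g x" "df x f = df x g"
proof -
  have ev: "\<forall>\<^sub>F w in at 0. f (chart x w) = g (chart x w)"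
    using eventually_chart_notin[OF assms(3), of x] by simp
  have "((\<lambda>w. f (chart x w)) \<longlongrightarrow> f x) (at 0)" "((\<lambda>w. g (chart x w)) \<longlongrightarrow> g x) (at 0)"
    using assms(1,2)[THEN holo_at_isCont] by (auto simp: isCont_def)
  note lim = this
  have "((\<lambda>w. g (chart x w)) \<longlongrightarrow> f x) (at 0)"
    by (rule Lim_transform_eventually[OF lim(1) ev])
  then show eq: "f x = g x"
    by (rule tendsto_unique[OF at_neq_bot _ lim(2)])
  have "\<forall>\<^sub>F w in nhds 0. f (chart x w) = g (chart x w)"
    using ev eq by (simp add: eventually_nhds_conv_at)
  then show "df x f = df x g"
    unfolding df_def by (rule deriv_cong_ev) simp
qed

lemma holo_at_const [simp]: "holo_at x (\<lambda>_. c)"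
  by (simp add: holo_at_def)

lemma holo_at_add: "holo_at x f \<Longrightarrow> holo_at x g \<Longrightarrow> holo_at x (\<lambda>y. f y + g y)"
  unfolding holo_at_def by (rule analytic_on_add)

lemma holo_at_diff: "holo_at x f \<Longrightarrow> holo_at x g \<Longrightarrow> holo_at x (\<lambda>y. f y - g y)"
  unfolding holo_at_def by (rule analytic_on_diff)

lemma holo_at_mult: "holo_at x f \<Longrightarrow> holo_at x g \<Longrightarrow> holo_at x (\<lambda>y. f y * g y)"
  unfolding holo_at_def by (rule analytic_on_mult)

lemma holo_at_divide: "holo_at x f \<Longrightarrow> holo_at x g \<Longrightarrow> g x \<noteq> 0 \<Longrightarrow> holo_at x (\<lambda>y. f y / g y)"
  unfolding holo_at_def by (rule analytic_on_divide) simp_all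

lemma holo_at_has_df: "holo_at x f \<Longrightarrow> ((\<lambda>w. f (chart x w)) has_field_derivative df x f) (at 0)"
  unfolding holo_at_def df_def
  using analytic_on_imp_differentiable_at DERIV_deriv_iff_field_differentiable by blast

lemma df_const [simp]: "df x (\<lambda>_. c) = 0"
  by (simp add: df_def)

lemma df_add: "holo_at x f \<Longrightarrow> holo_at x g \<Longrightarrow> df x (\<lambda>y. f y + g y) = df x f + df x g"
  unfolding df_def[of x "\<lambda>y. f y + g y"]
  by (rule DERIV_imp_deriv) (intro DERIV_add holo_at_has_df)

lemma df_mult: "holo_at x f \<Longrightarrow> holo_at x g \<Longrightarrow> df x (\<lambda>y. f y * g y) = df x f * g x + f x * df x g"
  unfolding df_def[of x "\<lambda>y. f y * g y"]
  by (rule DERIV_imp_deriv)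
     (use DERIV_mult[OF holo_at_has_df[of x f] holo_at_has_df[of x g]] in \<open>simp add: mult.commute add.commute\<close>)

lemma mero_fun_diff: "mero_fun f \<Longrightarrow> mero_fun g \<Longrightarrow> mero_fun (\<lambda>y. f y - g y)"
  and mero_fun_divide: "mero_fun f \<Longrightarrow> mero_fun g \<Longrightarrow> mero_fun (\<lambda>y. f y / g y)"
  by (auto simp: mero_fun_def intro!: meromorphic_intros)

lemma mero_fun_diff_const: "mero_fun f \<Longrightarrow> mero_fun (\<lambda>x. f x - c)"
  by (rule mero_fun_diff[OF _ mero_fun_const])

text \<open>Near infinity there are no singularities except possibly infinity itself. In the remaining closed disc
  they are finitely many, as they are isolated and the disc is compact.\<close>
lemma finite_not_holo_at:
  assumes f: "mero_fun f" shows "finite {x. \<not> holo_at x f}"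
proof -
  define G where "G c = (\<lambda>w. f (Fin (c + w)))" for c
  have G: "G 0 analytic_on {c} \<longleftrightarrow> holo_at (Fin c) f" for c
  proof -
    have "G 0 analytic_on {c}" if "G c analytic_on {0}"
    proof -
      have "(G c \<circ> (\<lambda>w. w - c)) analytic_on {c}"
        by (rule analytic_on_compose) (use that in \<open>auto intro!: analytic_intros\<close>)
      then show ?thesis by (simp add: o_def G_def)
    qed
    moreover have "G c analytic_on {0}" if "G 0 analytic_on {c}"
    proof -
      have "(G 0 \<circ> (\<lambda>w. c + w)) analytic_on {0}"
        by (rule analytic_on_compose) (use that in \<open>auto intro!: analytic_intros\<close>)
      then show ?thesis by (simp add: o_def G_def)
    qed
    ultimately show ?thesis by (auto simp: holo_at_def G_def)
  qed
  have mero: "G 0 meromorphic_on UNIV"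
  proof -
    have "G 0 meromorphic_on {c}" for c
    proof -
      have "(\<lambda>w. G c (w - c)) meromorphic_on {c}"
        by (rule meromorphic_on_compose[of _ "{0}"])
           (use f[unfolded mero_fun_def, rule_format, of "Fin c"] in \<open>auto simp: G_def intro!: analytic_intros\<close>)
      then show ?thesis by (simp add: G_def)
    qed
    then show ?thesis by (meson meromorphic_on_meromorphic_at)
  qed
  have "(\<lambda>w. f (chart Inf w)) meromorphic_on {0}"
    using f unfolding mero_fun_def by blast
  then have "isolated_singularity_at (\<lambda>w. f (chart Inf w)) 0"
    by (rule meromorphic_on_isolated_singularity)
  then obtain r where r: "r > 0" "(\<lambda>w. f (chart Inf w)) analytic_on ball 0 r - {0}"
    by (auto simp: isolated_singularity_at_def)
  have far: "G 0 analytic_on {c}" if "norm c > 1 / r" for c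
  proof -
    have c: "c \<noteq> 0" using that r by auto
    have "((\<lambda>w. f (chart Inf w)) \<circ> inverse) analytic_on {c}"
    proof (rule analytic_on_compose)
      show "inverse analytic_on {c}" using c by (intro analytic_intros) auto
      have "inverse c \<in> ball 0 r - {0}"
        using that r c by (auto simp: norm_inverse field_simps norm_divide)
      then show "(\<lambda>w. f (chart Inf w)) analytic_on inverse ` {c}"
        using analytic_on_subset[OF r(2)] by auto
    qed
    moreover have "\<forall>\<^sub>F w in nhds c. ((\<lambda>w. f (chart Inf w)) \<circ> inverse) w = G 0 w"
      using t1_space_nhds[OF c] by eventually_elim (auto simp: G_def field_simps)
    ultimately show ?thesis by (subst (asm) analytic_at_cong[OF _ refl]) auto
  qed
  let ?N = "{c. \<not> G 0 analytic_on {c}}"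
  have "?N sparse_in UNIV"
    by (rule meromorphic_on_imp_sparse_singularities[OF mero])
  then have "?N sparse_in cball 0 (1 / r)" by (rule sparse_in_subset) auto
  then have "finite (cball 0 (1 / r) \<inter> ?N)" by (rule sparse_in_compact_finite) simp
  moreover have "?N \<subseteq> cball 0 (1 / r) \<inter> ?N" using far by (auto intro!: leI)
  ultimately have "finite ?N" by (metis finite_subset)
  moreover have "{x. \<not> holo_at x f} \<subseteq> insert Inf (Fin ` ?N)"
  proof
    fix x assume "x \<in> {x. \<not> holo_at x f}"
    then show "x \<in> insert Inf (Fin ` ?N)" by (cases x) (auto simp: G)
  qed
  ultimately show ?thesis by (meson finite_imageI finite_insert finite_subset)
qed

section \<open>Representations of meromorphic maps\<close>

text \<open>The differential at \<open>x\<close> of the map given by a list.\<close>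
definition dlincomb :: "((cp1 \<Rightarrow> complex) \<times> 'g::complex_lie_algebra) list \<Rightarrow> cp1 \<Rightarrow> 'g" where
  "dlincomb fs x = (\<Sum>(f, a)\<leftarrow>fs. df x f *\<^sub>C a)"

text \<open>Lists that represent a meromorphic map, and lists that represent it by functions holomorphic at \<open>x\<close>.\<close>
definition mero_list :: "((cp1 \<Rightarrow> complex) \<times> 'g::complex_lie_algebra) list \<Rightarrow> bool" where
  "mero_list fs \<longleftrightarrow> (\<forall>(f, a)\<in>set fs. mero_fun f)"

definition holo_list :: "cp1 \<Rightarrow> ((cp1 \<Rightarrow> complex) \<times> 'g::complex_lie_algebra) list \<Rightarrow> bool" where
  "holo_list x fs \<longleftrightarrow> (\<forall>(f, a)\<in>set fs. mero_fun f \<and> holo_at x f)"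

lemma holo_list_mero_list: "holo_list x fs \<Longrightarrow> mero_list fs"
  by (auto simp: holo_list_def mero_list_def)

lemma mero_list_mero_map: "mero_list fs \<Longrightarrow> mero_map (lincomb fs)"
  unfolding mero_map_def mero_list_def by blast

lemma lincomb_Nil [simp]: "lincomb [] x = 0" "dlincomb [] x = 0"
  and lincomb_Cons [simp]: "lincomb ((f, a) # fs) x = f x *\<^sub>C a + lincomb fs x"
    "dlincomb ((f, a) # fs) x = df x f *\<^sub>C a + dlincomb fs x"
  and lincomb_append [simp]: "lincomb (fs @ gs) x = lincomb fs x + lincomb gs x"
    "dlincomb (fs @ gs) x = dlincomb fs x + dlincomb gs x"
  by (auto simp: lincomb_def dlincomb_def)

lemma mero_list_simps [simp]: "mero_list []" "mero_list ((f, a) # fs) \<longleftrightarrow> mero_fun f \<and> mero_list fs"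
    "mero_list (fs @ gs) \<longleftrightarrow> mero_list fs \<and> mero_list gs"
    "holo_list x []" "holo_list x ((f, a) # fs) \<longleftrightarrow> mero_fun f \<and> holo_at x f \<and> holo_list x fs"
    "holo_list x (fs @ gs) \<longleftrightarrow> holo_list x fs \<and> holo_list x gs"
  by (auto simp: holo_list_def mero_list_def)

lemma functional_lincomb:
  assumes "holo_list x fs" "linear_form \<xi>"
  shows "holo_at x (\<lambda>y. \<xi> (lincomb fs y))" "df x (\<lambda>y. \<xi> (lincomb fs y)) = \<xi> (dlincomb fs x)"
proof -
  have "holo_at x (\<lambda>y. \<xi> (lincomb fs y)) \<and> df x (\<lambda>y. \<xi> (lincomb fs y)) = \<xi> (dlincomb fs x)"
    using assms(1)
  proof (induction fs)
    case Nil
    then show ?case by (simp add: linear_form_0[OF assms(2)])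
  next
    case (Cons p fs)
    obtain f a where p: "p = (f, a)" by force
    have eq: "(\<lambda>y. \<xi> (lincomb (p # fs) y)) = (\<lambda>y. f y * \<xi> a + \<xi> (lincomb fs y))"
      by (simp add: p linear_form_add[OF assms(2)] linear_form_scaleC[OF assms(2)])
    show ?case
      unfolding eq using Cons
      by (simp add: p holo_at_add holo_at_mult df_add df_mult linear_form_add[OF assms(2)] linear_form_scaleC[OF assms(2)])
  qed
  then show "holo_at x (\<lambda>y. \<xi> (lincomb fs y))" "df x (\<lambda>y. \<xi> (lincomb fs y)) = \<xi> (dlincomb fs x)"
    by auto
qed

lemma mero_of_eq_iff:
  assumes "mero_list fs" "mero_list gs"
  shows "mero_of fs = mero_of gs \<longleftrightarrow> finite {x. lincomb fs x \<noteq> lincomb gs x}"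
proof -
  have "mero_eq (lincomb fs) (lincomb fs)" "mero_eq (lincomb gs) (lincomb gs)"
    using assms by (auto simp: mero_eq_def mero_list_mero_map)
  then have "mero_of fs = mero_of gs \<longleftrightarrow> mero_eq (lincomb fs) (lincomb gs)"
    unfolding mero_of_def using Quotient_rel[OF Quotient_mero] by blast
  with assms show ?thesis by (simp add: mero_eq_def mero_list_mero_map)
qed

lemma mero_of_cong: "mero_list fs \<Longrightarrow> mero_list gs \<Longrightarrow> (\<And>x. lincomb fs x = lincomb gs x) \<Longrightarrow> mero_of fs = mero_of gs"
  by (simp add: mero_of_eq_iff)

lemma mero_exhaust:
  fixes \<alpha> :: "'g::complex_lie_algebra mero"
  obtains fs where "mero_list fs" "\<alpha> = mero_of fs"
proof -
  have "mero_eq (rep_mero \<alpha>) (rep_mero \<alpha>)"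
    by (rule Quotient_rep_reflp[OF Quotient_mero])
  then obtain fs where fs: "mero_list fs" "rep_mero \<alpha> = lincomb fs"
    unfolding mero_eq_def mero_map_def mero_list_def by blast
  then have "\<alpha> = mero_of fs"
    unfolding mero_of_def by (metis Quotient_abs_rep[OF Quotient_mero])
  with fs that show ?thesis by blast
qed

lemma mero_of_append:
  assumes "mero_list fs" "mero_list gs" shows "mero_of (fs @ gs) = mero_of fs + mero_of gs"
proof -
  have "lincomb (fs @ gs) = (\<lambda>x. lincomb fs x + lincomb gs x)" by auto
  with assms show ?thesis unfolding mero_of_def
    by (subst plus_mero.abs_eq) (auto simp: mero_eq_def mero_list_mero_map)
qed

lemma mero_of_Nil: "mero_of [] = 0"
  by (simp add: mero_of_def zero_mero_def lincomb_def[abs_def])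

lemma mero_of_Cons:
  assumes "mero_fun f" "mero_list fs" shows "mero_of ((f, a) # fs) = mero_of [(f, a)] + mero_of fs"
  using mero_of_append[of "[(f, a)]" fs] assms by simp

text \<open>Representations of the product with a scalar function and of the pointwise Lie bracket.\<close>
definition scale_list :: "(cp1 \<Rightarrow> complex) \<Rightarrow> ((cp1 \<Rightarrow> complex) \<times> 'g::complex_lie_algebra) list
    \<Rightarrow> ((cp1 \<Rightarrow> complex) \<times> 'g) list" where
  "scale_list s fs = map (\<lambda>(f, a). (\<lambda>x. s x * f x, a)) fs"

definition lie_list :: "((cp1 \<Rightarrow> complex) \<times> 'g::complex_lie_algebra) list \<Rightarrow> ((cp1 \<Rightarrow> complex) \<times> 'g) list
    \<Rightarrow> ((cp1 \<Rightarrow> complex) \<times> 'g) list" where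
  "lie_list fs gs = concat (map (\<lambda>(f, a). map (\<lambda>(g, b). (\<lambda>x. f x * g x, lie a b)) gs) fs)"

lemma scale_list_simps [simp]: "scale_list s [] = []" "scale_list s ((f, a) # fs) = (\<lambda>x. s x * f x, a) # scale_list s fs"
  by (auto simp: scale_list_def)

lemma lincomb_scale_list: "lincomb (scale_list s fs) x = s x *\<^sub>C lincomb fs x"
  by (induction fs) (auto simp: scaleC_add_right scaleC_scaleC)

lemma holo_list_scale_list: "mero_fun s \<Longrightarrow> holo_at x s \<Longrightarrow> holo_list x fs \<Longrightarrow> holo_list x (scale_list s fs)"
  by (induction fs) (auto intro: mero_fun_times holo_at_mult)

lemma dlincomb_scale_list_const: "holo_list x fs \<Longrightarrow> dlincomb (scale_list (\<lambda>_. c) fs) x = c *\<^sub>C dlincomb fs x"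
  by (induction fs) (auto simp: scaleC_add_right scaleC_scaleC df_mult)

lemma lie_list_props:
  shows "lincomb (lie_list fs gs) x = lie (lincomb fs x) (lincomb gs x)"
    and "mero_list fs \<Longrightarrow> mero_list gs \<Longrightarrow> mero_list (lie_list fs gs)"
    and "holo_list x fs \<Longrightarrow> holo_list x gs \<Longrightarrow> holo_list x (lie_list fs gs)"
    and "holo_list x fs \<Longrightarrow> holo_list x gs \<Longrightarrow>
      dlincomb (lie_list fs gs) x = lie (dlincomb fs x) (lincomb gs x) + lie (lincomb fs x) (dlincomb gs x)"
proof -
  define L where "L f a gs = map (\<lambda>(g, b). (\<lambda>x. f x * g x, lie a b)) gs"
    for f :: "cp1 \<Rightarrow> complex" and a :: 'a and gs :: "((cp1 \<Rightarrow> complex) \<times> 'a) list"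
  have L: "lie_list [] gs = []" "lie_list ((f, a) # fs) gs = L f a gs @ lie_list fs gs" for f a fs
    by (auto simp: lie_list_def L_def)
  have L0: "L f a [] = []" "L f a ((g, b) # gs) = (\<lambda>x. f x * g x, lie a b) # L f a gs" for f a g b gs
    by (auto simp: L_def)
  have 1: "lincomb (L f a gs) x = lie (f x *\<^sub>C a) (lincomb gs x)" for f a
    by (induction gs) (auto simp: L0 lie_add_right lie_scaleC_left lie_scaleC_right scaleC_add_right scaleC_scaleC)
  have 2: "mero_fun f \<Longrightarrow> mero_list gs \<Longrightarrow> mero_list (L f a gs)" for f a
    by (induction gs) (auto simp: L0 intro: mero_fun_times)
  have 3: "mero_fun f \<Longrightarrow> holo_at x f \<Longrightarrow> holo_list x gs \<Longrightarrow> holo_list x (L f a gs)" for f a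
    by (induction gs) (auto simp: L0 intro: mero_fun_times holo_at_mult)
  have 4: "holo_at x f \<Longrightarrow> holo_list x gs \<Longrightarrow>
      dlincomb (L f a gs) x = lie (df x f *\<^sub>C a) (lincomb gs x) + lie (f x *\<^sub>C a) (dlincomb gs x)" for f a
    by (induction gs)
       (auto simp: L0 df_mult lie_add_right lie_scaleC_left lie_scaleC_right
          scaleC_add_right scaleC_add_left scaleC_scaleC algebra_simps)
  show "lincomb (lie_list fs gs) x = lie (lincomb fs x) (lincomb gs x)"
    by (induction fs) (auto simp: L 1 lie_add_left)
  show "mero_list fs \<Longrightarrow> mero_list gs \<Longrightarrow> mero_list (lie_list fs gs)"
    by (induction fs) (auto simp: L 2)
  show "holo_list x fs \<Longrightarrow> holo_list x gs \<Longrightarrow> holo_list x (lie_list fs gs)"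
    by (induction fs) (auto simp: L 3)
  show "holo_list x fs \<Longrightarrow> holo_list x gs \<Longrightarrow>
      dlincomb (lie_list fs gs) x = lie (dlincomb fs x) (lincomb gs x) + lie (lincomb fs x) (dlincomb gs x)"
    by (induction fs) (auto simp: L 4 lie_add_left algebra_simps)
qed

lemma mero_of_lie:
  assumes "mero_list fs" "mero_list gs" shows "mero_of (lie_list fs gs) = lie (mero_of fs) (mero_of gs)"
proof -
  have "lincomb (lie_list fs gs) = (\<lambda>x. lie (lincomb fs x) (lincomb gs x))"
    by (auto simp: lie_list_props(1))
  with assms show ?thesis unfolding mero_of_def
    by (subst lie_mero.abs_eq) (auto simp: mero_eq_def mero_list_mero_map)
qed

lemma mero_of_scaleC:
  assumes "mero_list fs" shows "mero_of (scale_list (\<lambda>_. c) fs) = c *\<^sub>C mero_of fs"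
proof -
  have "lincomb (scale_list (\<lambda>_. c) fs) = (\<lambda>x. c *\<^sub>C lincomb fs x)"
    by (auto simp: lincomb_scale_list)
  with assms show ?thesis unfolding mero_of_def
    by (subst scaleC_mero.abs_eq) (auto simp: mero_eq_def mero_list_mero_map)
qed

section \<open>Values and differentials\<close>

lemma regular_at_iff: "regular_at x \<alpha> \<longleftrightarrow> (\<exists>fs. holo_list x fs \<and> \<alpha> = mero_of fs)"
  by (simp add: regular_at_def holo_repr_def holo_list_def)

text \<open>Value and differential at \<open>x\<close> do not depend on the representation: apply linear functionals.\<close>
lemma mero_of_eq_imp:
  assumes "holo_list x fs" "holo_list x gs" "mero_of fs = mero_of gs"
  shows "lincomb fs x = lincomb gs x \<and> dlincomb fs x = dlincomb gs x"
proof -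
  have fin: "finite {y. lincomb fs y \<noteq> lincomb gs y}"
    using assms mero_of_eq_iff[of fs gs] by (simp add: holo_list_mero_list)
  have "\<xi> (lincomb fs x) = \<xi> (lincomb gs x) \<and> \<xi> (dlincomb fs x) = \<xi> (dlincomb gs x)" if "linear_form \<xi>" for \<xi>
  proof -
    have "finite {y. \<xi> (lincomb fs y) \<noteq> \<xi> (lincomb gs y)}"
      by (rule finite_subset[OF _ fin]) auto
    from holo_at_agree[OF functional_lincomb(1)[OF assms(1) that] functional_lincomb(1)[OF assms(2) that] this]
    show ?thesis
      using functional_lincomb(2)[OF assms(1) that] functional_lincomb(2)[OF assms(2) that] by simp
  qed
  then show ?thesis by (blast intro: linear_form_eqI)
qed

lemma val_mero_of: "holo_list x fs \<Longrightarrow> val (mero_of fs) x = lincomb fs x"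
  and dval_mero_of: "holo_list x fs \<Longrightarrow> dval (mero_of fs) x = dlincomb fs x"
proof -
  assume fs: "holo_list x fs"
  have r: "holo_repr x gs (mero_of fs) \<longleftrightarrow> holo_list x gs \<and> mero_of fs = mero_of gs" for gs
    by (simp add: holo_repr_def holo_list_def)
  show "val (mero_of fs) x = lincomb fs x"
    unfolding val_def r lincomb_def[symmetric]
    by (rule the_equality, rule exI[of _ fs], use fs in simp, elim exE conjE,
        use mero_of_eq_imp[OF fs] in simp)
  show "dval (mero_of fs) x = dlincomb fs x"
    unfolding dval_def r dlincomb_def[symmetric]
    by (rule the_equality, rule exI[of _ fs], use fs in simp, elim exE conjE,
        use mero_of_eq_imp[OF fs] in simp)
qed

lemma
  assumes "regular_at x \<alpha>" "regular_at x \<beta>"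
  shows regular_at_add: "regular_at x (\<alpha> + \<beta>)"
    and val_add: "val (\<alpha> + \<beta>) x = val \<alpha> x + val \<beta> x"
    and dval_add: "dval (\<alpha> + \<beta>) x = dval \<alpha> x + dval \<beta> x"
    and regular_at_lie: "regular_at x (lie \<alpha> \<beta>)"
    and val_lie: "val (lie \<alpha> \<beta>) x = lie (val \<alpha> x) (val \<beta> x)"
    and dval_lie: "dval (lie \<alpha> \<beta>) x = lie (dval \<alpha> x) (val \<beta> x) + lie (val \<alpha> x) (dval \<beta> x)"
proof -
  obtain fs gs where *: "holo_list x fs" "\<alpha> = mero_of fs" "holo_list x gs" "\<beta> = mero_of gs"
    using assms by (auto simp: regular_at_iff)
  then have add: "\<alpha> + \<beta> = mero_of (fs @ gs)" and lie: "lie \<alpha> \<beta> = mero_of (lie_list fs gs)"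
    by (simp_all add: mero_of_append mero_of_lie holo_list_mero_list)
  have h: "holo_list x (fs @ gs)" "holo_list x (lie_list fs gs)" using * by (simp_all add: lie_list_props)
  show "regular_at x (\<alpha> + \<beta>)" "regular_at x (lie \<alpha> \<beta>)"
    using add lie h unfolding regular_at_iff by blast+
  show "val (\<alpha> + \<beta>) x = val \<alpha> x + val \<beta> x" "dval (\<alpha> + \<beta>) x = dval \<alpha> x + dval \<beta> x"
    unfolding add using * h by (simp_all add: val_mero_of dval_mero_of)
  show "val (lie \<alpha> \<beta>) x = lie (val \<alpha> x) (val \<beta> x)"
    "dval (lie \<alpha> \<beta>) x = lie (dval \<alpha> x) (val \<beta> x) + lie (val \<alpha> x) (dval \<beta> x)"
    unfolding lie using * h by (simp_all add: val_mero_of dval_mero_of lie_list_props)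
qed

lemma
  assumes "regular_at x \<alpha>"
  shows regular_at_scaleC: "regular_at x (c *\<^sub>C \<alpha>)"
    and val_scaleC: "val (c *\<^sub>C \<alpha>) x = c *\<^sub>C val \<alpha> x"
    and dval_scaleC: "dval (c *\<^sub>C \<alpha>) x = c *\<^sub>C dval \<alpha> x"
proof -
  obtain fs where *: "holo_list x fs" "\<alpha> = mero_of fs"
    using assms by (auto simp: regular_at_iff)
  then have eq: "c *\<^sub>C \<alpha> = mero_of (scale_list (\<lambda>_. c) fs)"
    by (simp add: mero_of_scaleC holo_list_mero_list)
  have h: "holo_list x (scale_list (\<lambda>_. c) fs)" using * by (intro holo_list_scale_list mero_fun_const holo_at_const)
  show "regular_at x (c *\<^sub>C \<alpha>)"
    using eq h unfolding regular_at_iff by blast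
  show "val (c *\<^sub>C \<alpha>) x = c *\<^sub>C val \<alpha> x" "dval (c *\<^sub>C \<alpha>) x = c *\<^sub>C dval \<alpha> x"
    unfolding eq using * h
    by (simp_all add: val_mero_of dval_mero_of lincomb_scale_list dlincomb_scale_list_const)
qed

lemma
  assumes "regular_at x \<alpha>"
  shows regular_at_minus: "regular_at x (- \<alpha>)"
    and val_minus: "val (- \<alpha>) x = - val \<alpha> x"
  using regular_at_scaleC[OF assms, of "-1"] val_scaleC[OF assms, of "-1"]
  by (auto simp: scaleC_minus_left scaleC_one)

lemma
  assumes "regular_at x \<alpha>" "regular_at x \<beta>"
  shows regular_at_diff: "regular_at x (\<alpha> - \<beta>)"
    and val_diff: "val (\<alpha> - \<beta>) x = val \<alpha> x - val \<beta> x"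
  using regular_at_add[OF assms(1) regular_at_minus[OF assms(2)]]
    val_add[OF assms(1) regular_at_minus[OF assms(2)]] val_minus[OF assms(2)] by auto

lemma holo_list_const: "holo_list x [(\<lambda>_. c, a)]"
  by (simp add: mero_fun_const)

lemma regular_at_const [simp]: "regular_at x (const_map a)"
  and val_const [simp]: "val (const_map a) x = a"
  and dval_const [simp]: "dval (const_map a) x = 0"
proof -
  show "regular_at x (const_map a)"
    unfolding regular_at_iff const_map_def using holo_list_const by blast
  show "val (const_map a) x = a" "dval (const_map a) x = 0"
    unfolding const_map_def using holo_list_const[of x 1 a]
    by (simp_all add: val_mero_of dval_mero_of scaleC_one)
qed

lemma const_map_add: "const_map (a + b) = const_map a + const_map b"
proof -
  have "const_map (a + b) = mero_of ([(\<lambda>_. 1, a)] @ [(\<lambda>_. 1, b)])"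
    unfolding const_map_def by (rule mero_of_cong) (auto simp: mero_fun_const scaleC_add_right)
  then show ?thesis by (simp only: mero_of_append const_map_def mero_list_simps mero_fun_const simp_thms)
qed

lemma const_map_scaleC: "const_map (c *\<^sub>C a) = c *\<^sub>C const_map a"
proof -
  have "const_map (c *\<^sub>C a) = mero_of (scale_list (\<lambda>_. c) [(\<lambda>_. 1, a)])"
    unfolding const_map_def by (rule mero_of_cong) (auto simp: mero_fun_const scaleC_one)
  then show ?thesis by (simp add: mero_of_scaleC const_map_def mero_fun_const del: scale_list_simps)
qed

lemma const_map_lie: "const_map (lie a b) = lie (const_map a) (const_map b)"
proof -
  have "const_map (lie a b) = mero_of (lie_list [(\<lambda>_. 1, a)] [(\<lambda>_. 1, b)])"
    unfolding const_map_def by (simp add: lie_list_def)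
  then show ?thesis by (simp add: mero_of_lie const_map_def mero_fun_const)
qed

lemma const_map_0: "const_map 0 = 0"
  using const_map_scaleC[of 0 0] by simp

lemma regular_at_0 [simp]: "regular_at x 0" and val_0 [simp]: "val 0 x = 0"
  using regular_at_const[of x 0] val_const[of 0 x] by (simp_all only: const_map_0)

lemma lie_sub_maps: "lie_sub (maps S)"
  by (auto simp: lie_sub_def maps_def regular_at_add regular_at_lie regular_at_scaleC)

lemma lie_sub_maps0: "lie_sub (maps0 P S)"
  using lie_sub_maps[of "insert P S"]
  by (auto simp: lie_sub_def maps0_def maps_def val_add val_lie val_scaleC)

lemma finite_not_regular: "finite {x. \<not> regular_at x \<alpha>}"
proof -
  obtain fs where fs: "mero_list fs" "\<alpha> = mero_of fs" by (rule mero_exhaust)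
  have "finite (\<Union>(f, a)\<in>set fs. {x. \<not> holo_at x f})"
    using fs finite_not_holo_at by (auto simp: mero_list_def)
  moreover have "{x. \<not> regular_at x \<alpha>} \<subseteq> (\<Union>(f, a)\<in>set fs. {x. \<not> holo_at x f})"
    using fs by (force simp: regular_at_iff holo_list_def mero_list_def)
  ultimately show ?thesis by (rule finite_subset[rotated])
qed

text \<open>A map whose differential vanishes off a finite set is constant. If it also vanishes at a point, it is
  zero.\<close>
lemma dval_zero_imp_zero:
  fixes \<alpha> :: "'g::complex_lie_algebra mero"
  assumes F: "finite F" and zero: "\<And>x. x \<notin> F \<Longrightarrow> regular_at x \<alpha> \<Longrightarrow> dval \<alpha> x = 0"
    and P: "regular_at P \<alpha>" "val \<alpha> P = 0"
  shows "\<alpha> = 0"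
proof -
  obtain fs where fs: "mero_list fs" "\<alpha> = mero_of fs" by (rule mero_exhaust)
  obtain gs where gs: "holo_list P gs" "\<alpha> = mero_of gs" using P by (auto simp: regular_at_iff)
  have gsP: "lincomb gs P = 0" using P gs by (simp add: val_mero_of)
  have fsgs: "finite {x. lincomb fs x \<noteq> lincomb gs x}"
    using fs gs mero_of_eq_iff[of fs gs] by (simp add: holo_list_mero_list)
  define N where "N = F \<union> insert Inf (\<Union>(f, a)\<in>set fs. {x. \<not> holo_at x f})"
  have N: "finite N"
    using fs F finite_not_holo_at by (auto simp: mero_list_def N_def)
  have holN: "holo_list x fs" if "x \<notin> N" for x
    using that fs by (auto simp: N_def holo_list_def mero_list_def)
  have "\<xi> (lincomb fs x) = 0" if xi: "linear_form \<xi>" and x: "x \<notin> N" for \<xi> x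
  proof -
    \<comment> \<open>The plane without finitely many points is connected.\<close>
    define S where "S = UNIV - Fin -` N"
    have finv: "finite (Fin -` N)" using N by (intro finite_vimageI) (auto simp: inj_on_def)
    have S: "open S" "connected S"
      unfolding S_def using finv by (auto intro!: connected_open_delete_finite open_Diff finite_imp_closed)
    have der: "((\<lambda>w. \<xi> (lincomb fs (Fin w))) has_field_derivative 0) (at v)" if "v \<in> S" for v
    proof -
      have v: "Fin v \<notin> N" using that by (simp add: S_def)
      have "regular_at (Fin v) \<alpha>" using holN[OF v] fs by (auto simp: regular_at_iff)
      moreover have "Fin v \<notin> F" using v by (auto simp: N_def)
      ultimately have "dlincomb fs (Fin v) = 0"
        using zero[of "Fin v"] holN[OF v] fs by (simp add: dval_mero_of)
      then have "((\<lambda>w. \<xi> (lincomb fs (chart (Fin v) w))) has_field_derivative 0) (at 0)"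
        using holo_at_has_df[OF functional_lincomb(1)[OF holN[OF v] xi]]
        by (simp add: functional_lincomb(2)[OF holN[OF v] xi] linear_form_0[OF xi])
      then have "((\<lambda>w. \<xi> (lincomb fs (Fin (w + v)))) has_field_derivative 0) (at 0)"
        by (simp add: add.commute)
      then show ?thesis using DERIV_shift[of "\<lambda>w. \<xi> (lincomb fs (Fin w))" 0 0 v] by simp
    qed
    have "(\<lambda>w. \<xi> (lincomb fs (Fin w))) constant_on S"
      by (rule has_field_derivative_0_imp_constant_on) (use der S in auto)
    then obtain c where c: "\<And>w. w \<in> S \<Longrightarrow> \<xi> (lincomb fs (Fin w)) = c"
      by (auto simp: constant_on_def)
    have cN: "\<xi> (lincomb fs y) = c" if "y \<notin> N" for y
      using that c by (cases y) (auto simp: S_def N_def)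
    have "\<forall>\<^sub>F w in at 0. \<xi> (lincomb gs (chart P w)) = c"
      using eventually_chart_notin[OF N, of P] eventually_chart_notin[OF fsgs, of P]
      by eventually_elim (metis (mono_tags, lifting) cN mem_Collect_eq)
    moreover have "((\<lambda>w. \<xi> (lincomb gs (chart P w))) \<longlongrightarrow> 0) (at 0)"
      using holo_at_isCont[OF functional_lincomb(1)[OF gs(1) xi]]
      by (simp add: isCont_def gsP linear_form_0[OF xi])
    ultimately have "((\<lambda>_. c) \<longlongrightarrow> 0) (at (0::complex))"
      by (rule Lim_transform_eventually[rotated])
    then have "c = 0" by (simp add: tendsto_const_iff)
    with cN[OF x] show ?thesis by simp
  qed
  then have "lincomb fs x = 0" if "x \<notin> N" for x
    using that by (blast intro: linear_form_separates)
  then have "{x. lincomb fs x \<noteq> lincomb [] x} \<subseteq> N" by auto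
  then have "finite {x. lincomb fs x \<noteq> lincomb [] x}" using N by (rule finite_subset)
  then show ?thesis using mero_of_eq_iff[of fs "[]"] fs by (simp add: mero_of_Nil)
qed

section \<open>Multiplication by scalar functions\<close>

lemma mero_map_mmul: "mero_map \<alpha> \<Longrightarrow> mero_map (\<lambda>x. if mero_fun s then s x *\<^sub>C \<alpha> x else 0)"
  by (cases "mero_fun s") (simp_all add: mero_map_scale mero_map_0)

text \<open>The product of a meromorphic function and a meromorphic map. If \<open>s\<close> is not meromorphic, the dummy
  value \<open>0\<close> makes the definition total.\<close>
lift_definition mmul :: "(cp1 \<Rightarrow> complex) \<Rightarrow> 'g::complex_lie_algebra mero \<Rightarrow> 'g mero"
  is "\<lambda>s \<alpha> x. if mero_fun s then s x *\<^sub>C \<alpha> x else 0"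
proof -
  fix s and \<alpha> \<beta> :: "cp1 \<Rightarrow> 'g" assume "mero_eq \<alpha> \<beta>"
  moreover then have "finite {x. s x *\<^sub>C \<alpha> x \<noteq> s x *\<^sub>C \<beta> x}"
    by (auto simp: mero_eq_def elim!: finite_subset[rotated])
  ultimately show "mero_eq (\<lambda>x. if mero_fun s then s x *\<^sub>C \<alpha> x else 0) (\<lambda>x. if mero_fun s then s x *\<^sub>C \<beta> x else 0)"
    by (simp add: mero_eq_def mero_map_mmul)
qed

lemma mmul_mero_of:
  assumes "mero_fun s" "mero_list fs" shows "mmul s (mero_of fs) = mero_of (scale_list s fs)"
proof -
  have "lincomb (scale_list s fs) = (\<lambda>x. s x *\<^sub>C lincomb fs x)"
    by (auto simp: lincomb_scale_list)
  with assms show ?thesis unfolding mero_of_def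
    by (subst mmul.abs_eq) (auto simp: mero_eq_def mero_list_mero_map)
qed

lemma mmul_const: "mero_fun s \<Longrightarrow> mmul s (const_map a) = mero_of [(s, a)]"
  by (simp add: const_map_def mmul_mero_of mero_fun_const)

lemma mmul_add: "mmul s (\<alpha> + \<beta>) = mmul s \<alpha> + mmul s \<beta>"
  by transfer (rule mero_eqI, intro mero_map_mmul mero_map_add,
    auto simp: mero_eq_def fun_eq_iff scaleC_add_right)

lemma mmul_scaleC: "mmul s (c *\<^sub>C \<alpha>) = c *\<^sub>C mmul s \<alpha>"
  by transfer (rule mero_eqI, intro mero_map_mmul mero_map_scale_const,
    auto simp: mero_eq_def fun_eq_iff scaleC_scaleC mult.commute)

lemma mmul_lie_left: "mmul s (lie \<alpha> \<beta>) = lie (mmul s \<alpha>) \<beta>"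
  by transfer (rule mero_eqI, intro mero_map_mmul mero_map_lie,
    auto simp: mero_eq_def fun_eq_iff lie_scaleC_left)

lemma mmul_0: "mmul s 0 = 0"
  using mmul_scaleC[of s 0 0] by simp

lemma lie_anticomm: "lie x y = - lie y (x::'a::complex_lie_algebra)"
proof -
  have "lie x y + lie y x = 0"
    using lie_self[of "x + y"] unfolding lie_add_left lie_add_right by (simp add: lie_self add.commute)
  then show ?thesis by (simp add: eq_neg_iff_add_eq_0)
qed

lemma lie_minus_left: "lie (- x) y = - lie x (y::'a::complex_lie_algebra)"
  and lie_minus_right: "lie x (- y) = - lie x (y::'a::complex_lie_algebra)"
  using lie_scaleC_left[of "-1" x y] lie_scaleC_right[of x "-1" y]
  by (simp_all add: scaleC_minus_left scaleC_one)

lemma lie_diff_left: "lie (x - y) w = lie x w - lie y (w::'a::complex_lie_algebra)"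
  and lie_diff_right: "lie w (x - y) = lie w x - lie w (y::'a::complex_lie_algebra)"
  using lie_add_left[of x "- y" w] lie_add_right[of w x "- y"]
  by (simp_all add: lie_minus_left lie_minus_right)

lemma mmul_cong:
  assumes "mero_fun s" "mero_fun t" "finite {x. s x \<noteq> t x}" shows "mmul s \<alpha> = mmul t \<alpha>"
  using assms
proof (transfer fixing: s t)
  fix \<alpha> :: "cp1 \<Rightarrow> 'a" assume *: "mero_eq \<alpha> \<alpha>" "mero_fun s" "mero_fun t" "finite {x. s x \<noteq> t x}"
  have "finite {x. s x *\<^sub>C \<alpha> x \<noteq> t x *\<^sub>C \<alpha> x}"
    by (rule finite_subset[OF _ *(4)]) auto
  with * show "mero_eq (\<lambda>x. if mero_fun s then s x *\<^sub>C \<alpha> x else 0) (\<lambda>x. if mero_fun t then t x *\<^sub>C \<alpha> x else 0)"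
    by (simp add: mero_eq_def mero_map_scale)
qed

lemma scaleC_diff_left: "(c - d) *\<^sub>C x = c *\<^sub>C x - d *\<^sub>C (x::'a::complex_lie_algebra)"
  using scaleC_add_left[of "c - d" d x] by simp

lemma mmul_diff_const:
  assumes "mero_fun s" shows "mmul (\<lambda>x. s x - c) \<alpha> = mmul s \<alpha> - c *\<^sub>C \<alpha>"
proof -
  have "mero_fun (\<lambda>x. s x - c)" using assms by (intro mero_fun_diff mero_fun_const)
  with assms show ?thesis
    by (transfer fixing: s c)
       (rule mero_eqI, simp add: mero_eq_def mero_map_scale, simp add: fun_eq_iff scaleC_diff_left)
qed

lemma mmul_times_const:
  assumes "mero_fun s" shows "mmul (\<lambda>x. c * s x) \<alpha> = c *\<^sub>C mmul s \<alpha>"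
proof -
  have "mero_fun (\<lambda>x. c * s x)" using assms by (intro mero_fun_times mero_fun_const)
  with assms show ?thesis
    by (transfer fixing: s c)
       (rule mero_eqI, simp add: mero_eq_def mero_map_scale, simp add: fun_eq_iff scaleC_scaleC)
qed

lemma
  assumes "mero_fun s" "holo_at x s" "regular_at x \<alpha>"
  shows regular_at_mmul: "regular_at x (mmul s \<alpha>)"
    and val_mmul: "val (mmul s \<alpha>) x = s x *\<^sub>C val \<alpha> x"
proof -
  obtain fs where *: "holo_list x fs" "\<alpha> = mero_of fs"
    using assms by (auto simp: regular_at_iff)
  then have eq: "mmul s \<alpha> = mero_of (scale_list s fs)"
    using assms by (simp add: mmul_mero_of holo_list_mero_list)
  have h: "holo_list x (scale_list s fs)" using * assms by (intro holo_list_scale_list)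
  show "regular_at x (mmul s \<alpha>)"
    using eq h unfolding regular_at_iff by blast
  show "val (mmul s \<alpha>) x = s x *\<^sub>C val \<alpha> x"
    unfolding eq using * h by (simp add: val_mero_of lincomb_scale_list)
qed

text \<open>The function \<open>s\<close> has at most a simple pole at \<open>z\<close>: its product with every function that vanishes at
  \<open>z\<close> is, up to finitely many values, holomorphic at \<open>z\<close>.\<close>
definition simple_pole_at :: "cp1 \<Rightarrow> (cp1 \<Rightarrow> complex) \<Rightarrow> bool" where
  "simple_pole_at z s \<longleftrightarrow> (\<forall>f. mero_fun f \<longrightarrow> holo_at z f \<longrightarrow> f z = 0 \<longrightarrow>
     (\<exists>g. mero_fun g \<and> holo_at z g \<and> finite {x. g x \<noteq> s x * f x}))"

lemma regular_at_mmul_pole: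
  fixes \<alpha> :: "'g::complex_lie_algebra mero"
  assumes s: "mero_fun s" "simple_pole_at z s" and \<alpha>: "regular_at z \<alpha>" "val \<alpha> z = 0"
  shows "regular_at z (mmul s \<alpha>)"
proof -
  obtain fs where fs: "holo_list z fs" "\<alpha> = mero_of fs"
    using \<alpha> by (auto simp: regular_at_iff)
  define sh :: "((cp1 \<Rightarrow> complex) \<times> 'g) list \<Rightarrow> _" where "sh = map (\<lambda>(f, a). (\<lambda>x. f x - f z, a))"
  have sh: "sh [] = []" "sh ((f, a) # fs) = (\<lambda>x. f x - f z, a) # sh fs" for f a fs
    by (auto simp: sh_def)
  have merosh: "mero_list (sh gs)" if "holo_list z gs" for gs
    using that by (induction gs) (auto simp: sh mero_fun_diff_const)
  \<comment> \<open>The functions in the list need not vanish at \<open>z\<close> themselves, but subtracting their values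
    at \<open>z\<close> does not change the map.\<close>
  have "lincomb (sh gs) x = lincomb gs x - lincomb gs z" for gs x
    by (induction gs) (auto simp: sh scaleC_diff_left)
  moreover have "lincomb fs z = 0" using fs \<alpha> by (simp add: val_mero_of)
  ultimately have "\<alpha> = mero_of (sh fs)"
    unfolding fs(2) using fs by (intro mero_of_cong) (auto simp: holo_list_mero_list merosh)
  moreover have "regular_at z (mmul s (mero_of (sh gs)))" if "holo_list z gs" for gs
    using that
  proof (induction gs)
    case Nil
    then show ?case by (simp add: sh mero_of_Nil mmul_0)
  next
    case (Cons p gs)
    obtain f a where p: "p = (f, a)" by force
    have f: "mero_fun (\<lambda>x. f x - f z)" "holo_at z (\<lambda>x. f x - f z)"
      using Cons.prems p by (auto intro: mero_fun_diff mero_fun_const holo_at_diff)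
    obtain g where g: "mero_fun g" "holo_at z g" "finite {x. g x \<noteq> s x * (f x - f z)}"
      using s(2)[unfolded simple_pole_at_def, rule_format, OF f] by auto
    have "mmul s (mero_of [(\<lambda>x. f x - f z, a)]) = mero_of [(\<lambda>x. s x * (f x - f z), a)]"
      using s f by (simp add: mmul_mero_of)
    also have "\<dots> = mmul (\<lambda>x. s x * (f x - f z)) (const_map a)"
      using s f by (simp add: mmul_const mero_fun_times)
    also have "\<dots> = mmul g (const_map a)"
      using s f g by (intro mmul_cong) (auto simp: mero_fun_times eq_commute)
    finally have "regular_at z (mmul s (mero_of [(\<lambda>x. f x - f z, a)]))"
      using g by (simp add: regular_at_mmul)
    with Cons f show ?case
      using mero_of_Cons[OF f(1) merosh[of gs]]
      by (simp add: p sh mmul_add regular_at_add)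
  qed
  ultimately show ?thesis using fs by simp
qed

section \<open>Coordinates\<close>

text \<open>By the simple pole of \<open>h\<close>, the function \<open>G\<close> grows at most linearly, so that Liouville's theorem applies.\<close>
lemma affine_if_simple_pole_at_infinity:
  fixes G h :: "complex \<Rightarrow> complex"
  assumes G: "\<And>v. G analytic_on {v}" and h: "\<And>w. w \<noteq> 0 \<Longrightarrow> h w = G (1 / w)"
    and pole: "is_pole h 0" "zorder h 0 = -1"
  shows "\<exists>r k. r \<noteq> 0 \<and> (\<forall>v. G v = r * v + k)"
proof -
  have holG: "G holomorphic_on UNIV"
    using G by (intro analytic_imp_holomorphic) (auto simp: analytic_on_analytic_at[of G UNIV])
  have "(\<lambda>w. G (1 / w)) holomorphic_on UNIV - {0}"
    by (rule holomorphic_on_compose[of "\<lambda>w. 1 / w" _ G, unfolded o_def])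
       (auto intro!: holomorphic_intros holomorphic_on_subset[OF holG])
  then have "h holomorphic_on UNIV - {0}"
    by (rule holomorphic_transform) (auto simp: h)
  from zorder_exist_pole[OF this _ _ pole(1)] obtain r where r: "r > 0"
      "zor_poly h 0 holomorphic_on cball 0 r"
      "\<And>w. w \<in> cball 0 r - {0} \<Longrightarrow> h w = zor_poly h 0 w / w"
    by (auto simp: pole(2))
  have "compact (zor_poly h 0 ` cball 0 r)"
    using r(2) by (intro compact_continuous_image holomorphic_on_imp_continuous_on) auto
  then obtain M where M: "\<And>w. w \<in> cball 0 r \<Longrightarrow> norm (zor_poly h 0 w) \<le> M"
    by (meson bounded_iff compact_imp_bounded imageI)
  have growth: "norm (G v) \<le> M * norm v ^ 1" if "1 / r \<le> norm v" for v
  proof -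
    have v: "v \<noteq> 0" using that r by auto
    have w: "1 / v \<in> cball 0 r - {0}"
      using that r v by (auto simp: norm_divide field_simps)
    have "G v = zor_poly h 0 (1 / v) * v"
      using h[of "1 / v"] r(3)[OF w] v by simp
    then have "norm (G v) = norm (zor_poly h 0 (1 / v)) * norm v" by (simp add: norm_mult)
    also have "\<dots> \<le> M * norm v" using w M[of "1 / v"] by (intro mult_right_mono) auto
    finally show ?thesis by simp
  qed
  define k c where "k = G 0" and "c = deriv G 0"
  have Gv: "G v = c * v + k" for v
    using Liouville_polynomial[OF holG growth, where \<xi> = v] by (simp add: k_def c_def)
  have "c \<noteq> 0"
  proof
    assume "c = 0"
    have "\<forall>\<^sub>F w in at 0. h w = k"
      by (auto simp: eventually_at_filter h Gv \<open>c = 0\<close>)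
    then have "(h \<longlongrightarrow> k) (at 0)" by (rule tendsto_eventually)
    with pole(1) show False
      unfolding is_pole_def by (metis at_neq_bot not_tendsto_and_filterlim_at_infinity)
  qed
  with Gv show ?thesis by blast
qed

lemma coordinate_holo_at:
  assumes "coordinate P u" "x \<noteq> P" shows "holo_at x u"
  using assms nicely_meromorphic_on_imp_analytic_at[of "\<lambda>w. u (chart x w)" "{0}" 0]
  by (auto simp: coordinate_def holo_at_def pole_at_def)

lemma coordinate_mero_fun: "coordinate P u \<Longrightarrow> mero_fun u"
  by (auto simp: coordinate_def mero_fun_def nicely_meromorphic_on_def)

lemma coordinate_Inf:
  assumes u: "coordinate Inf u"
  obtains r k where "r \<noteq> 0" "\<And>w. u (Fin w) = r * w + k"
proof -
  have "\<exists>r k. r \<noteq> 0 \<and> (\<forall>v. u (Fin v) = r * v + k)"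
  proof (rule affine_if_simple_pole_at_infinity[where h = "\<lambda>w. u (chart Inf w)"])
    fix c
    have "((\<lambda>w. u (chart (Fin c) w)) \<circ> (\<lambda>w. w - c)) analytic_on {c}"
      using coordinate_holo_at[OF u, of "Fin c"]
      by (intro analytic_on_compose) (auto simp: holo_at_def intro!: analytic_intros)
    then show "(\<lambda>v. u (Fin v)) analytic_on {c}" by (simp add: o_def)
  qed (use u in \<open>simp_all add: coordinate_def pole_at_def del: chart.simps, simp\<close>)
  with that show ?thesis by blast
qed

text \<open>Move the pole \<open>p\<close> to infinity by \<open>v = 1 / (w - p)\<close>.\<close>
lemma coordinate_Fin:
  assumes u: "coordinate (Fin p) u"
  obtains r k where "r \<noteq> 0" "u Inf = k" "\<And>w. w \<noteq> p \<Longrightarrow> u (Fin w) = r / (w - p) + k"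
proof -
  define G where "G v = (if v = 0 then u Inf else u (Fin (p + 1 / v)))" for v
  have "\<exists>r k. r \<noteq> 0 \<and> (\<forall>v. G v = r * v + k)"
  proof (rule affine_if_simple_pole_at_infinity)
    fix c
    show "G analytic_on {c}"
    proof (cases "c = 0")
      case True
      have "((\<lambda>w. u (chart Inf w)) \<circ> (\<lambda>v. v / (p * v + 1))) analytic_on {c}"
        using coordinate_holo_at[OF u, of Inf] True
        by (intro analytic_on_compose) (auto simp: holo_at_def intro!: analytic_intros)
      moreover have "\<forall>\<^sub>F v in nhds c. p * v + 1 \<noteq> 0"
      proof -
        have "open {v. p * v + 1 \<noteq> 0}"
          by (intro open_Collect_neq continuous_intros)
        then have "\<forall>\<^sub>F v in nhds c. v \<in> {v. p * v + 1 \<noteq> 0}"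
          by (rule eventually_nhds_in_open) (simp add: True)
        then show ?thesis by simp
      qed
      then have "\<forall>\<^sub>F v in nhds c. ((\<lambda>w. u (chart Inf w)) \<circ> (\<lambda>v. v / (p * v + 1))) v = G v"
        by eventually_elim (auto simp: G_def field_simps)
      ultimately show ?thesis by (subst (asm) analytic_at_cong[OF _ refl]) auto
    next
      case False
      have "((\<lambda>w. u (chart (Fin (p + 1 / c)) w)) \<circ> (\<lambda>v. 1 / v - 1 / c)) analytic_on {c}"
        using coordinate_holo_at[OF u, of "Fin (p + 1 / c)"] False
        by (intro analytic_on_compose) (auto simp: holo_at_def intro!: analytic_intros)
      moreover have "\<forall>\<^sub>F v in nhds c. ((\<lambda>w. u (chart (Fin (p + 1 / c)) w)) \<circ> (\<lambda>v. 1 / v - 1 / c)) v = G v"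
        using t1_space_nhds[OF False] by eventually_elim (auto simp: G_def)
      ultimately show ?thesis by (subst (asm) analytic_at_cong[OF _ refl]) auto
    qed
  next
    fix w :: complex assume "w \<noteq> 0"
    then show "u (chart (Fin p) w) = G (1 / w)" by (simp add: G_def)
  qed (use u in \<open>simp_all add: coordinate_def pole_at_def del: chart.simps\<close>)
  then obtain r k where rk: "r \<noteq> 0" "\<And>v. G v = r * v + k" by blast
  have "u Inf = k" using rk(2)[of 0] by (simp add: G_def)
  moreover have "u (Fin w) = r / (w - p) + k" if "w \<noteq> p" for w
    using rk(2)[of "1 / (w - p)"] that by (simp add: G_def)
  ultimately show ?thesis using that rk(1) by blast
qed

lemma coordinate_inj:
  assumes u: "coordinate P u" and "x \<noteq> P" "y \<noteq> P" "u x = u y" shows "x = y"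
proof (cases P)
  case Inf
  with u obtain r k where "r \<noteq> 0" "\<And>w. u (Fin w) = r * w + k" by (auto elim: coordinate_Inf)
  with assms Inf show ?thesis by (cases x; cases y) auto
next
  case (Fin p)
  with u obtain r k where "r \<noteq> 0" "u Inf = k" "\<And>w. w \<noteq> p \<Longrightarrow> u (Fin w) = r / (w - p) + k"
    by (auto elim: coordinate_Fin)
  with assms Fin show ?thesis by (cases x; cases y) (auto simp: field_simps)
qed

lemma coordinate_chart:
  assumes u: "coordinate P u"
  obtains r k where "r \<noteq> 0" "\<And>w. w \<noteq> 0 \<Longrightarrow> u (chart P w) = r / w + k"
proof (cases P)
  case Inf
  with u obtain r k where "r \<noteq> 0" "\<And>w. u (Fin w) = r * w + k" by (auto elim: coordinate_Inf)
  with that[of r k] Inf show ?thesis by auto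
next
  case (Fin p)
  with u obtain r k where "r \<noteq> 0" "\<And>w. w \<noteq> p \<Longrightarrow> u (Fin w) = r / (w - p) + k"
    by (auto elim: coordinate_Fin)
  with that[of r k] Fin show ?thesis by auto
qed

lemma mero_fun_cong:
  assumes f: "mero_fun f" and fin: "finite {x. f x \<noteq> g x}" shows "mero_fun g"
  unfolding mero_fun_def
proof
  fix x
  have "\<forall>\<^sub>F w in at 0. f (chart x w) = g (chart x w)"
    using eventually_chart_notin[OF fin, of x] by simp
  then have "(\<lambda>w. f (chart x w)) meromorphic_on {0} \<longleftrightarrow> (\<lambda>w. g (chart x w)) meromorphic_on {0}"
    by (intro meromorphic_on_cong) auto
  with f show "(\<lambda>w. g (chart x w)) meromorphic_on {0}" unfolding mero_fun_def by blast
qed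

lemma analytic_at_0_factor:
  fixes F :: "complex \<Rightarrow> complex"
  assumes F: "F analytic_on {0}" "F 0 = 0"
  shows "(\<lambda>w. if w = 0 then deriv F 0 else F w / w) analytic_on {0}"
proof -
  have "(\<lambda>w. if w = 0 then deriv F 0 else F w / w - F 0 / (w - 0)) analytic_on {0}"
    by (rule pole_theorem_analytic[OF F(1)]) (auto intro: exI[of _ 1])
  with F(2) show ?thesis by (simp cong: if_cong)
qed

text \<open>The factor \<^term>\<open>df z u\<close> makes this true also when the differential of \<open>u\<close> vanishes at \<open>z\<close>.\<close>
lemma simple_pole_at_quotient:
  assumes u: "mero_fun u" "holo_at z u"
  shows "simple_pole_at z (\<lambda>x. df z u * (1 / (u x - u z)))"
  unfolding simple_pole_at_def
proof (intro allI impI)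
  fix f assume f: "mero_fun f" "holo_at z f" "f z = 0"
  show "\<exists>g. mero_fun g \<and> holo_at z g \<and> finite {x. g x \<noteq> df z u * (1 / (u x - u z)) * f x}"
  proof (cases "df z u = 0")
    case True
    then show ?thesis by (intro exI[of _ "\<lambda>_. 0"]) (auto simp: mero_fun_const)
  next
    case False
    define g where "g x = (if x = z then df z f else df z u * (1 / (u x - u z)) * f x)" for x
    have fin: "finite {x. df z u * (1 / (u x - u z)) * f x \<noteq> g x}"
      by (rule finite_subset[of _ "{z}"]) (auto simp: g_def)
    have "mero_fun (\<lambda>x. df z u * (1 / (u x - u z)) * f x)"
      using u f by (intro mero_fun_times mero_fun_const mero_fun_divide mero_fun_diff)
    then have "mero_fun g" using fin by (rule mero_fun_cong)
    moreover have "holo_at z g"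
    proof -
      define F U where "F w = f (chart z w)" and "U w = u (chart z w) - u z" for w
      define F1 U1 where "F1 w = (if w = 0 then deriv F 0 else F w / w)"
        and "U1 w = (if w = 0 then deriv U 0 else U w / w)" for w
      have an: "F analytic_on {0}" "U analytic_on {0}"
        using u f by (auto simp: F_def[abs_def] U_def[abs_def] holo_at_def intro: analytic_on_diff)
      have "F1 analytic_on {0}" "U1 analytic_on {0}"
        unfolding F1_def[abs_def] U1_def[abs_def]
        by (intro analytic_at_0_factor an; simp add: F_def U_def f)+
      moreover have "deriv F 0 = df z f" by (simp add: df_def F_def[abs_def])
      moreover have "deriv U 0 = df z u"
        unfolding U_def[abs_def] using holo_at_has_df[OF u(2)]
        by (intro DERIV_imp_deriv) (auto intro!: derivative_eq_intros)
      moreover from this have "U1 0 \<noteq> 0" using False by (simp add: U1_def)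
      ultimately have "(\<lambda>w. df z u * F1 w / U1 w) analytic_on {0}"
        by (intro analytic_on_divide analytic_on_mult analytic_on_const) auto
      moreover have "df z u * F1 w / U1 w = g (chart z w)" for w
      proof (cases "w = 0")
        case True
        then show ?thesis
          using False \<open>deriv F 0 = df z f\<close> \<open>deriv U 0 = df z u\<close> by (simp add: F1_def U1_def g_def)
      next
        case w: False
        then have "chart z w \<noteq> z" using inj_chart[of z] by (metis chart_0 injD)
        with w show ?thesis by (simp add: F1_def U1_def g_def F_def U_def)
      qed
      ultimately show ?thesis by (simp add: holo_at_def)
    qed
    ultimately show ?thesis using fin by (auto simp: eq_commute)
  qed
qed

lemma
  assumes u: "coordinate P u" and z: "z \<noteq> P"
  shows mero_fun_recip: "mero_fun (\<lambda>x. 1 / (u x - u z))"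
    and regular_at_recip_pole: "regular_at P \<alpha> \<Longrightarrow> regular_at P (mmul (\<lambda>x. 1 / (u x - u z)) \<alpha>)"
    and val_recip_pole: "regular_at P \<alpha> \<Longrightarrow> val (mmul (\<lambda>x. 1 / (u x - u z)) \<alpha>) P = 0"
    and regular_at_recip: "regular_at x \<alpha> \<Longrightarrow> x \<noteq> P \<Longrightarrow> x \<noteq> z \<Longrightarrow> regular_at x (mmul (\<lambda>x. 1 / (u x - u z)) \<alpha>)"
    and val_recip: "regular_at x \<alpha> \<Longrightarrow> x \<noteq> P \<Longrightarrow> x \<noteq> z \<Longrightarrow>
      val (mmul (\<lambda>x. 1 / (u x - u z)) \<alpha>) x = (1 / (u x - u z)) *\<^sub>C val \<alpha> x"
    and regular_at_recip_centre: "regular_at z \<alpha> \<Longrightarrow> val \<alpha> z = 0 \<Longrightarrow>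
      regular_at z (df z u *\<^sub>C mmul (\<lambda>x. 1 / (u x - u z)) \<alpha>)"
proof -
  let ?t = "\<lambda>x. 1 / (u x - u z)"
  show t: "mero_fun ?t"
    using coordinate_mero_fun[OF u] by (intro mero_fun_divide mero_fun_diff mero_fun_const)
  \<comment> \<open>At \<open>P\<close> the coordinate has the dummy value \<open>0\<close>, which is replaced by the limit of the
    quotient.\<close>
  define t' where "t' x = (if x = P then 0 else ?t x)" for x
  have fin: "finite {x. ?t x \<noteq> t' x}"
    by (rule finite_subset[of _ "{P}"]) (auto simp: t'_def)
  have t': "mero_fun t'" using t fin by (rule mero_fun_cong)
  have eq: "mmul ?t \<alpha> = mmul t' \<alpha>" for \<alpha> :: "'a mero" by (rule mmul_cong[OF t t' fin])
  have "holo_at P t'"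
  proof -
    obtain r k where rk: "r \<noteq> 0" "\<And>w. w \<noteq> 0 \<Longrightarrow> u (chart P w) = r / w + k"
      using coordinate_chart[OF u] by blast
    have "(\<lambda>w. w / (r + (k - u z) * w)) analytic_on {0}"
      using rk by (auto intro!: analytic_intros)
    moreover have "w / (r + (k - u z) * w) = t' (chart P w)" for w
    proof (cases "w = 0")
      case False
      then have "chart P w \<noteq> P" using inj_chart[of P] by (metis chart_0 injD)
      moreover have "r / w + k - u z = (r + (k - u z) * w) / w"
        using False by (simp add: field_simps)
      ultimately show ?thesis using False rk(2)[of w] by (simp add: t'_def)
    qed (simp add: t'_def)
    ultimately show ?thesis by (simp add: holo_at_def)
  qed
  then show "regular_at P \<alpha> \<Longrightarrow> regular_at P (mmul ?t \<alpha>)" "regular_at P \<alpha> \<Longrightarrow> val (mmul ?t \<alpha>) P = 0"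
    unfolding eq using t' by (auto simp: regular_at_mmul val_mmul t'_def)
  have "holo_at x ?t" if "x \<noteq> P" "x \<noteq> z" for x
    using that coordinate_inj[OF u that(1) z] coordinate_holo_at[OF u that(1)]
    by (intro holo_at_divide holo_at_diff holo_at_const) auto
  then show "regular_at x \<alpha> \<Longrightarrow> x \<noteq> P \<Longrightarrow> x \<noteq> z \<Longrightarrow> regular_at x (mmul ?t \<alpha>)"
    "regular_at x \<alpha> \<Longrightarrow> x \<noteq> P \<Longrightarrow> x \<noteq> z \<Longrightarrow> val (mmul ?t \<alpha>) x = ?t x *\<^sub>C val \<alpha> x"
    using t by (auto simp: regular_at_mmul val_mmul)
  assume \<alpha>: "regular_at z \<alpha>" "val \<alpha> z = 0"
  have "regular_at z (mmul (\<lambda>x. df z u * ?t x) \<alpha>)"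
    using t coordinate_mero_fun[OF u] coordinate_holo_at[OF u z]
    by (intro regular_at_mmul_pole simple_pole_at_quotient mero_fun_times mero_fun_const \<alpha>)
  then show "regular_at z (df z u *\<^sub>C mmul ?t \<alpha>)"
    by (simp only: mmul_times_const[OF t])
qed

lemma df_recip:
  assumes "holo_at z u" "u z \<noteq> 0" shows "df z (\<lambda>x. 1 / u x) = - df z u / (u z)^2"
  unfolding df_def[of z "\<lambda>x. 1 / u x"] using assms
  by (intro DERIV_imp_deriv) (auto intro!: derivative_eq_intros holo_at_has_df simp: power2_eq_square)

lemma recip_inverse_eq:
  fixes p q :: complex
  assumes "q \<noteq> 0" "p \<noteq> q" "p \<noteq> 0"
  shows "1 / (1 / p - 1 / q) = - (q^2) * (1 / (p - q)) - q"
proof -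
  have d: "p - q \<noteq> 0" using assms by simp
  have "1 / p - 1 / q = - (p - q) / (p * q)"
    using assms by (simp add: diff_frac_eq)
  then have "1 / (1 / p - 1 / q) = - (p * q) / (p - q)"
    by (simp only: divide_divide_eq_right minus_divide_left[symmetric] minus_divide_right[symmetric] mult_1_left)
  also have "\<dots> = (- (q^2) - q * (p - q)) / (p - q)"
    by (simp add: algebra_simps power2_eq_square)
  also have "\<dots> = - (q^2) * (1 / (p - q)) - q"
    using d by (simp add: diff_divide_distrib)
  finally show ?thesis .
qed

lemma mmul_recip_inverse:
  assumes u: "coordinate P u" and z: "z \<noteq> P" "z \<noteq> Q" and Q: "Q \<noteq> P" "u Q = 0"
  shows "mero_fun (\<lambda>x. 1 / (1 / u x - 1 / u z))"
    and "mmul (\<lambda>x. 1 / (1 / u x - 1 / u z)) \<alpha> =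
      (- ((u z)^2)) *\<^sub>C mmul (\<lambda>x. 1 / (u x - u z)) \<alpha> - u z *\<^sub>C \<alpha>"
proof -
  have uz: "u z \<noteq> 0" using coordinate_inj[OF u z(1) Q(1)] Q z by auto
  note t = mero_fun_recip[OF u z(1)]
  have t1: "mero_fun (\<lambda>x. - ((u z)^2) * (1 / (u x - u z)))"
    using t by (intro mero_fun_times mero_fun_const)
  show tt: "mero_fun (\<lambda>x. 1 / (1 / u x - 1 / u z))"
    using coordinate_mero_fun[OF u] by (intro mero_fun_divide mero_fun_diff mero_fun_const)
  have "1 / (1 / u x - 1 / u z) = - ((u z)^2) * (1 / (u x - u z)) - u z" if "x \<notin> {P, Q, z}" for x
  proof -
    have "u x \<noteq> u z" "u x \<noteq> 0"
      using that coordinate_inj[OF u _ Q(1), of x] coordinate_inj[OF u _ z(1), of x] Q by auto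
    with uz show ?thesis by (rule recip_inverse_eq)
  qed
  then have "{x. 1 / (1 / u x - 1 / u z) \<noteq> - ((u z)^2) * (1 / (u x - u z)) - u z} \<subseteq> {P, Q, z}"
    by blast
  then have "finite {x. 1 / (1 / u x - 1 / u z) \<noteq> - ((u z)^2) * (1 / (u x - u z)) - u z}"
    by (rule finite_subset) simp
  then have "mmul (\<lambda>x. 1 / (1 / u x - 1 / u z)) \<alpha> =
      mmul (\<lambda>x. - ((u z)^2) * (1 / (u x - u z)) - u z) \<alpha>"
    by (intro mmul_cong tt mero_fun_diff_const t1)
  also have "\<dots> = (- ((u z)^2)) *\<^sub>C mmul (\<lambda>x. 1 / (u x - u z)) \<alpha> - u z *\<^sub>C \<alpha>"
    by (simp only: mmul_diff_const[OF t1] mmul_times_const[OF t])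
  finally show "mmul (\<lambda>x. 1 / (1 / u x - 1 / u z)) \<alpha> =
      (- ((u z)^2)) *\<^sub>C mmul (\<lambda>x. 1 / (u x - u z)) \<alpha> - u z *\<^sub>C \<alpha>" .
qed

section \<open>Poincare-Birkhoff-Witt for maps vanishing at a point\<close>

lemma lie_lie: "lie (lie x y) w = lie x (lie y w) - lie y (lie x (w::'a::complex_lie_algebra))"
  using jacobi[of x y w] lie_anticomm[of w "lie x y"] lie_anticomm[of w x]
  by (simp add: lie_minus_right algebra_simps add_eq_0_iff)

lemma lie_lie_right: "lie w (lie x y) = lie (lie w x) y + lie x (lie w (y::'a::complex_lie_algebra))"
  by (simp add: lie_lie)

text \<open>The derivation \<open>\<alpha> \<mapsto> d\<alpha>\<close> is a cocycle of maps with values in maps. It extends to words: the last letter is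
  differentiated and the others act by the adjoint action, all evaluated at the point \<open>x\<close>.\<close>
fun cocycle :: "cp1 \<Rightarrow> 'g::complex_lie_algebra mero list \<Rightarrow> 'g" where
  "cocycle x [] = 0"
| "cocycle x (\<alpha> # w) = (if w = [] then dval \<alpha> x else lie (val \<alpha> x) (cocycle x w))"

lemma env_form_cocycle:
  assumes "linear_form \<xi>" "\<And>\<alpha>. \<alpha> \<in> h \<Longrightarrow> regular_at x \<alpha>"
  shows "env_form h (\<lambda>w. \<xi> (cocycle x w))"
proof (rule admI)
  fix u v and \<alpha> \<beta> :: "'a mero" and c
  assume ab: "\<alpha> \<in> h" 
  have "cocycle x (u @ (c *\<^sub>C \<alpha>) # v) = c *\<^sub>C cocycle x (u @ \<alpha> # v)"
    using ab assms(2) by (induction u) (auto simp: val_scaleC dval_scaleC lie_scaleC_left lie_scaleC_right)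
  then show "\<xi> (cocycle x (u @ (c *\<^sub>C \<alpha>) # v)) = c * \<xi> (cocycle x (u @ \<alpha> # v))"
    by (simp add: linear_form_scaleC[OF assms(1)])
  assume b: "\<beta> \<in> h"
  have "cocycle x (u @ (\<alpha> + \<beta>) # v) = cocycle x (u @ \<alpha> # v) + cocycle x (u @ \<beta> # v)"
    using ab b assms(2) by (induction u) (auto simp: val_add dval_add lie_add_left lie_add_right)
  then show "\<xi> (cocycle x (u @ (\<alpha> + \<beta>) # v)) = \<xi> (cocycle x (u @ \<alpha> # v)) + \<xi> (cocycle x (u @ \<beta> # v))"
    by (simp add: linear_form_add[OF assms(1)])
  have "cocycle x (u @ lie \<alpha> \<beta> # v) = cocycle x (u @ \<alpha> # \<beta> # v) - cocycle x (u @ \<beta> # \<alpha> # v)"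
  proof (induction u)
    case Nil
    have "lie (dval \<alpha> x) (val \<beta> x) = - lie (val \<beta> x) (dval \<alpha> x)" by (rule lie_anticomm)
    then show ?case using ab b assms(2) by (auto simp: val_lie dval_lie lie_lie)
  qed (auto simp: lie_diff_right)
  then show "\<xi> (cocycle x (u @ lie \<alpha> \<beta> # v)) = \<xi> (cocycle x (u @ \<alpha> # \<beta> # v)) - \<xi> (cocycle x (u @ \<beta> # \<alpha> # v))"
    by (simp add: linear_form_diff[OF assms(1)])
qed

lemma maps_mono: "S \<subseteq> T \<Longrightarrow> maps T \<subseteq> maps S"
  by (auto simp: maps_def)

text \<open>The letters of an element have finitely many poles in all. Hence membership in the ideal of relations
  is already witnessed by maps regular off a finite set, at whose points the cocycle is defined.\<close>
lemma free_on_regular: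
  fixes p :: "'g::complex_lie_algebra mero free_alg"
  assumes "p \<in> free_on h"
  shows "\<exists>F. finite F \<and> p \<in> free_on (h \<inter> maps (- F))"
proof -
  define F where "F = (\<Union>w\<in>Poly_Mapping.keys p. \<Union>\<alpha>\<in>set (letters w). {x. \<not> regular_at x \<alpha>})"
  have "finite F" by (auto simp: F_def finite_not_regular)
  moreover have "p \<in> free_on (h \<inter> maps (- F))"
    using assms by (auto simp: free_on_def maps_def F_def)
  ultimately show ?thesis by blast
qed

lemma env_rels_regular:
  fixes r :: "'g::complex_lie_algebra mero free_alg"
  assumes "r \<in> env_rels h"
  shows "\<exists>F. finite F \<and> r \<in> env_rels (h \<inter> maps (- F))"
proof -
  have *: "\<exists>F. finite F \<and> \<alpha> \<in> maps (- F) \<and> \<beta> \<in> maps (- F)" for \<alpha> \<beta> :: "'g mero"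
    by (rule exI[of _ "{x. \<not> regular_at x \<alpha>} \<union> {x. \<not> regular_at x \<beta>}"])
       (auto simp: finite_not_regular maps_def)
  from assms show ?thesis
  proof (cases rule: env_relsE)
    case (1 \<alpha> \<beta>)
    then show ?thesis using *[of \<alpha> \<beta>] unfolding env_rels_def by blast
  next
    case (2 c \<alpha>)
    then show ?thesis using *[of \<alpha> \<alpha>] unfolding env_rels_def by blast
  next
    case (3 \<alpha> \<beta>)
    then show ?thesis using *[of \<alpha> \<beta>] unfolding env_rels_def by blast
  qed
qed

lemma env_ideal_regular:
  fixes p :: "'g::complex_lie_algebra mero free_alg"
  assumes "p \<in> env_ideal h"
  shows "\<exists>F. finite F \<and> p \<in> env_ideal (h \<inter> maps (- F))"
  using assms
proof (induction rule: env_ideal.induct)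
  case zero
  then show ?case by (intro exI[of _ "{}"]) (auto intro: env_ideal.zero)
next
  case (step x p r q)
  obtain F1 F2 F3 F4 where F: "finite F1" "x \<in> env_ideal (h \<inter> maps (- F1))"
      "finite F2" "p \<in> free_on (h \<inter> maps (- F2))" "finite F3" "r \<in> env_rels (h \<inter> maps (- F3))"
      "finite F4" "q \<in> free_on (h \<inter> maps (- F4))"
    using step free_on_regular env_rels_regular by metis
  define F where "F = F1 \<union> F2 \<union> F3 \<union> F4"
  have sub: "h \<inter> maps (- F') \<subseteq> h \<inter> maps (- F)" if "F' \<subseteq> F" for F'
    using maps_mono[of "- F" "- F'"] that by blast
  have "x + p * r * q \<in> env_ideal (h \<inter> maps (- F))"
  proof (rule env_ideal.step)
    show "x \<in> env_ideal (h \<inter> maps (- F))"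
      using F(2) env_ideal_mono[OF sub[of F1]] by (auto simp: F_def)
    show "p \<in> free_on (h \<inter> maps (- F))"
      using F(4) free_on_mono[OF sub[of F2]] by (auto simp: F_def)
    show "r \<in> env_rels (h \<inter> maps (- F))"
      using F(6) env_rels_mono[OF sub[of F3]] by (auto simp: F_def)
    show "q \<in> free_on (h \<inter> maps (- F))"
      using F(8) free_on_mono[OF sub[of F4]] by (auto simp: F_def)
  qed
  moreover have "finite F" using F by (simp add: F_def)
  ultimately show ?case by blast
qed

lemma lie_sub_Int: "lie_sub h \<Longrightarrow> lie_sub k \<Longrightarrow> lie_sub (h \<inter> k)"
  by (auto simp: lie_sub_def)

theorem env_ideal_maps0_Int:
  fixes p :: "'g::complex_lie_algebra mero free_alg"
  assumes ST: "S \<subseteq> T" and p: "p \<in> free_on (maps0 P T)" "p \<in> env_ideal (maps0 P S)"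
  shows "p \<in> env_ideal (maps0 P T)"
proof -
  obtain F1 F2 where F12: "finite F1" "p \<in> free_on (maps0 P T \<inter> maps (- F1))"
      "finite F2" "p \<in> env_ideal (maps0 P S \<inter> maps (- F2))"
    using free_on_regular[OF p(1)] env_ideal_regular[OF p(2)] by blast
  define F where "F = F1 \<union> F2"
  define k h :: "'g mero set" where "k = maps0 P T \<inter> maps (- F)" and "h = maps0 P S \<inter> (maps (- F) :: 'g mero set)"
  have fin: "finite F" using F12 by (simp add: F_def)
  have pk: "p \<in> free_on k"
    using F12(2) free_on_mono[of "maps0 P T \<inter> maps (- F1)" k] maps_mono[of "- F" "- F1"]
    by (auto simp: k_def F_def)
  have ph: "p \<in> env_ideal h"
    using F12(4) env_ideal_mono[of "maps0 P S \<inter> maps (- F2)" h] maps_mono[of "- F" "- F2"]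
    by (auto simp: h_def F_def)
  \<comment> \<open>The components of the cocycle at all points off the poles.\<close>
  define \<Lambda> :: "('g mero list \<Rightarrow> complex) set" where "\<Lambda> = {\<lambda>w. \<xi> (cocycle x w) | \<xi> x. linear_form \<xi> \<and> x \<notin> F}" 
  have "p \<in> env_ideal k"
  proof (rule env_ideal_Int_free_on[of k h \<Lambda>, OF _ _ _ _ _ pk ph])
    show "lie_sub k" unfolding k_def by (intro lie_sub_Int lie_sub_maps lie_sub_maps0)
    show "k \<subseteq> h" using ST by (auto simp: k_def h_def maps0_def maps_def)
    show "env_form h f" if "f \<in> \<Lambda>" for f
      using that by (auto simp: \<Lambda>_def h_def maps_def intro!: env_form_cocycle)
    show "f [] = 0" if "f \<in> \<Lambda>" for f
      using that by (auto simp: \<Lambda>_def linear_form_0)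
    show "\<alpha> = 0" if \<alpha>: "\<alpha> \<in> k" "\<And>f. f \<in> \<Lambda> \<Longrightarrow> f [\<alpha>] = 0" for \<alpha>
    proof (rule dval_zero_imp_zero[OF fin])
      show "dval \<alpha> x = 0" if "x \<notin> F" for x
      proof (rule linear_form_separates)
        fix \<xi> :: "'g \<Rightarrow> complex" assume "linear_form \<xi>"
        with that have "(\<lambda>w. \<xi> (cocycle x w)) \<in> \<Lambda>" unfolding \<Lambda>_def by blast
        from \<alpha>(2)[OF this] show "\<xi> (dval \<alpha> x) = 0" by simp
      qed
      show "regular_at P \<alpha>" "val \<alpha> P = 0"
        using \<alpha>(1) by (auto simp: k_def maps0_def maps_def)
    qed
  qed
  then show ?thesis
    using env_ideal_mono[of k "maps0 P T"] by (auto simp: k_def)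
qed

section \<open>Adjoint derivations\<close>

text \<open>The derivation of the free algebra that extends the adjoint action of \<open>b\<close> on letters.\<close>
fun ad :: "'a::complex_lie_algebra \<Rightarrow> 'a list \<Rightarrow> 'a free_alg" where
  "ad b [] = 0"
| "ad b (x # w) = gen (lie b x) * mon w + gen x * ad b w"

lemma ad_append: "ad b (v @ w) = ad b v * mon w + mon v * ad b w"
  by (induction v) (auto simp: mon_Nil mon_Cons mon_append algebra_simps)

lemma free_on_UNIV [simp]: "p \<in> free_on UNIV"
  by (simp add: free_on_def)

lemma lin_ad_mult: "lin (ad b) (p * q) = lin (ad b) p * q + p * lin (ad b) q"
proof -
  have "lin (ad b) (mon v * q) - (ad b v * q + mon v * lin (ad b) q) \<in> {0}" for v
    by (rule linear_eq_on_free[of q UNIV _ _ "{0}"])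
       (auto simp: lin_add lin_scal distrib_left distrib_right scal_left_commute lsub_singleton_0
         ad_append simp flip: mon_append)
  then have *: "lin (ad b) (mon v * q) = ad b v * q + mon v * lin (ad b) q" for v by simp
  have "lin (ad b) (p * q) - (lin (ad b) p * q + p * lin (ad b) q) \<in> {0}"
    by (rule linear_eq_on_free[of p UNIV _ _ "{0}"])
       (auto simp: lin_add lin_scal distrib_left distrib_right mult.assoc lsub_singleton_0 *)
  then show ?thesis by simp
qed

text \<open>The adjoint action of \<open>b\<close> preserves \<open>k\<close>.\<close>
definition stabilizes :: "'a::complex_lie_algebra set \<Rightarrow> 'a \<Rightarrow> bool" where
  "stabilizes k b \<longleftrightarrow> (\<forall>x\<in>k. lie b x \<in> k)"

lemma ad_in_free_on:
  assumes "stabilizes k b" "p \<in> free_on k" shows "lin (ad b) p \<in> free_on k"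
proof (rule free_on_lin_in[OF assms(2) free_on_lsub])
  fix w assume "set w \<subseteq> k"
  then show "ad b w \<in> free_on k"
    using assms(1) by (induction w) (auto simp: stabilizes_def intro!: free_on_closed)
qed

lemma ad_env_ideal:
  assumes k: "lie_sub k" and b: "stabilizes k b" and p: "p \<in> env_ideal k"
  shows "lin (ad b) p \<in> env_ideal k"
proof -
  have "env_ideal k \<subseteq> {p. lin (ad b) p \<in> env_ideal k}"
  proof (rule env_ideal_subset[OF lsub_lin_vimage[OF env_ideal_lsub]])
    fix u r v assume uv: "set u \<subseteq> k" "set v \<subseteq> k" and r: "r \<in> env_rels k"
    have bk: "lie b x \<in> k" if "x \<in> k" for x using b that by (simp add: stabilizes_def)
    have "lin (ad b) r \<in> env_ideal k"
    proof -
      from r show ?thesis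
      proof (cases rule: env_relsE)
        case (1 x y)
        then show ?thesis
          using gen_add_env[OF bk[of x] bk[of y]] by (simp add: lin_diff lin_add lie_add_right mon_Nil)
      next
        case (2 c x)
        then show ?thesis
          using gen_scaleC_env[OF bk[of x]] by (simp add: lin_diff lin_scal lie_scaleC_right mon_Nil)
      next
        case (3 x y)
        have ks: "lie (lie b x) y \<in> k" "lie x (lie b y) \<in> k"
          using 3 bk k by (auto intro: lie_sub_lie)
        have "gen (lie (lie b x) y + lie x (lie b y)) - (gen (lie (lie b x) y) + gen (lie x (lie b y)))
            + (gen (lie (lie b x) y) - (gen (lie b x) * gen y - gen y * gen (lie b x)))
            + (gen (lie x (lie b y)) - (gen x * gen (lie b y) - gen (lie b y) * gen x)) \<in> env_ideal k"
          using 3 bk ks by (intro env_ideal_closed(2) gen_add_env gen_lie_env)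
        also have "lie (lie b x) y + lie x (lie b y) = lie b (lie x y)"
          by (rule lie_lie_right[symmetric])
        finally show ?thesis
          unfolding 3(1) by (simp add: lin_diff lin_add lin_ad_mult mon_Nil algebra_simps)
      qed
    qed
    then have "ad b u * r * mon v + mon u * lin (ad b) r * mon v + mon u * r * ad b v \<in> env_ideal k"
      using uv env_rels_in_env_ideal[OF r] ad_in_free_on[OF b, of "mon u"] ad_in_free_on[OF b, of "mon v"]
      by (intro env_ideal_closed(2) env_ideal_mult) auto
    then show "mon u * r * mon v \<in> {p. lin (ad b) p \<in> env_ideal k}"
      by (simp add: lin_ad_mult algebra_simps)
  qed
  with p show ?thesis by auto
qed

lemma ad_add_env:
  assumes k: "lie_sub k" and b: "stabilizes k b" "stabilizes k b'" and p: "p \<in> free_on k"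
  shows "lin (ad (b + b')) p - (lin (ad b) p + lin (ad b') p) \<in> env_ideal k"
proof (rule linear_eq_on_free[OF p])
  fix w assume "set w \<subseteq> k"
  then have "ad (b + b') w - (ad b w + ad b' w) \<in> env_ideal k"
  proof (induction w)
    case (Cons x w)
    then have "(gen (lie b x + lie b' x) - (gen (lie b x) + gen (lie b' x))) * mon w
        + gen x * (ad (b + b') w - (ad b w + ad b' w)) \<in> env_ideal k"
      using b by (intro env_ideal_closed(2) env_ideal_mult_left env_ideal_mult_right gen_add_env)
        (auto simp: stabilizes_def)
    then show ?case by (simp add: lie_add_left algebra_simps)
  qed (simp add: env_ideal.zero)
  then show "lin (ad (b + b')) (mon w) - (lin (ad b) (mon w) + lin (ad b') (mon w)) \<in> env_ideal k"
    by simp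
qed (auto simp: lin_add lin_scal distrib_left env_ideal_lsub)

lemma ad_scaleC_env:
  assumes k: "lie_sub k" and b: "stabilizes k b" and p: "p \<in> free_on k"
  shows "lin (ad (c *\<^sub>C b)) p - scal c * lin (ad b) p \<in> env_ideal k"
proof (rule linear_eq_on_free[OF p])
  fix w assume "set w \<subseteq> k"
  then have "ad (c *\<^sub>C b) w - scal c * ad b w \<in> env_ideal k"
  proof (induction w)
    case (Cons x w)
    then have "(gen (c *\<^sub>C lie b x) - scal c * gen (lie b x)) * mon w
        + gen x * (ad (c *\<^sub>C b) w - scal c * ad b w) \<in> env_ideal k"
      using b by (intro env_ideal_closed(2) env_ideal_mult_left env_ideal_mult_right gen_scaleC_env)
        (auto simp: stabilizes_def)
    then show ?case
      by (simp add: lie_scaleC_left algebra_simps scal_left_commute[of "gen x"])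
  qed (simp add: env_ideal.zero)
  then show "lin (ad (c *\<^sub>C b)) (mon w) - scal c * lin (ad b) (mon w) \<in> env_ideal k"
    by simp
next
  show "scal c * lin (ad b) (scal d * x) = scal d * (scal c * lin (ad b) x)" for d x
    by (simp add: lin_scal scal_left_commute[of "scal c"])
qed (auto simp: lin_add lin_scal distrib_left env_ideal_lsub)

lemma ad_lie_env:
  assumes k: "lie_sub k" and b: "stabilizes k b" "stabilizes k b'" and p: "p \<in> free_on k"
  shows "lin (ad (lie b b')) p - (lin (ad b) (lin (ad b') p) - lin (ad b') (lin (ad b) p)) \<in> env_ideal k"
proof (rule linear_eq_on_free[OF p])
  fix w assume "set w \<subseteq> k"
  then have "ad (lie b b') w - (lin (ad b) (ad b' w) - lin (ad b') (ad b w)) \<in> env_ideal k"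
  proof (induction w)
    case (Cons x w)
    have s: "lie b (lie b' x) \<in> k" "lie b' (lie b x) \<in> k"
      using b Cons.prems by (auto simp: stabilizes_def)
    have "(gen (lie b (lie b' x) - lie b' (lie b x)) - (gen (lie b (lie b' x)) - gen (lie b' (lie b x)))) * mon w
        + gen x * (ad (lie b b') w - (lin (ad b) (ad b' w) - lin (ad b') (ad b w))) \<in> env_ideal k"
      using Cons s by (intro env_ideal_closed(2) env_ideal_mult_left env_ideal_mult_right gen_diff_env[OF k]) auto
    then show ?case
      by (simp add: lie_lie lin_add lin_ad_mult mon_Nil algebra_simps)
  qed (simp add: env_ideal.zero)
  then show "lin (ad (lie b b')) (mon w)
      - (lin (ad b) (lin (ad b') (mon w)) - lin (ad b') (lin (ad b) (mon w))) \<in> env_ideal k"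
    by simp
qed (auto simp: lin_add lin_scal right_diff_distrib env_ideal_lsub)

lemma ad_0_env:
  assumes k: "lie_sub k" and p: "p \<in> free_on k" shows "lin (ad 0) p \<in> env_ideal k"
  using ad_scaleC_env[OF k _ p, of 0 0] k by (simp add: stabilizes_def lie_sub_0)

section \<open>Straightening modulo the constants\<close>

text \<open>The action of a map \<open>\<alpha>\<close> regular at \<open>P\<close> on the enveloping algebra of the maps vanishing at \<open>P\<close>: the
  constant \<open>\<alpha> P\<close> acts as a derivation, and \<open>\<alpha> - \<alpha> P\<close> by left multiplication.\<close>
definition vac_act :: "cp1 \<Rightarrow> 'g::complex_lie_algebra mero \<Rightarrow> 'g mero free_alg \<Rightarrow> 'g mero free_alg" where
  "vac_act P \<alpha> p = gen (\<alpha> - const_map (val \<alpha> P)) * p + lin (ad (const_map (val \<alpha> P))) p"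

text \<open>The word \<open>w\<close> applied to the unit by this action.\<close>
primrec straighten :: "cp1 \<Rightarrow> 'g::complex_lie_algebra mero list \<Rightarrow> 'g mero free_alg" where
  "straighten P [] = 1"
| "straighten P (\<alpha> # w) = vac_act P \<alpha> (straighten P w)"

lemma const_in_maps [simp]: "const_map a \<in> maps S"
  by (simp add: maps_def)

lemma stabilizes_const: "stabilizes (maps0 P S) (const_map a)"
  by (auto simp: stabilizes_def maps0_def maps_def regular_at_lie val_lie)

lemma diff_const_in_maps0:
  "\<alpha> \<in> maps (insert P S) \<Longrightarrow> \<alpha> - const_map (val \<alpha> P) \<in> maps0 P S"
  by (auto simp: maps0_def maps_def regular_at_diff val_diff)

lemma vac_act_add: "vac_act P \<alpha> (p + q) = vac_act P \<alpha> p + vac_act P \<alpha> q"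
  and vac_act_scal: "vac_act P \<alpha> (scal c * p) = scal c * vac_act P \<alpha> p"
  by (simp_all add: vac_act_def lin_add lin_scal algebra_simps scal_left_commute[of "gen _"])

lemma vac_act_in_free_on:
  "\<alpha> \<in> maps (insert P S) \<Longrightarrow> p \<in> free_on (maps0 P S) \<Longrightarrow> vac_act P \<alpha> p \<in> free_on (maps0 P S)"
  unfolding vac_act_def
  by (intro free_on_closed(3) free_on_mult ad_in_free_on[OF stabilizes_const]) (simp_all add: diff_const_in_maps0)

lemma vac_act_env_ideal:
  "\<alpha> \<in> maps (insert P S) \<Longrightarrow> p \<in> env_ideal (maps0 P S) \<Longrightarrow> vac_act P \<alpha> p \<in> env_ideal (maps0 P S)"
  unfolding vac_act_def
  by (intro env_ideal_closed(2) env_ideal_mult_left ad_env_ideal[OF lie_sub_maps0 stabilizes_const])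
     (simp_all add: diff_const_in_maps0)

lemma regular_if_in_maps: "\<alpha> \<in> maps (insert P S) \<Longrightarrow> regular_at P \<alpha>"
  by (simp add: maps_def)

lemma vac_act_rel_add:
  assumes "\<alpha> \<in> maps (insert P S)" "\<beta> \<in> maps (insert P S)" "p \<in> free_on (maps0 P S)"
  shows "vac_act P (\<alpha> + \<beta>) p - (vac_act P \<alpha> p + vac_act P \<beta> p) \<in> env_ideal (maps0 P S)"
proof -
  let ?b = "const_map (val \<alpha> P)" and ?b' = "const_map (val \<beta> P)"
  have "(gen ((\<alpha> - ?b) + (\<beta> - ?b')) - (gen (\<alpha> - ?b) + gen (\<beta> - ?b'))) * p
      + (lin (ad (?b + ?b')) p - (lin (ad ?b) p + lin (ad ?b') p)) \<in> env_ideal (maps0 P S)"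
    using assms by (intro env_ideal_closed(2) env_ideal_mult_right gen_add_env
        ad_add_env[OF lie_sub_maps0] stabilizes_const diff_const_in_maps0)
  moreover have "(\<alpha> - ?b) + (\<beta> - ?b') = \<alpha> + \<beta> - (?b + ?b')" by simp
  ultimately show ?thesis
    using assms by (simp add: vac_act_def val_add regular_if_in_maps const_map_add algebra_simps)
qed

lemma vac_act_rel_scaleC:
  assumes "\<alpha> \<in> maps (insert P S)" "p \<in> free_on (maps0 P S)"
  shows "vac_act P (c *\<^sub>C \<alpha>) p - scal c * vac_act P \<alpha> p \<in> env_ideal (maps0 P S)"
proof -
  let ?b = "const_map (val \<alpha> P)"
  have "(gen (c *\<^sub>C (\<alpha> - ?b)) - scal c * gen (\<alpha> - ?b)) * p
      + (lin (ad (c *\<^sub>C ?b)) p - scal c * lin (ad ?b) p) \<in> env_ideal (maps0 P S)"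
    using assms by (intro env_ideal_closed(2) env_ideal_mult_right gen_scaleC_env
        ad_scaleC_env[OF lie_sub_maps0] stabilizes_const diff_const_in_maps0)
  moreover have "c *\<^sub>C (\<alpha> - ?b) = c *\<^sub>C \<alpha> - c *\<^sub>C ?b"
    by (rule clie.scale_right_diff_distrib)
  ultimately show ?thesis
    using assms by (simp add: vac_act_def val_scaleC regular_if_in_maps const_map_scaleC algebra_simps)
qed

lemma vac_act_rel_lie:
  assumes "\<alpha> \<in> maps (insert P S)" "\<beta> \<in> maps (insert P S)" "p \<in> free_on (maps0 P S)"
  shows "vac_act P (lie \<alpha> \<beta>) p - (vac_act P \<alpha> (vac_act P \<beta> p) - vac_act P \<beta> (vac_act P \<alpha> p)) \<in> env_ideal (maps0 P S)"
proof -
  let ?J = "env_ideal (maps0 P S)"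
  define b b' where "b = const_map (val \<alpha> P)" and "b' = const_map (val \<beta> P)"
  define x y where "x = \<alpha> - b" and "y = \<beta> - b'"
  have xy: "x \<in> maps0 P S" "y \<in> maps0 P S"
    using assms by (auto simp: x_def y_def b_def b'_def diff_const_in_maps0)
  have st: "stabilizes (maps0 P S) b" "stabilizes (maps0 P S) b'"
    by (simp_all add: b_def b'_def stabilizes_const)
  then have bxy: "lie b y \<in> maps0 P S" "lie b' x \<in> maps0 P S"
    using xy by (auto simp: stabilizes_def)
  have vl: "const_map (val (lie \<alpha> \<beta>) P) = lie b b'"
    using assms by (simp add: val_lie regular_if_in_maps const_map_lie b_def b'_def)
  have split: "lie \<alpha> \<beta> - lie b b' = lie x y + (lie b y - lie b' x)"
    using lie_anticomm[of x b']
    by (simp add: x_def y_def lie_diff_left lie_diff_right algebra_simps)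
  note k = lie_sub_maps0[of P S]
  have "(gen (lie x y + (lie b y - lie b' x)) - (gen (lie x y) + gen (lie b y - lie b' x))) * p
      + (gen (lie b y - lie b' x) - (gen (lie b y) - gen (lie b' x))) * p
      + (gen (lie x y) - (gen x * gen y - gen y * gen x)) * p
      + (lin (ad (lie b b')) p - (lin (ad b) (lin (ad b') p) - lin (ad b') (lin (ad b) p))) \<in> ?J"
    using xy bxy st assms(3) lie_sub_lie[OF k xy]
    by (intro env_ideal_closed(2) env_ideal_mult_right gen_add_env gen_diff_env[OF k] gen_lie_env
        ad_lie_env[OF k] lie_sub_diff[OF k])
  then show ?thesis
    unfolding vac_act_def vl split b_def[symmetric] b'_def[symmetric] x_def[symmetric] y_def[symmetric]
    by (simp add: lin_add lin_ad_mult mon_Nil algebra_simps)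
qed

lemma lin_straighten_gen: "lin (straighten P) (gen \<alpha> * p) = vac_act P \<alpha> (lin (straighten P) p)"
proof -
  have "lin (straighten P) (gen \<alpha> * p) - vac_act P \<alpha> (lin (straighten P) p) \<in> {0}"
    by (rule linear_eq_on_free[of p UNIV _ _ "{0}"])
       (auto simp: distrib_left lin_add lin_scal scal_left_commute[of "gen _"] vac_act_add vac_act_scal lsub_singleton_0
         simp flip: mon_Cons)
  then show ?thesis by simp
qed

lemma straighten_in_free_on:
  fixes p :: "'g::complex_lie_algebra mero free_alg"
  assumes "p \<in> free_on (maps (insert P S))" shows "lin (straighten P) p \<in> free_on (maps0 P S)"
proof (rule free_on_lin_in[OF assms free_on_lsub])
  fix w :: "'g mero list" assume "set w \<subseteq> maps (insert P S)"
  then show "straighten P w \<in> free_on (maps0 P S)"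
    by (induction w) (auto intro: vac_act_in_free_on)
qed

lemma straighten_env_ideal:
  fixes p :: "'g::complex_lie_algebra mero free_alg"
  assumes "p \<in> env_ideal (maps (insert P S))" shows "lin (straighten P) p \<in> env_ideal (maps0 P S)"
proof -
  let ?h = "maps (insert P S) :: 'g mero set" and ?J = "env_ideal (maps0 P S) :: 'g mero free_alg set"
  have "env_ideal ?h \<subseteq> {p. lin (straighten P) p \<in> ?J}"
  proof (rule env_ideal_subset[OF lsub_lin_vimage[OF env_ideal_lsub]])
    fix u v :: "'g mero list" and r :: "'g mero free_alg" assume uv: "set u \<subseteq> ?h" "set v \<subseteq> ?h" and r: "r \<in> env_rels ?h"
    have v: "straighten P v \<in> free_on (maps0 P S)"
      using straighten_in_free_on[of "mon v" P S] uv by simp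
    have "lin (straighten P) (r * mon v) \<in> ?J"
    proof -
      from r show ?thesis
      proof (cases rule: env_relsE)
        case (1 x y)
        then show ?thesis using vac_act_rel_add[OF 1(2,3) v]
          by (simp add: left_diff_distrib distrib_right lin_diff lin_add lin_straighten_gen)
      next
        case (2 c x)
        then show ?thesis using vac_act_rel_scaleC[OF 2(2) v]
          by (simp add: left_diff_distrib mult.assoc lin_diff lin_scal lin_straighten_gen)
      next
        case (3 x y)
        then show ?thesis using vac_act_rel_lie[OF 3(2,3) v]
          by (simp add: left_diff_distrib mult.assoc lin_diff lin_straighten_gen)
      qed
    qed
    with uv(1) have "lin (straighten P) (mon u * (r * mon v)) \<in> ?J"
      by (induction u) (auto simp: mon_Nil mon_Cons mult.assoc lin_straighten_gen vac_act_env_ideal)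
    then show "mon u * r * mon v \<in> {p. lin (straighten P) p \<in> ?J}" by (simp add: mult.assoc)
  qed
  with assms show ?thesis by auto
qed

text \<open>The constants annihilate the unit, so that the left ideal acts on it by zero.\<close>
lemma straighten_vac_ideal:
  fixes p :: "'g::complex_lie_algebra mero free_alg"
  assumes "p \<in> vac_ideal (insert P S)" shows "lin (straighten P) p \<in> env_ideal (maps0 P S)"
proof -
  let ?h = "maps (insert P S) :: 'g mero set" and ?J = "env_ideal (maps0 P S) :: 'g mero free_alg set"
  have "vac_ideal (insert P S) \<subseteq> {p. lin (straighten P) p \<in> ?J}"
    unfolding vac_ideal_def
  proof (rule aug_left_ideal_subset[OF lsub_lin_vimage[OF env_ideal_lsub]])
    fix u :: "'g mero list" and x :: "'g mero" assume u: "set u \<subseteq> ?h" and x: "x \<in> range const_map"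
    from x obtain b where b: "x = const_map b" by blast
    have "lin (straighten P) (gen x) \<in> ?J"
      using gen_0_env[OF lie_sub_0[OF lie_sub_maps0, of P S]] lin_mon[of "ad (const_map b)" "[]"]
      by (simp add: b vac_act_def mon_Nil)
    with u have "lin (straighten P) (mon u * gen x) \<in> ?J"
      by (induction u) (auto simp: mon_Nil mon_Cons mult.assoc lin_straighten_gen vac_act_env_ideal)
    then show "mon u * gen x \<in> {p. lin (straighten P) p \<in> ?J}" by simp
  qed (auto simp: straighten_env_ideal)
  with assms show ?thesis by auto
qed

lemma vac_act_vanishing:
  assumes "val \<alpha> P = 0" "p \<in> free_on (maps0 P S)"
  shows "vac_act P \<alpha> p - gen \<alpha> * p \<in> env_ideal (maps0 P S)"
  using ad_0_env[OF lie_sub_maps0 assms(2)] assms(1) by (simp add: vac_act_def const_map_0)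

lemma straighten_id:
  fixes p :: "'g::complex_lie_algebra mero free_alg"
  assumes "p \<in> free_on (maps0 P S)" shows "lin (straighten P) p - p \<in> env_ideal (maps0 P S)"
proof (rule linear_eq_on_free[OF assms])
  fix w :: "'g mero list" assume "set w \<subseteq> maps0 P S"
  then have "straighten P w - mon w \<in> env_ideal (maps0 P S)"
  proof (induction w)
    case (Cons \<alpha> w)
    then have w: "\<alpha> \<in> maps0 P S" "val \<alpha> P = 0" "straighten P w \<in> free_on (maps0 P S)"
      using straighten_in_free_on[of "mon w" P S] by (auto simp: maps0_def)
    then have "(vac_act P \<alpha> (straighten P w) - gen \<alpha> * straighten P w) + gen \<alpha> * (straighten P w - mon w) \<in> env_ideal (maps0 P S)"
      using Cons by (intro env_ideal_closed(2) vac_act_vanishing env_ideal_mult_left) auto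
    then show ?case by (simp add: mon_Cons algebra_simps)
  qed (simp add: mon_Nil env_ideal.zero)
  then show "lin (straighten P) (mon w) - mon w \<in> env_ideal (maps0 P S)" by simp
qed (auto simp: lin_add lin_scal env_ideal_lsub)

lemma vac_ideal_lsub: "lsub (vac_ideal S)"
  by (simp add: vac_ideal_def aug_left_ideal_lsub)

lemma env_ideal_vac_ideal: "p \<in> env_ideal (maps S) \<Longrightarrow> p \<in> vac_ideal S"
  by (simp add: vac_ideal_def aug_left_ideal.base)

lemma vac_ideal_mult: "x \<in> vac_ideal S \<Longrightarrow> p \<in> free_on (maps S) \<Longrightarrow> p * x \<in> vac_ideal S"
  by (simp add: vac_ideal_def aug_left_ideal_mult)

lemma gen_const_vac_ideal: "gen (const_map a) \<in> vac_ideal S"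
  by (simp add: vac_ideal_def gen_in_aug_left_ideal)

lemma maps0_subset: "maps0 P S \<subseteq> maps (insert P S)"
  by (auto simp: maps0_def)

text \<open>Modulo the left ideal, left multiplication by a constant is the derivation \<^const>\<open>ad\<close>.\<close>
lemma const_commute_vac_ideal:
  fixes p :: "'g::complex_lie_algebra mero free_alg"
  assumes "p \<in> free_on (maps S)"
  shows "gen (const_map b) * p - lin (ad (const_map b)) p \<in> vac_ideal S"
proof (rule linear_eq_on_free[OF assms])
  let ?b = "const_map b"
  fix w :: "'g mero list" assume w: "set w \<subseteq> maps S"
  then have "gen ?b * mon w - mon w * gen ?b - ad ?b w \<in> env_ideal (maps S)"
  proof (induction w)
    case (Cons x w)
    then have "- ((gen (lie ?b x) - (gen ?b * gen x - gen x * gen ?b)) * mon w)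
        + gen x * (gen ?b * mon w - mon w * gen ?b - ad ?b w) \<in> env_ideal (maps S)"
      by (intro env_ideal_closed(2) env_ideal_closed(4) env_ideal_mult_left env_ideal_mult_right gen_lie_env) auto
    then show ?case by (simp add: mon_Cons algebra_simps)
  qed (simp add: mon_Nil env_ideal.zero)
  then have "(gen ?b * mon w - mon w * gen ?b - ad ?b w) + mon w * gen ?b \<in> vac_ideal S"
    using w by (intro lsub_add[OF vac_ideal_lsub] env_ideal_vac_ideal vac_ideal_mult gen_const_vac_ideal) auto
  then show "gen ?b * mon w - lin (ad ?b) (mon w) \<in> vac_ideal S" by (simp add: algebra_simps)
qed (auto simp: lin_add lin_scal distrib_left scal_left_commute[of "gen _"] vac_ideal_lsub)

lemma straighten_congruent:
  fixes p :: "'g::complex_lie_algebra mero free_alg"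
  assumes "p \<in> free_on (maps (insert P S))" shows "p - lin (straighten P) p \<in> vac_ideal (insert P S)"
proof (rule linear_eq_on_free[OF assms])
  let ?h = "maps (insert P S) :: 'g mero set"
  fix w :: "'g mero list" assume "set w \<subseteq> ?h"
  then have "mon w - straighten P w \<in> vac_ideal (insert P S)"
  proof (induction w)
    case (Cons \<alpha> w)
    let ?b = "const_map (val \<alpha> P)"
    have \<alpha>: "\<alpha> \<in> ?h" using Cons.prems by simp
    have rw: "straighten P w \<in> free_on ?h"
      using straighten_in_free_on[of "mon w" P S] Cons.prems free_on_mono[OF maps0_subset] by auto
    have "gen \<alpha> * (mon w - straighten P w)
        + (gen (\<alpha> - ?b + ?b) - (gen (\<alpha> - ?b) + gen ?b)) * straighten P w
        + (gen ?b * straighten P w - lin (ad ?b) (straighten P w)) \<in> vac_ideal (insert P S)"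
    proof (intro lsub_add[OF vac_ideal_lsub])
      show "gen \<alpha> * (mon w - straighten P w) \<in> vac_ideal (insert P S)"
        using Cons \<alpha> by (intro vac_ideal_mult) auto
      show "(gen (\<alpha> - ?b + ?b) - (gen (\<alpha> - ?b) + gen ?b)) * straighten P w \<in> vac_ideal (insert P S)"
        using \<alpha> rw by (intro env_ideal_vac_ideal env_ideal_mult_right gen_add_env lie_sub_diff[OF lie_sub_maps]) auto
      show "gen ?b * straighten P w - lin (ad ?b) (straighten P w) \<in> vac_ideal (insert P S)"
        using rw by (rule const_commute_vac_ideal)
    qed
    then show ?case by (simp add: mon_Cons vac_act_def algebra_simps)
  qed (simp add: mon_Nil lsub_0[OF vac_ideal_lsub])
  then show "mon w - lin (straighten P) (mon w) \<in> vac_ideal (insert P S)" by simp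
qed (auto simp: lin_add lin_scal vac_ideal_lsub)

section \<open>The embeddings of the vacuum spaces\<close>

lemma vac_ideal_mono:
  assumes "S \<subseteq> T" shows "(vac_ideal T :: 'g::complex_lie_algebra mero free_alg set) \<subseteq> vac_ideal S"
proof -
  note m = maps_mono[OF assms, where 'a='g]
  show ?thesis
    unfolding vac_ideal_def
  proof (rule aug_left_ideal_subset[OF aug_left_ideal_lsub])
    show "env_ideal (maps T :: 'g mero set) \<subseteq> aug_left_ideal (maps S) (range const_map)"
      using env_ideal_mono[OF m] by (intro subsetI aug_left_ideal.base) blast
    show "mon u * gen x \<in> aug_left_ideal (maps S) (range const_map)"
      if "set u \<subseteq> maps T" "x \<in> range const_map" for u and x :: "'g mero"
      using that m by (intro aug_left_ideal_mult gen_in_aug_left_ideal) auto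
  qed auto
qed

text \<open>The identification of the vacuum space takes the class of \<open>p\<close> to the class of its straightening.\<close>
lemma vac_emb_coset:
  fixes p :: "'g::complex_lie_algebra mero free_alg"
  assumes T: "insert P S \<subseteq> T" and p: "p \<in> free_on (maps T)"
  shows "vac_emb P S (p +o vac_ideal T) = lin (straighten P) p +o env_ideal (maps0 P S)"
proof -
  let ?J = "env_ideal (maps0 P S) :: 'g mero free_alg set"
    and ?V = "vac_ideal (insert P S) :: 'g mero free_alg set"
  have p': "p \<in> free_on (maps (insert P S))"
    using p free_on_mono[OF maps_mono[OF T]] by auto
  have JV: "?J \<subseteq> ?V"
    using env_ideal_mono[OF maps0_subset[of P S]] env_ideal_vac_ideal by auto
  have pbw: "pbw P S (q +o ?J) = q +o ?V" for q :: "'g mero free_alg"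
    unfolding pbw_def by (rule coset_add_ideal[OF env_ideal_lsub vac_ideal_lsub JV])
  have inj: "inj_on (pbw P S) (env (maps0 P S) :: 'g mero free_alg set set)"
  proof (rule inj_onI)
    fix X Y :: "'g mero free_alg set"
    assume "X \<in> env (maps0 P S)" "Y \<in> env (maps0 P S)" and eq: "pbw P S X = pbw P S Y"
    then obtain q q' where q: "q \<in> free_on (maps0 P S)" "X = q +o ?J" "q' \<in> free_on (maps0 P S)" "Y = q' +o ?J"
      by (auto simp: env_def)
    have "q - q' \<in> ?V" using eq by (simp add: q pbw coset_eq_iff vac_ideal_lsub)
    then have "lin (straighten P) (q - q') \<in> ?J" by (rule straighten_vac_ideal)
    moreover have "lin (straighten P) (q - q') - (q - q') \<in> ?J"
      using q by (intro straighten_id free_on_closed) auto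
    ultimately have "lin (straighten P) (q - q') - (lin (straighten P) (q - q') - (q - q')) \<in> ?J"
      by (rule env_ideal_closed(5))
    then show "X = Y" by (simp add: q coset_eq_iff env_ideal_lsub)
  qed
  have "(p +o vac_ideal T) + ?V = p +o ?V"
    by (rule coset_add_ideal[OF vac_ideal_lsub vac_ideal_lsub vac_ideal_mono[OF T]])
  also have "\<dots> = pbw P S (lin (straighten P) p +o ?J)"
    unfolding pbw using straighten_congruent[OF p'] by (simp add: coset_eq_iff vac_ideal_lsub)
  finally show ?thesis
    unfolding vac_emb_def using inj straighten_in_free_on[OF p']
    by (simp add: env_def)
qed

lemma vac_emb_inj:
  assumes T: "insert P S \<subseteq> T"
  shows "inj_on (vac_emb P S) (vac T :: 'g::complex_lie_algebra mero free_alg set set)"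
proof (rule inj_onI)
  fix X Y :: "'g mero free_alg set"
  assume "X \<in> vac T" "Y \<in> vac T" and eq: "vac_emb P S X = vac_emb P S Y"
  then obtain p q where pq: "p \<in> free_on (maps T)" "X = p +o vac_ideal T" "q \<in> free_on (maps T)" "Y = q +o vac_ideal T"
    by (auto simp: vac_def)
  \<comment> \<open>The straightening of \<open>p - q\<close> has letters regular on \<open>T\<close>, and the enveloping algebra of the
    maps regular on \<open>T\<close> that vanish at \<open>P\<close> embeds.\<close>
  have d: "p - q \<in> free_on (maps (insert P T))"
    using pq T by (simp add: insert_absorb free_on_closed)
  have "lin (straighten P) (p - q) \<in> env_ideal (maps0 P S)"
    using eq by (simp add: pq vac_emb_coset[OF T] coset_eq_iff env_ideal_lsub lin_diff)
  moreover have "lin (straighten P) (p - q) \<in> free_on (maps0 P T)"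
    by (rule straighten_in_free_on[OF d])
  ultimately have "lin (straighten P) (p - q) \<in> env_ideal (maps0 P T)"
    using env_ideal_maps0_Int[of S T] T by blast
  then have "lin (straighten P) (p - q) \<in> vac_ideal (insert P T)"
    using env_ideal_mono[OF maps0_subset[of P T]] env_ideal_vac_ideal by blast
  with straighten_congruent[OF d] have "p - q - lin (straighten P) (p - q) + lin (straighten P) (p - q) \<in> vac_ideal (insert P T)"
    by (intro lsub_add[OF vac_ideal_lsub])
  then show "X = Y"
    using T by (simp add: pq coset_eq_iff vac_ideal_lsub insert_absorb)
qed

text \<open>An operator that is induced by one map \<open>G\<close> of the free algebra on both sides of the identifications
  restricts to the operator induced by \<open>G\<close> on the subspaces.\<close>
lemma restrict_op_coset:
  fixes G :: "'g::complex_lie_algebra mero free_alg \<Rightarrow> 'g mero free_alg"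
  assumes T: "insert P S \<subseteq> T" "insert P S' \<subseteq> T'"
    and G: "\<And>p q. G (p - q) = G p - G q"
    and vac: "\<And>p. p \<in> vac_ideal (insert P S) \<Longrightarrow> G p \<in> vac_ideal (insert P S')"
    and free: "\<And>p. p \<in> free_on (maps0 P S) \<Longrightarrow> G p \<in> free_on (maps0 P S')"
      "\<And>p. p \<in> free_on (maps T) \<Longrightarrow> G p \<in> free_on (maps T')"
    and A: "\<And>q. q \<in> free_on (maps0 P S) \<Longrightarrow>
      A (q +o env_ideal (maps0 P S)) = G q +o env_ideal (maps0 P S')"
  shows "restricts P S S' T T' A"
    and "p \<in> free_on (maps T) \<Longrightarrow> restrict_op P S S' T' A (p +o vac_ideal T) = G p +o vac_ideal T'"
proof -
  let ?J = "env_ideal (maps0 P S') :: 'g mero free_alg set"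
  have *: "A (vac_emb P S (p +o vac_ideal T)) = vac_emb P S' (G p +o vac_ideal T')"
    if p: "p \<in> free_on (maps T)" for p
  proof -
    have p': "p \<in> free_on (maps (insert P S))"
      using p free_on_mono[OF maps_mono[OF T(1)]] by auto
    let ?q = "lin (straighten P) p"
    have q: "?q \<in> free_on (maps0 P S)" by (rule straighten_in_free_on[OF p'])
    have "lin (straighten P) (G p - G ?q) \<in> ?J"
      using vac[OF straighten_congruent[OF p']] by (intro straighten_vac_ideal) (simp add: G)
    moreover have "lin (straighten P) (G ?q) - G ?q \<in> ?J"
      by (intro straighten_id free q)
    ultimately have "lin (straighten P) (G p - G ?q) + (lin (straighten P) (G ?q) - G ?q) \<in> ?J"
      by (intro env_ideal_closed(2))
    then have "lin (straighten P) (G p) - G ?q \<in> ?J" by (simp add: lin_diff)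
    then show ?thesis
      using vac_emb_coset[OF T(1) p] vac_emb_coset[OF T(2) free(2)[OF p]] A[OF q]
      by (simp add: coset_eq_iff env_ideal_lsub lsub_minus_commute)
  qed
  show "restricts P S S' T T' A"
    unfolding restricts_def
  proof
    fix X :: "'g mero free_alg set" assume "X \<in> vac T"
    then obtain p where p: "p \<in> free_on (maps T)" "X = p +o vac_ideal T" by (auto simp: vac_def)
    then show "A (vac_emb P S X) \<in> vac_emb P S' ` vac T'"
      using *[OF p(1)] free(2)[OF p(1)] by (auto simp: vac_def)
  qed
  assume p: "p \<in> free_on (maps T)"
  have "G p +o vac_ideal T' \<in> vac T'" using free(2)[OF p] by (auto simp: vac_def)
  then show "restrict_op P S S' T' A (p +o vac_ideal T) = G p +o vac_ideal T'"
    unfolding restrict_op_def *[OF p] by (rule inv_into_f_f[OF vac_emb_inj[OF T(2)]])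
qed

section \<open>Annihilation operators on words\<close>

text \<open>The map \<open>\<gamma> a \<alpha> = s [a, \<alpha> z - \<alpha>]\<close>, where \<open>K\<close> is multiplication by \<open>s\<close>.\<close>
definition gam :: "('g::metric_lie_algebra mero \<Rightarrow> 'g mero) \<Rightarrow> cp1 \<Rightarrow> 'g \<Rightarrow> 'g mero \<Rightarrow> 'g mero" where
  "gam K z a \<alpha> = K (lie (const_map a) (const_map (val \<alpha> z) - \<alpha>))"

text \<open>The recursion for \<open>\<iota> a\<close> on words. The argument \<open>a\<close> comes last since it changes in the recursion.\<close>
primrec ann_word :: "('g::metric_lie_algebra mero \<Rightarrow> 'g mero) \<Rightarrow> cp1 \<Rightarrow> 'g mero list \<Rightarrow> 'g \<Rightarrow> 'g mero free_alg" where
  "ann_word K z [] = (\<lambda>a. 0)"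
| "ann_word K z (\<alpha> # w) = (\<lambda>a. gen \<alpha> * ann_word K z w a + gen (gam K z a \<alpha>) * mon w
     - scal (inv_form a (dval \<alpha> z)) * mon w + ann_word K z w (lie a (val \<alpha> z)))"

definition ann_op :: "('g::metric_lie_algebra mero \<Rightarrow> 'g mero) \<Rightarrow> cp1 \<Rightarrow> 'g \<Rightarrow> 'g mero free_alg \<Rightarrow> 'g mero free_alg" where
  "ann_op K z a = lin (\<lambda>w. ann_word K z w a)"

lemma ann_op_linear:
  "ann_op K z a (p + q) = ann_op K z a p + ann_op K z a q"
  "ann_op K z a (p - q) = ann_op K z a p - ann_op K z a q"
  "ann_op K z a (scal c * p) = scal c * ann_op K z a p"
  by (simp_all add: ann_op_def lin_add lin_diff lin_scal)

lemma ann_op_mon [simp]: "ann_op K z a (mon w) = ann_word K z w a"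
  by (simp add: ann_op_def)

lemma ann_op_1 [simp]: "ann_op K z a 1 = 0"
  using ann_op_mon[of K z a "[]"] by (simp add: mon_Nil)

lemma ann_op_0 [simp]: "ann_op K z a 0 = 0"
  by (simp add: ann_op_def)

lemma ann_op_gen_mult:
  "ann_op K z a (gen \<alpha> * p) = gen \<alpha> * ann_op K z a p + gen (gam K z a \<alpha>) * p
     - scal (inv_form a (dval \<alpha> z)) * p + ann_op K z (lie a (val \<alpha> z)) p"
proof -
  have "ann_op K z a (gen \<alpha> * p) - (gen \<alpha> * ann_op K z a p + gen (gam K z a \<alpha>) * p
     - scal (inv_form a (dval \<alpha> z)) * p + ann_op K z (lie a (val \<alpha> z)) p) \<in> {0}"
  proof (rule linear_eq_on_free[of p UNIV _ _ "{0}"])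
    fix w :: "'a mero list"
    show "ann_op K z a (gen \<alpha> * mon w) - (gen \<alpha> * ann_op K z a (mon w) + gen (gam K z a \<alpha>) * mon w
      - scal (inv_form a (dval \<alpha> z)) * mon w + ann_op K z (lie a (val \<alpha> z)) (mon w)) \<in> {0}"
      by (simp flip: mon_Cons)
  qed (auto simp: ann_op_linear distrib_left right_diff_distrib scal_left_commute[of "gen _"]
      scal_left_commute[of "scal (inv_form a (dval \<alpha> z))"] lsub_singleton_0)
  then show ?thesis by simp
qed

lemma inv_form_add_right: "inv_form x (y + w) = inv_form x y + inv_form x (w::'g::metric_lie_algebra)"
  by (simp add: inv_form_sym[of x] inv_form_add_left)

lemma inv_form_scaleC_right: "inv_form x (c *\<^sub>C y) = c * inv_form x (y::'g::metric_lie_algebra)"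
  by (simp add: inv_form_sym[of x] inv_form_scaleC_left)

lemma inv_form_0_right [simp]: "inv_form x (0::'g::metric_lie_algebra) = 0"
  using inv_form_scaleC_right[of x 0 0] by simp

lemma inv_form_diff_right: "inv_form x (y - w) = inv_form x y - inv_form x (w::'g::metric_lie_algebra)"
  using inv_form_add_right[of x "y - w" w] by simp

lemma mon_mult_closed:
  assumes "\<And>\<alpha> p. \<alpha> \<in> h \<Longrightarrow> p \<in> V \<Longrightarrow> gen \<alpha> * p \<in> V" "p \<in> V" "set u \<subseteq> h"
  shows "mon u * p \<in> V"
  using assms(3) by (induction u) (auto simp: mon_Nil mon_Cons mult.assoc assms)

text \<open>The properties of multiplication by a scalar function that the algebra uses.\<close>
locale kernel =
  fixes K :: "'g::metric_lie_algebra mero \<Rightarrow> 'g mero" and z :: cp1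
  assumes K_add: "K (\<alpha> + \<beta>) = K \<alpha> + K \<beta>"
    and K_scaleC: "K (c *\<^sub>C \<alpha>) = c *\<^sub>C K \<alpha>"
    and K_lie_left: "K (lie \<alpha> \<beta>) = lie (K \<alpha>) \<beta>"
begin

lemma K_0: "K 0 = 0"
  using K_scaleC[of 0 0] by simp

lemma K_minus: "K (- \<alpha>) = - K \<alpha>"
  using K_scaleC[of "-1" \<alpha>] by (simp add: scaleC_minus_left scaleC_one)

lemma K_diff: "K (\<alpha> - \<beta>) = K \<alpha> - K \<beta>"
  using K_add[of \<alpha> "- \<beta>"] by (simp add: K_minus)

lemma K_lie_right: "K (lie \<alpha> \<beta>) = lie \<alpha> (K \<beta>)"
  using K_lie_left[of \<beta> \<alpha>] lie_anticomm[of \<alpha> \<beta>] lie_anticomm[of \<alpha> "K \<beta>"]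
  by (simp add: K_minus)

lemma gam_add_left: "gam K z (a + b) \<alpha> = gam K z a \<alpha> + gam K z b \<alpha>"
  by (simp add: gam_def const_map_add lie_add_left K_add)

lemma gam_scaleC_left: "gam K z (c *\<^sub>C a) \<alpha> = c *\<^sub>C gam K z a \<alpha>"
  by (simp add: gam_def const_map_scaleC lie_scaleC_left K_scaleC)

lemma gam_add_right:
  "regular_at z \<alpha> \<Longrightarrow> regular_at z \<beta> \<Longrightarrow> gam K z a (\<alpha> + \<beta>) = gam K z a \<alpha> + gam K z a \<beta>"
  by (simp add: gam_def val_add const_map_add add_diff_add lie_add_right K_add)

lemma gam_scaleC_right: "regular_at z \<alpha> \<Longrightarrow> gam K z a (c *\<^sub>C \<alpha>) = c *\<^sub>C gam K z a \<alpha>"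
  by (simp add: gam_def val_scaleC const_map_scaleC clie.scale_right_diff_distrib[symmetric] lie_scaleC_right K_scaleC)

lemma gam_const: "gam K z a (const_map b) = 0"
  by (simp add: gam_def K_0)

text \<open>The cocycle property that makes \<^const>\<open>ann_op\<close> compatible with brackets.\<close>
lemma gam_lie:
  assumes "regular_at z \<alpha>" "regular_at z \<beta>"
  shows "gam K z a (lie \<alpha> \<beta>) = lie \<alpha> (gam K z a \<beta>) + lie (gam K z a \<alpha>) \<beta>
    + (gam K z (lie a (val \<alpha> z)) \<beta> - gam K z (lie a (val \<beta> z)) \<alpha>)"
proof -
  define A x y where "A = const_map a" and "x = const_map (val \<alpha> z)" and "y = const_map (val \<beta> z)"
  have 1: "lie (lie A x) y = lie A (lie x y) + lie (lie A y) x"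
    unfolding lie_lie_right[of A x y] lie_anticomm[of "lie A y" x] by simp
  have 2: "lie (lie A y) \<alpha> = - lie \<alpha> (lie A y)" by (rule lie_anticomm)
  have "lie A (lie x y - lie \<alpha> \<beta>) = lie \<alpha> (lie A (y - \<beta>)) + lie (lie A (x - \<alpha>)) \<beta>
      + (lie (lie A x) (y - \<beta>) - lie (lie A y) (x - \<alpha>))"
    by (simp add: lie_diff_left lie_diff_right 1 2 lie_lie_right[of A \<alpha> \<beta>])
  then show ?thesis
    using assms unfolding gam_def A_def x_def y_def
    by (simp only: val_lie const_map_lie K_add K_diff K_lie_left[symmetric] K_lie_right[symmetric])
qed

end

text \<open>Lie algebras \<open>h\<close> of maps regular at \<open>z\<close> on whose free algebra \<^const>\<open>ann_op\<close> acts.\<close>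
locale kernel_on = kernel K z for K :: "'g::metric_lie_algebra mero \<Rightarrow> 'g mero" and z :: cp1 +
  fixes h :: "'g mero set"
  assumes lie_sub_h: "lie_sub h"
    and regular: "\<alpha> \<in> h \<Longrightarrow> regular_at z \<alpha>"
    and gam_in: "\<alpha> \<in> h \<Longrightarrow> gam K z a \<alpha> \<in> h"
begin

lemma ann_op_in_free_on:
  assumes "p \<in> free_on h" shows "ann_op K z a p \<in> free_on h"
  unfolding ann_op_def
proof (rule free_on_lin_in[OF assms free_on_lsub])
  fix w assume "set w \<subseteq> h"
  then show "ann_word K z w a \<in> free_on h"
    by (induction w arbitrary: a) (auto intro!: free_on_closed simp: gam_in)
qed

lemma ann_op_add_env:
  assumes p: "p \<in> free_on h"
  shows "ann_op K z (a + b) p - (ann_op K z a p + ann_op K z b p) \<in> env_ideal h"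
proof (rule linear_eq_on_free[OF p])
  fix w assume "set w \<subseteq> h"
  then have "ann_word K z w (a + b) - (ann_word K z w a + ann_word K z w b) \<in> env_ideal h"
  proof (induction w arbitrary: a b)
    case (Cons \<alpha> w)
    have "gen \<alpha> * (ann_word K z w (a + b) - (ann_word K z w a + ann_word K z w b))
      + (gen (gam K z a \<alpha> + gam K z b \<alpha>) - (gen (gam K z a \<alpha>) + gen (gam K z b \<alpha>))) * mon w
      + (ann_word K z w (lie a (val \<alpha> z) + lie b (val \<alpha> z)) - (ann_word K z w (lie a (val \<alpha> z)) + ann_word K z w (lie b (val \<alpha> z))))
      \<in> env_ideal h"
      using Cons by (intro env_ideal_closed(2) env_ideal_mult_left env_ideal_mult_right gen_add_env) (auto simp: gam_in)
    then show ?case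
      by (simp add: gam_add_left lie_add_left inv_form_add_left scal_add algebra_simps)
  qed (simp add: env_ideal.zero)
  then show "ann_op K z (a + b) (mon w) - (ann_op K z a (mon w) + ann_op K z b (mon w)) \<in> env_ideal h"
    by simp
qed (auto simp: ann_op_linear distrib_left env_ideal_lsub)

lemma ann_op_scaleC_env:
  assumes p: "p \<in> free_on h"
  shows "ann_op K z (c *\<^sub>C a) p - scal c * ann_op K z a p \<in> env_ideal h"
proof (rule linear_eq_on_free[OF p])
  fix w assume "set w \<subseteq> h"
  then have "ann_word K z w (c *\<^sub>C a) - scal c * ann_word K z w a \<in> env_ideal h"
  proof (induction w arbitrary: a)
    case (Cons \<alpha> w)
    have "gen \<alpha> * (ann_word K z w (c *\<^sub>C a) - scal c * ann_word K z w a)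
      + (gen (c *\<^sub>C gam K z a \<alpha>) - scal c * gen (gam K z a \<alpha>)) * mon w
      + (ann_word K z w (c *\<^sub>C lie a (val \<alpha> z)) - scal c * ann_word K z w (lie a (val \<alpha> z)))
      \<in> env_ideal h"
      using Cons by (intro env_ideal_closed(2) env_ideal_mult_left env_ideal_mult_right gen_scaleC_env) (auto simp: gam_in)
    then show ?case
      by (simp add: gam_scaleC_left lie_scaleC_left inv_form_scaleC_left scal_mult algebra_simps
          scal_left_commute[of "gen \<alpha>"])
  qed (simp add: env_ideal.zero)
  then show "ann_op K z (c *\<^sub>C a) (mon w) - scal c * ann_op K z a (mon w) \<in> env_ideal h"
    by simp
next
  show "scal c * ann_op K z a (scal d * x) = scal d * (scal c * ann_op K z a x)" for d x
    by (simp add: ann_op_linear scal_left_commute[of "scal c"])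
qed (auto simp: ann_op_linear distrib_left env_ideal_lsub)

lemma ann_op_rel_add:
  assumes "\<alpha> \<in> h" "\<beta> \<in> h" "q \<in> free_on h"
  shows "ann_op K z a ((gen (\<alpha> + \<beta>) - (gen \<alpha> + gen \<beta>)) * q) \<in> env_ideal h"
proof -
  have r: "regular_at z \<alpha>" "regular_at z \<beta>" using assms regular by auto
  have "(gen (\<alpha> + \<beta>) - (gen \<alpha> + gen \<beta>)) * ann_op K z a q
    + (gen (gam K z a \<alpha> + gam K z a \<beta>) - (gen (gam K z a \<alpha>) + gen (gam K z a \<beta>))) * q
    + (ann_op K z (lie a (val \<alpha> z) + lie a (val \<beta> z)) q
        - (ann_op K z (lie a (val \<alpha> z)) q + ann_op K z (lie a (val \<beta> z)) q)) \<in> env_ideal h"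
    using assms by (intro env_ideal_closed(2) env_ideal_mult_right gen_add_env ann_op_add_env ann_op_in_free_on)
      (auto simp: gam_in)
  then show ?thesis
    by (simp add: left_diff_distrib distrib_right ann_op_linear ann_op_gen_mult gam_add_right r val_add dval_add
        lie_add_right inv_form_add_right scal_add) (simp add: algebra_simps)
qed

lemma ann_op_rel_scaleC:
  assumes "\<alpha> \<in> h" "q \<in> free_on h"
  shows "ann_op K z a ((gen (c *\<^sub>C \<alpha>) - scal c * gen \<alpha>) * q) \<in> env_ideal h"
proof -
  have r: "regular_at z \<alpha>" using assms regular by auto
  have "(gen (c *\<^sub>C \<alpha>) - scal c * gen \<alpha>) * ann_op K z a q
    + (gen (c *\<^sub>C gam K z a \<alpha>) - scal c * gen (gam K z a \<alpha>)) * q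
    + (ann_op K z (c *\<^sub>C lie a (val \<alpha> z)) q - scal c * ann_op K z (lie a (val \<alpha> z)) q) \<in> env_ideal h"
    using assms by (intro env_ideal_closed(2) env_ideal_mult_right gen_scaleC_env ann_op_scaleC_env ann_op_in_free_on)
      (auto simp: gam_in)
  then show ?thesis
    by (simp add: left_diff_distrib mult.assoc ann_op_linear ann_op_gen_mult gam_scaleC_right r val_scaleC dval_scaleC
        lie_scaleC_right inv_form_scaleC_right scal_mult) (simp add: algebra_simps)
qed

text \<open>Expanding \<open>\<alpha> \<beta> q - \<beta> \<alpha> q\<close>, the mixed terms are symmetric in \<open>\<alpha>\<close> and \<open>\<beta>\<close> and cancel. What remains is the
  identity for \<^const>\<open>gam\<close>, invariance of the form and the Jacobi identity.\<close>
lemma ann_op_rel_lie: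
  assumes "\<alpha> \<in> h" "\<beta> \<in> h" and q: "q \<in> free_on h"
  shows "ann_op K z a ((gen (lie \<alpha> \<beta>) - (gen \<alpha> * gen \<beta> - gen \<beta> * gen \<alpha>)) * q) \<in> env_ideal h"
proof -
  have r: "regular_at z \<alpha>" "regular_at z \<beta>" using assms regular by auto
  define I where "I b = ann_op K z b q" for b
  define g where "g b \<gamma> = gam K z b \<gamma>" for b \<gamma>
  define a\<alpha> a\<beta> where "a\<alpha> = lie a (val \<alpha> z)" and "a\<beta> = lie a (val \<beta> z)"
  have gin: "g b \<gamma> \<in> h" if "\<gamma> \<in> h" for b \<gamma> using that by (simp add: g_def gam_in)
  note L = lie_sub_h
  let ?J = "env_ideal h"
  have val: "lie a (val (lie \<alpha> \<beta>) z) = lie a\<alpha> (val \<beta> z) - lie a\<beta> (val \<alpha> z)"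
    using r lie_anticomm[of "val \<alpha> z" "lie a (val \<beta> z)"]
    by (simp add: val_lie a\<alpha>_def a\<beta>_def lie_lie_right[of a])
  have inv: "inv_form a (dval (lie \<alpha> \<beta>) z) = inv_form a\<alpha> (dval \<beta> z) - inv_form a\<beta> (dval \<alpha> z)"
    using r lie_anticomm[of "dval \<alpha> z" "val \<beta> z"]
    by (simp add: dval_lie a\<alpha>_def a\<beta>_def inv_form_diff_right inv_form_invariant)
  have gl: "g a (lie \<alpha> \<beta>) = lie \<alpha> (g a \<beta>) + lie (g a \<alpha>) \<beta> + (g a\<alpha> \<beta> - g a\<beta> \<alpha>)"
    unfolding g_def a\<alpha>_def a\<beta>_def by (rule gam_lie[OF r])
  define g1 g2 g3 g4 where "g1 = lie \<alpha> (g a \<beta>)" and "g2 = lie (g a \<alpha>) \<beta>"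
    and "g3 = g a\<alpha> \<beta>" and "g4 = g a\<beta> \<alpha>"
  have gs: "g1 \<in> h" "g2 \<in> h" "g3 \<in> h" "g4 \<in> h"
    using assms gin lie_sub_lie[OF L] by (auto simp: g1_def g2_def g3_def g4_def)
  have E1: "(gen (g1 + g2 + (g3 - g4)) - (gen (g1 + g2) + gen (g3 - g4)))
      + (gen (g1 + g2) - (gen g1 + gen g2)) + (gen (g3 - g4) - (gen g3 - gen g4))
      + (gen g1 - (gen \<alpha> * gen (g a \<beta>) - gen (g a \<beta>) * gen \<alpha>))
      + (gen g2 - (gen (g a \<alpha>) * gen \<beta> - gen \<beta> * gen (g a \<alpha>))) \<in> ?J"
    unfolding g1_def g2_def using assms gin gs[unfolded g1_def g2_def]
    by (intro env_ideal_closed(2) gen_add_env gen_diff_env[OF L] gen_lie_env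
        lie_sub_add[OF L] lie_sub_diff[OF L])
  have E2: "ann_op K z (lie a\<alpha> (val \<beta> z)) q
      - (ann_op K z (lie a\<alpha> (val \<beta> z) - lie a\<beta> (val \<alpha> z)) q + ann_op K z (lie a\<beta> (val \<alpha> z)) q) \<in> ?J"
    using ann_op_add_env[OF q, of "lie a\<alpha> (val \<beta> z) - lie a\<beta> (val \<alpha> z)" "lie a\<beta> (val \<alpha> z)"] by simp
  have "(gen (lie \<alpha> \<beta>) - (gen \<alpha> * gen \<beta> - gen \<beta> * gen \<alpha>)) * I a \<in> ?J"
    unfolding I_def by (intro env_ideal_mult_right gen_lie_env ann_op_in_free_on assms)
  from env_ideal_closed(5)[OF env_ideal_closed(2)[OF this env_ideal_mult_right[OF E1 q]] E2[folded I_def]]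
  show ?thesis
    by (simp add: left_diff_distrib mult.assoc ann_op_linear ann_op_gen_mult val inv
        a\<alpha>_def[symmetric] a\<beta>_def[symmetric] I_def[symmetric] g_def[symmetric] gl
        g1_def[symmetric] g2_def[symmetric] g3_def[symmetric] g4_def[symmetric] scal_diff
        scal_left_commute[of "gen _"])
      (simp add: algebra_simps scal_left_commute[of "gen _"])
qed

lemma ann_op_env_ideal:
  assumes "p \<in> env_ideal h" shows "ann_op K z a p \<in> env_ideal h"
proof -
  let ?V = "{p \<in> env_ideal h. \<forall>a. ann_op K z a p \<in> env_ideal h}"
  have V: "lsub ?V"
    by (rule lsubI) (auto simp: ann_op_linear intro: env_ideal_closed)
  have step: "gen \<alpha> * p \<in> ?V" if "\<alpha> \<in> h" "p \<in> ?V" for \<alpha> p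
  proof -
    have "ann_op K z a (gen \<alpha> * p) \<in> env_ideal h" for a
      unfolding ann_op_gen_mult using that
      by (intro env_ideal_closed(2) env_ideal_closed(5) env_ideal_mult_left) (auto simp: gam_in)
    with that show ?thesis by (auto intro: env_ideal_mult_left)
  qed
  have "env_ideal h \<subseteq> ?V"
  proof (rule env_ideal_subset[OF V])
    fix u r v assume uv: "set u \<subseteq> h" "set v \<subseteq> h" and r: "r \<in> env_rels h"
    have "ann_op K z a (r * mon v) \<in> env_ideal h" for a
    proof -
      from r show ?thesis
        by (cases rule: env_relsE) (use uv ann_op_rel_add[of _ _ "mon v"] ann_op_rel_scaleC[of _ "mon v"]
          ann_op_rel_lie[of _ _ "mon v"] in auto)
    qed
    moreover have "r * mon v \<in> env_ideal h"
      using r uv by (intro env_ideal_mult_right env_rels_in_env_ideal) auto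
    ultimately have "r * mon v \<in> ?V" by blast
    with uv(1) have "mon u * (r * mon v) \<in> ?V"
      using step by (intro mon_mult_closed[where V = ?V]) auto
    then show "mon u * r * mon v \<in> ?V" by (simp only: mult.assoc)
  qed
  with assms show ?thesis by auto
qed

lemma ann_op_aug_left_ideal:
  assumes c: "range const_map \<subseteq> h" and p: "p \<in> aug_left_ideal h (range const_map)"
  shows "ann_op K z a p \<in> aug_left_ideal h (range const_map)"
proof -
  let ?A = "aug_left_ideal h (range const_map)"
  let ?V = "{p \<in> ?A. \<forall>a. ann_op K z a p \<in> ?A}"
  note A = lsub_closed[OF aug_left_ideal_lsub]
  have V: "lsub ?V"
    by (rule lsubI) (auto simp: ann_op_linear intro: A)
  have step: "gen \<alpha> * p \<in> ?V" if "\<alpha> \<in> h" "p \<in> ?V" for \<alpha> p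
  proof -
    have "ann_op K z a (gen \<alpha> * p) \<in> ?A" for a
      unfolding ann_op_gen_mult using that
      by (intro A(2) A(5) aug_left_ideal_mult A(3)) (auto simp: gam_in)
    with that show ?thesis by (auto intro: aug_left_ideal_mult)
  qed
  have "?A \<subseteq> ?V"
  proof (rule aug_left_ideal_subset[OF V _ c])
    show "env_ideal h \<subseteq> ?V" by (auto intro: aug_left_ideal.base ann_op_env_ideal)
    fix u x assume u: "set u \<subseteq> h" and x: "x \<in> range (const_map :: 'g \<Rightarrow> 'g mero)"
    have "ann_op K z a (gen x) \<in> ?A" for a
    proof -
      have "ann_op K z a (gen x) = gen 0"
        using x ann_op_gen_mult[of K z a x 1] by (auto simp: gam_const)
      then show ?thesis
        using gen_0_env[OF lie_sub_0[OF lie_sub_h]] by (simp add: aug_left_ideal.base)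
    qed
    then have "gen x \<in> ?V" using x by (auto intro: gen_in_aug_left_ideal)
    with u show "mon u * gen x \<in> ?V"
      using step by (intro mon_mult_closed[where V = ?V]) auto
  qed
  with p show ?thesis by auto
qed

end

text \<open>Subtracting the constant \<open>c\<close> from \<open>s\<close> adds left multiplication by \<open>c a\<close> to the operator. The unit
  is annihilated by \<open>a\<close> only modulo the left ideal.\<close>

lemma ann_op_change_kernel:
  fixes K K' :: "'g::metric_lie_algebra mero \<Rightarrow> 'g mero"
  assumes "kernel_on K z h" "kernel_on K' z h" and K': "\<And>\<alpha>. K' \<alpha> = K \<alpha> - c *\<^sub>C \<alpha>"
    and const: "range const_map \<subseteq> h" and p: "p \<in> free_on h"
  shows "ann_op K' z a p - (ann_op K z a p + scal c * gen (const_map a) * p) \<in> aug_left_ideal h (range const_map)"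
proof (rule linear_eq_on_free[OF p])
  interpret K: kernel_on K z h by fact
  interpret K': kernel_on K' z h by fact
  let ?A = "aug_left_ideal h (range const_map)" and ?J = "env_ideal h"
  note A = lsub_closed[OF aug_left_ideal_lsub[of h "range const_map"]]
  note L = K.lie_sub_h
  fix w assume "set w \<subseteq> h"
  then have "ann_word K' z w a - (ann_word K z w a + scal c * gen (const_map a) * mon w) \<in> ?A"
  proof (induction w arbitrary: a)
    case Nil
    have "- (scal c * gen (const_map a)) \<in> ?A"
      by (intro A(4) A(3) gen_in_aug_left_ideal) auto
    then show ?case by (simp add: mon_Nil)
  next
    case (Cons \<alpha> w)
    \<comment> \<open>The two maps \<^const>\<open>gam\<close> differ by \<open>c [a, \<alpha> z - \<alpha>]\<close>. Here \<open>c [a, \<alpha> z]\<close> is the correction in the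
      last term of the recursion, and \<open>c [a, \<alpha>]\<close> comes from moving \<open>c a\<close> past \<open>\<alpha>\<close>.\<close>
    define b where "b = lie a (val \<alpha> z)"
    let ?ca = "const_map a" and ?cb = "const_map b"
    have \<alpha>: "\<alpha> \<in> h" and w: "mon w \<in> free_on h" using Cons.prems by auto
    have ca: "?ca \<in> h" "?cb \<in> h" using const by auto
    have g: "gam K' z a \<alpha> = gam K z a \<alpha> - c *\<^sub>C (?cb - lie ?ca \<alpha>)"
      by (simp add: gam_def K' b_def const_map_lie lie_diff_right)
    have gin: "gam K z a \<alpha> \<in> h" by (rule K.gam_in[OF \<alpha>])
    have l: "lie ?ca \<alpha> \<in> h" by (rule lie_sub_lie[OF L ca(1) \<alpha>])
    have "(gen (gam K z a \<alpha> - c *\<^sub>C (?cb - lie ?ca \<alpha>)) - (gen (gam K z a \<alpha>) - gen (c *\<^sub>C (?cb - lie ?ca \<alpha>))))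
        - (gen (c *\<^sub>C (?cb - lie ?ca \<alpha>)) - scal c * gen (?cb - lie ?ca \<alpha>))
        - scal c * (gen (?cb - lie ?ca \<alpha>) - (gen ?cb - gen (lie ?ca \<alpha>)))
        + scal c * (gen (lie ?ca \<alpha>) - (gen ?ca * gen \<alpha> - gen \<alpha> * gen ?ca)) \<in> ?J" (is "?e \<in> _")
      using \<alpha> ca gin l
      by (intro env_ideal_closed(2) env_ideal_closed(5) env_ideal_closed(3) gen_diff_env[OF L] gen_scaleC_env
          gen_lie_env lie_sub_diff[OF L] lie_sub_scaleC[OF L])
    then have "?e * mon w \<in> ?A"
      using w by (intro aug_left_ideal.base env_ideal_mult_right)
    moreover have "gen \<alpha> * (ann_word K' z w a - (ann_word K z w a + scal c * gen ?ca * mon w)) \<in> ?A"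
      using Cons \<alpha> by (intro aug_left_ideal_mult) auto
    moreover have "ann_word K' z w b - (ann_word K z w b + scal c * gen ?cb * mon w) \<in> ?A"
      using Cons by auto
    ultimately have "?e * mon w
        + gen \<alpha> * (ann_word K' z w a - (ann_word K z w a + scal c * gen ?ca * mon w))
        + (ann_word K' z w b - (ann_word K z w b + scal c * gen ?cb * mon w)) \<in> ?A"
      by (rule A(2)[OF A(2)])
    then show ?case
      unfolding ann_word.simps g b_def[symmetric]
      by (simp add: mon_Cons algebra_simps scal_left_commute[of "gen _"])
  qed
  then show "ann_op K' z a (mon w) - (ann_op K z a (mon w) + scal c * gen (const_map a) * mon w) \<in> ?A"
    by simp
next
  show "ann_op K z a (scal d * x) + scal c * gen (const_map a) * (scal d * x)
      = scal d * (ann_op K z a x + scal c * gen (const_map a) * x)" for d x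
    by (simp add: ann_op_linear distrib_left mult.assoc scal_left_commute[of "gen _"] scal_left_commute[of "scal c"])
qed (auto simp: ann_op_linear distrib_left aug_left_ideal_lsub)

section \<open>The fields of a coordinate\<close>

text \<open>What is used of a coordinate \<open>u\<close> with pole at \<open>P\<close>: the operator \<open>T\<close> of multiplication by
  \<open>1 / (u - u z)\<close> takes maps regular at \<open>P\<close> to maps vanishing there, preserves regularity at
  another point \<open>Q\<close>, and, scaled by the differential of \<open>u\<close> at \<open>z\<close>, takes maps that vanish at \<open>z\<close>
  to maps regular at \<open>z\<close>. This also covers the coordinate \<open>1 / u\<close> with the points exchanged.\<close>
locale field_at =
  fixes P z Q :: cp1 and u :: "cp1 \<Rightarrow> complex" and T :: "'g::metric_lie_algebra mero \<Rightarrow> 'g mero"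
  assumes T_add: "T (\<alpha> + \<beta>) = T \<alpha> + T \<beta>"
    and T_scaleC: "T (c *\<^sub>C \<alpha>) = c *\<^sub>C T \<alpha>"
    and T_lie_left: "T (lie \<alpha> \<beta>) = lie (T \<alpha>) \<beta>"
    and T_P: "regular_at P \<alpha> \<Longrightarrow> regular_at P (T \<alpha>)" "regular_at P \<alpha> \<Longrightarrow> val (T \<alpha>) P = 0"
    and T_Q: "regular_at Q \<alpha> \<Longrightarrow> regular_at Q (T \<alpha>)"
    and T_z: "regular_at z \<alpha> \<Longrightarrow> val \<alpha> z = 0 \<Longrightarrow> regular_at z (df z u *\<^sub>C T \<alpha>)"
    and eps_elt: "eps_elt u z a = scal (df z u) * gen (T (const_map a))"
begin

text \<open>Multiplication by \<open>s = du / (u - u z)\<close>.\<close>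
definition K :: "'g mero \<Rightarrow> 'g mero" where "K \<alpha> = df z u *\<^sub>C T \<alpha>"

sublocale kernel K z
  by unfold_locales
     (auto simp: K_def T_add T_scaleC T_lie_left scaleC_add_right lie_scaleC_left
       scaleC_scaleC mult.commute)

lemma gam_regular:
  assumes "regular_at z \<alpha>"
  shows "regular_at z (gam K z a \<alpha>)" "regular_at P \<alpha> \<Longrightarrow> regular_at P (gam K z a \<alpha>)"
    "regular_at P \<alpha> \<Longrightarrow> val (gam K z a \<alpha>) P = 0" "regular_at Q \<alpha> \<Longrightarrow> regular_at Q (gam K z a \<alpha>)"
proof -
  let ?x = "lie (const_map a) (const_map (val \<alpha> z) - \<alpha>)"
  have "regular_at z ?x" "val ?x z = 0"
    using assms by (auto simp: regular_at_lie regular_at_diff val_lie val_diff)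
  then show "regular_at z (gam K z a \<alpha>)"
    unfolding gam_def K_def by (rule T_z)
  show "regular_at P \<alpha> \<Longrightarrow> regular_at P (gam K z a \<alpha>)" "regular_at P \<alpha> \<Longrightarrow> val (gam K z a \<alpha>) P = 0"
    "regular_at Q \<alpha> \<Longrightarrow> regular_at Q (gam K z a \<alpha>)"
    unfolding gam_def K_def
    by (auto simp: regular_at_scaleC val_scaleC T_P T_Q regular_at_lie regular_at_diff)
qed

lemma kernel_on_maps0: "kernel_on K z (maps0 P {z})"
  by unfold_locales (rule lie_sub_maps0, auto simp: maps0_def maps_def gam_regular)

lemma kernel_on_maps: "kernel_on K z (maps {P, z})"
  by unfold_locales (rule lie_sub_maps, auto simp: maps_def gam_regular)

lemma kernel_on_maps_Q: "kernel_on K z (maps {P, Q, z})"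
  by unfold_locales (rule lie_sub_maps, auto simp: maps_def gam_regular)

lemma T_const_maps0: "T (const_map a) \<in> maps0 P {}"
  by (simp add: maps0_def maps_def T_P)

lemma eps_elt_free_on: "eps_elt u z (a::'g) \<in> free_on (maps0 P {})"
  unfolding eps_elt by (intro free_on_mult) (auto simp: T_const_maps0)

lemma eps_elt_free_on_Q: "eps_elt u z (a::'g) \<in> free_on (maps {P, Q})"
  unfolding eps_elt by (intro free_on_mult) (auto simp: maps_def T_P T_Q)

lemma eps_elt_env:
  assumes "T (const_map a) \<in> h"
  shows "gen (K (const_map a)) - eps_elt u z a \<in> env_ideal h"
  unfolding K_def eps_elt using assms by (rule gen_scaleC_env)

abbreviation "I \<equiv> env_ideal (maps0 P {} :: 'g mero set)"
abbreviation "Iz \<equiv> env_ideal (maps0 P {z} :: 'g mero set)"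

lemma maps0_z_subset: "maps0 P {z} \<subseteq> (maps0 P {} :: 'g mero set)"
  by (auto simp: maps0_def maps_def)

lemma Iz_sub: "Iz \<subseteq> I"
  by (rule env_ideal_mono[OF maps0_z_subset])

lemma eps_coset: "eps P u z a (q +o I) = (eps_elt u z a * q) +o I"
  unfolding eps_def
  by (rule lmul_coset[OF env_ideal_lsub]) (rule env_ideal_mult_left[OF _ eps_elt_free_on])

text \<open>The operator induced by \<^const>\<open>ann_op\<close> on the enveloping algebra of the maps regular at \<open>z\<close> that vanish
  at \<open>P\<close>, with the default value off this set that belongs to extensional functions.\<close>
definition iota0 :: "'g \<Rightarrow> 'g mero free_alg set \<Rightarrow> 'g mero free_alg set" where
  "iota0 a X = (if X \<in> env (maps0 P {z})
     then ann_op K z a (SOME p. p \<in> free_on (maps0 P {z}) \<and> X = p +o Iz) +o Iz else undefined)"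

lemma coset_in_env: "p \<in> free_on h \<Longrightarrow> p +o env_ideal h \<in> env h"
  by (auto simp: env_def)

lemma iota0_coset:
  assumes p: "p \<in> free_on (maps0 P {z})"
  shows "iota0 a (p +o Iz) = ann_op K z a p +o Iz"
proof -
  interpret kernel_on K z "maps0 P {z}" by (rule kernel_on_maps0)
  define q where "q = (SOME q. q \<in> free_on (maps0 P {z}) \<and> p +o Iz = q +o Iz)"
  have "q \<in> free_on (maps0 P {z}) \<and> p +o Iz = q +o Iz"
    unfolding q_def by (rule someI[of _ p]) (use p in simp)
  then have "ann_op K z a (p - q) \<in> Iz"
    by (intro ann_op_env_ideal) (simp add: coset_eq_iff env_ideal_lsub)
  then have "ann_op K z a q +o Iz = ann_op K z a p +o Iz"
    by (simp add: coset_eq_iff env_ideal_lsub ann_op_linear lsub_minus_commute)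
  then show ?thesis
    unfolding iota0_def using coset_in_env[OF p] by (simp add: q_def)
qed

lemma j_coset: "(q +o Iz) + I = q +o I"
  by (rule coset_add_ideal[OF env_ideal_lsub env_ideal_lsub Iz_sub])

lemma lmul_Iz: "p \<in> free_on (maps0 P {z}) \<Longrightarrow> lmul Iz p (q +o Iz) = (p * q) +o Iz"
  by (rule lmul_coset[OF env_ideal_lsub]) (rule env_ideal_mult_left)

lemma lmul_I: "p \<in> free_on (maps0 P {}) \<Longrightarrow> lmul I p (q +o I) = (p * q) +o I"
  by (rule lmul_coset[OF env_ideal_lsub]) (rule env_ideal_mult_left)

lemma envE:
  assumes "X \<in> env h" obtains p where "p \<in> free_on h" "X = p +o env_ideal h"
  using assms by (auto simp: env_def)

text \<open>The terms with \<open>\<epsilon>\<close> in the defining relation of \<open>\<iota>\<close> combine to left multiplication by \<^const>\<open>gam\<close>.\<close>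
lemma gam_rel:
  assumes "\<alpha> \<in> maps0 P {z}"
  shows "gen (gam K z a \<alpha>) - (- (eps_elt u z a * gen \<alpha> - gen \<alpha> * eps_elt u z a)
      + eps_elt u z (lie a (val \<alpha> z))) \<in> I"
proof -
  define b where "b = lie a (val \<alpha> z)"
  let ?Ka = "K (const_map a)" and ?Kb = "K (const_map b)"
  note L = lie_sub_maps0[of P "{}"]
  have \<alpha>: "\<alpha> \<in> maps0 P {}" using assms maps0_z_subset by auto
  have Kin: "K (const_map a) \<in> maps0 P {}" for a
    unfolding K_def by (rule lie_sub_scaleC[OF L T_const_maps0])
  have l: "lie ?Ka \<alpha> \<in> maps0 P {}" by (rule lie_sub_lie[OF L Kin \<alpha>])
  have g: "gam K z a \<alpha> = ?Kb - lie ?Ka \<alpha>"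
    by (simp add: gam_def b_def const_map_lie lie_diff_right K_diff K_lie_left)
  have "(gen (?Kb - lie ?Ka \<alpha>) - (gen ?Kb - gen (lie ?Ka \<alpha>)))
      - (gen (lie ?Ka \<alpha>) - (gen ?Ka * gen \<alpha> - gen \<alpha> * gen ?Ka))
      - ((gen ?Ka - eps_elt u z a) * gen \<alpha> - gen \<alpha> * (gen ?Ka - eps_elt u z a))
      + (gen ?Kb - eps_elt u z b) \<in> I"
    using \<alpha> Kin l T_const_maps0
    by (intro env_ideal_closed(2) env_ideal_closed(5) gen_diff_env[OF L] gen_lie_env
        env_ideal_mult_left env_ideal_mult_right eps_elt_env) auto
  then show ?thesis
    unfolding g b_def[symmetric] by (simp add: algebra_simps)
qed

lemma is_iota_iota0: "is_iota P u z iota0"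
  unfolding is_iota_def Let_def
proof (intro conjI allI ballI)
  interpret kernel_on K z "maps0 P {z}" by (rule kernel_on_maps0)
  fix a
  show "iota0 a \<in> env (maps0 P {z}) \<rightarrow>\<^sub>E env (maps0 P {z})"
  proof (rule PiE_I)
    fix X :: "'g mero free_alg set" assume "X \<in> env (maps0 P {z})"
    then show "iota0 a X \<in> env (maps0 P {z})"
      by (elim envE) (simp add: iota0_coset coset_in_env ann_op_in_free_on)
  qed (simp add: iota0_def)
  show "iota0 a (1 +o Iz) = 0 +o Iz"
    by (simp add: iota0_coset)
  fix X :: "'g mero free_alg set" assume "X \<in> env (maps0 P {z})"
  then obtain p where p: "p \<in> free_on (maps0 P {z})" "X = p +o Iz" by (rule envE)
  show "iota0 a (lmul Iz (scal c) X) = lmul Iz (scal c) (iota0 a X)" for c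
    using p by (simp add: lmul_Iz iota0_coset free_on_closed ann_op_linear)
  show "iota0 a (X + Y) = iota0 a X + iota0 a Y" if Y: "Y \<in> env (maps0 P {z})" for Y
  proof -
    obtain q where q: "q \<in> free_on (maps0 P {z})" "Y = q +o Iz" using Y by (rule envE)
    with p show ?thesis
      by (simp add: coset_add env_ideal_lsub iota0_coset free_on_closed ann_op_linear)
  qed
  fix \<alpha> :: "'g mero" assume \<alpha>: "\<alpha> \<in> maps0 P {z}"
  have \<alpha>': "\<alpha> \<in> maps0 P {}" using \<alpha> maps0_z_subset by auto
  have \<alpha>p: "gen \<alpha> * p \<in> free_on (maps0 P {z})" using \<alpha> p by (intro free_on_mult) auto
  have p': "p \<in> free_on (maps0 P {})" using p free_on_mono[OF maps0_z_subset] by auto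
  have "(gen (gam K z a \<alpha>) - (- (eps_elt u z a * gen \<alpha> - gen \<alpha> * eps_elt u z a)
      + eps_elt u z (lie a (val \<alpha> z)))) * p \<in> I"
    by (rule env_ideal_mult_right[OF gam_rel[OF \<alpha>] p'])
  then show "iota0 a (lmul Iz (gen \<alpha>) X) + I \<ominus> (lmul Iz (gen \<alpha>) (iota0 a X) + I) =
      0 +o I \<ominus> (eps P u z a (lmul Iz (gen \<alpha>) X + I) \<ominus> lmul I (gen \<alpha>) (eps P u z a (X + I)))
      \<ominus> lmul I (scal (inv_form a (dval \<alpha> z))) (X + I)
      + (iota0 (lie a (val \<alpha> z)) X + I) + eps P u z (lie a (val \<alpha> z)) (X + I)"
    using \<alpha> \<alpha>' \<alpha>p p
    by (simp only: p(2) lmul_Iz lmul_I iota0_coset j_coset eps_coset coset_diff[OF env_ideal_lsub]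
        coset_add[OF env_ideal_lsub] coset_eq_iff[OF env_ideal_lsub] gen_in_free_on scal_in_free_on
        ann_op_gen_mult simp_thms)
      (simp add: algebra_simps)
qed

text \<open>The relation determines \<open>\<iota>\<close> on words only after passage to the larger enveloping algebra. It is
  therefore essential that the smaller one embeds.\<close>
lemma is_iota_unique:
  fixes \<iota> \<iota>' :: "'g \<Rightarrow> 'g mero free_alg set \<Rightarrow> 'g mero free_alg set"
  assumes i: "is_iota P u z \<iota>" and i': "is_iota P u z \<iota>'" shows "\<iota> = \<iota>'"
proof -
  let ?k = "maps0 P {z} :: 'g mero set"
  note d = i[unfolded is_iota_def Let_def] and d' = i'[unfolded is_iota_def Let_def]
  note r5 = d[THEN conjunct2, THEN conjunct2, THEN conjunct2, THEN conjunct2, rule_format]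
    and r5' = d'[THEN conjunct2, THEN conjunct2, THEN conjunct2, THEN conjunct2, rule_format]
  have w: "\<iota> a (mon w +o Iz) = \<iota>' a (mon w +o Iz)" if "set w \<subseteq> ?k" for a w
    using that
  proof (induction w arbitrary: a)
    case Nil
    then show ?case using d d' by (simp add: mon_Nil)
  next
    case (Cons \<alpha> w)
    have IH: "\<iota> b (mon w +o Iz) = \<iota>' b (mon w +o Iz)" for b
      using Cons by simp
    have \<alpha>: "\<alpha> \<in> ?k" and X: "mon w +o Iz \<in> env ?k"
      using Cons.prems by (auto intro: coset_in_env)
    have \<alpha>X: "lmul Iz (gen \<alpha>) (mon w +o Iz) = mon (\<alpha> # w) +o Iz"
      using \<alpha> by (simp add: lmul_Iz mon_Cons)
    have \<alpha>X_in: "mon (\<alpha> # w) +o Iz \<in> env ?k" using Cons.prems by (intro coset_in_env) simp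
    have "\<iota> a (mon (\<alpha> # w) +o Iz) \<in> env ?k" "\<iota>' a (mon (\<alpha> # w) +o Iz) \<in> env ?k" "\<iota>' a (mon w +o Iz) \<in> env ?k"
      using d d' \<alpha>X_in X by (auto dest: PiE_mem)
    then obtain q q' m where q: "q \<in> free_on ?k" "\<iota> a (mon (\<alpha> # w) +o Iz) = q +o Iz"
      "q' \<in> free_on ?k" "\<iota>' a (mon (\<alpha> # w) +o Iz) = q' +o Iz" "\<iota>' a (mon w +o Iz) = m +o Iz"
      by (metis envE)
    have "(\<iota> a (mon (\<alpha> # w) +o Iz) + I) \<ominus> (lmul Iz (gen \<alpha>) (\<iota> a (mon w +o Iz)) + I)
        = (\<iota>' a (mon (\<alpha> # w) +o Iz) + I) \<ominus> (lmul Iz (gen \<alpha>) (\<iota>' a (mon w +o Iz)) + I)"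
      using r5[OF \<alpha> X, of a] r5'[OF \<alpha> X, of a] unfolding \<alpha>X IH by simp
    then have "q - gen \<alpha> * m - (q' - gen \<alpha> * m) \<in> I"
      using \<alpha> Cons by (simp add: q lmul_Iz j_coset coset_diff[OF env_ideal_lsub] coset_eq_iff[OF env_ideal_lsub])
    then have "q - q' \<in> I" by simp
    moreover have "q - q' \<in> free_on ?k" using q by (intro free_on_closed)
    ultimately have "q - q' \<in> Iz" using env_ideal_maps0_Int[of "{}" "{z}"] by blast
    then show ?case by (simp add: q coset_eq_iff[OF env_ideal_lsub])
  qed
  have V: "lsub {p \<in> free_on ?k. \<forall>a. \<iota> a (p +o Iz) = \<iota>' a (p +o Iz)}"
  proof (rule lsubI)
    have "\<iota> a (lmul Iz (scal c) (1 +o Iz)) = \<iota>' a (lmul Iz (scal c) (1 +o Iz))" for a c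
      using d d' w[of "[]" a] coset_in_env[of 1 ?k] by (simp add: mon_Nil)
    from this[of _ 0] have "\<iota> a (0 +o Iz) = \<iota>' a (0 +o Iz)" for a
      using lmul_Iz[of 0 1] by (simp add: lsub_0[OF free_on_lsub])
    then show "0 \<in> {p \<in> free_on ?k. \<forall>a. \<iota> a (p +o Iz) = \<iota>' a (p +o Iz)}"
      by (simp add: lsub_0[OF free_on_lsub])
  next
    fix x y assume xy: "x \<in> {p \<in> free_on ?k. \<forall>a. \<iota> a (p +o Iz) = \<iota>' a (p +o Iz)}"
      "y \<in> {p \<in> free_on ?k. \<forall>a. \<iota> a (p +o Iz) = \<iota>' a (p +o Iz)}"
    then have "\<iota> a ((x +o Iz) + (y +o Iz)) = \<iota>' a ((x +o Iz) + (y +o Iz))" for a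
      using d d' coset_in_env[of x ?k] coset_in_env[of y ?k] by simp
    with xy show "x + y \<in> {p \<in> free_on ?k. \<forall>a. \<iota> a (p +o Iz) = \<iota>' a (p +o Iz)}"
      by (simp add: coset_add[OF env_ideal_lsub] free_on_closed)
  next
    fix c x assume x: "x \<in> {p \<in> free_on ?k. \<forall>a. \<iota> a (p +o Iz) = \<iota>' a (p +o Iz)}"
    then have "\<iota> a (lmul Iz (scal c) (x +o Iz)) = \<iota>' a (lmul Iz (scal c) (x +o Iz))" for a
      using d d' coset_in_env[of x ?k] by simp
    with x show "scal c * x \<in> {p \<in> free_on ?k. \<forall>a. \<iota> a (p +o Iz) = \<iota>' a (p +o Iz)}"
      by (simp add: lmul_Iz free_on_closed)
  qed
  show ?thesis
  proof (intro ext)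
    fix a X
    show "\<iota> a X = \<iota>' a X"
    proof (cases "X \<in> env ?k")
      case True
      then obtain p where p: "p \<in> free_on ?k" "X = p +o Iz" by (rule envE)
      from free_on_span[OF p(1) V] w p(2) show ?thesis by simp
    next
      case False
      have "\<iota> a X = undefined"
        by (rule PiE_arb[OF d[THEN conjunct1, THEN spec] False])
      moreover have "\<iota>' a X = undefined"
        by (rule PiE_arb[OF d'[THEN conjunct1, THEN spec] False])
      ultimately show ?thesis by (rule trans[OF _ sym])
    qed
  qed
qed

lemma iota_coset:
  assumes "p \<in> free_on (maps0 P {z})" shows "iota P u z a (p +o Iz) = ann_op K z a p +o Iz"
proof -
  have "iota P u z = iota0"
    unfolding iota_def by (rule the_equality, rule is_iota_iota0, erule is_iota_unique[OF _ is_iota_iota0])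
  with assms show ?thesis by (simp add: iota0_coset)
qed

lemma cur_coset:
  assumes "p \<in> free_on (maps0 P {z})"
  shows "cur P u z a (p +o Iz) = (eps_elt u z a * p + ann_op K z a p) +o I"
  using assms by (simp add: cur_def iota_coset j_coset eps_coset coset_add[OF env_ideal_lsub])

lemma eps_elt_vac: "p \<in> vac_ideal {P} \<Longrightarrow> eps_elt u z (a::'g) * p \<in> vac_ideal {P}"
  using eps_elt_free_on free_on_mono[OF maps0_subset[of P "{}"]] by (intro vac_ideal_mult) auto

lemma ann_op_vac: "p \<in> vac_ideal {P, z} \<Longrightarrow> ann_op K z a p \<in> vac_ideal {P, z}"
  unfolding vac_ideal_def by (intro kernel_on.ann_op_aug_left_ideal kernel_on_maps) auto

lemma eps_restrict:
  fixes a :: 'g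
  shows "restricts P {} {} {P, Q} {P, Q} (eps P u z a)"
    and "p \<in> free_on (maps {P, Q}) \<Longrightarrow>
      restrict_op P {} {} {P, Q} (eps P u z a) (p +o vac_ideal {P, Q}) = eps_elt u z a * p +o vac_ideal {P, Q}"
  by (rule restrict_op_coset[where G = "\<lambda>p. eps_elt u z a * p"];
      auto simp: right_diff_distrib eps_elt_vac eps_elt_free_on eps_elt_free_on_Q free_on_mult eps_coset)+

lemma iota_restrict:
  fixes a :: 'g
  shows "restricts P {z} {z} {P, Q, z} {P, Q, z} (iota P u z a)"
    and "p \<in> free_on (maps {P, Q, z}) \<Longrightarrow>
      restrict_op P {z} {z} {P, Q, z} (iota P u z a) (p +o vac_ideal {P, Q, z}) = ann_op K z a p +o vac_ideal {P, Q, z}"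
  by (rule restrict_op_coset[where G = "ann_op K z a"];
      auto simp: ann_op_linear ann_op_vac kernel_on.ann_op_in_free_on[OF kernel_on_maps0]
        kernel_on.ann_op_in_free_on[OF kernel_on_maps_Q] iota_coset)+

lemma cur_restrict:
  fixes a :: 'g
  shows "restricts P {z} {} {P, Q, z} {P, Q} (cur P u z a)"
    and "p \<in> free_on (maps {P, Q, z}) \<Longrightarrow>
      restrict_op P {z} {} {P, Q} (cur P u z a) (p +o vac_ideal {P, Q, z})
        = (eps_elt u z a * p + ann_op K z a p) +o vac_ideal {P, Q}"
proof -
  let ?G = "\<lambda>p. eps_elt u z a * p + ann_op K z a p"
  have vac: "?G p \<in> vac_ideal {P}" if "p \<in> vac_ideal {P, z}" for p
    using that ann_op_vac[OF that] vac_ideal_mono[of "{P}" "{P, z}"]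
    by (intro lsub_add[OF vac_ideal_lsub] eps_elt_vac) auto
  have f1: "?G p \<in> free_on (maps0 P {})" if "p \<in> free_on (maps0 P {z})" for p
    using that kernel_on.ann_op_in_free_on[OF kernel_on_maps0 that] free_on_mono[OF maps0_z_subset] eps_elt_free_on
    by (intro free_on_closed) auto
  have m: "maps {P, Q, z} \<subseteq> (maps {P, Q} :: 'g mero set)" by (rule maps_mono) auto
  have f2: "?G p \<in> free_on (maps {P, Q})" if "p \<in> free_on (maps {P, Q, z})" for p
    using that kernel_on.ann_op_in_free_on[OF kernel_on_maps_Q that] free_on_mono[OF m] eps_elt_free_on_Q
    by (intro free_on_closed) auto
  show "restricts P {z} {} {P, Q, z} {P, Q} (cur P u z a)"
    "p \<in> free_on (maps {P, Q, z}) \<Longrightarrow>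
      restrict_op P {z} {} {P, Q} (cur P u z a) (p +o vac_ideal {P, Q, z}) = ?G p +o vac_ideal {P, Q}"
    by (rule restrict_op_coset[where G = ?G];
        auto simp: right_diff_distrib ann_op_linear vac f1 f2 cur_coset)+
qed

end

lemma field_at_coordinate:
  assumes u: "coordinate P u" and z: "z \<noteq> P" "z \<noteq> Q" and Q: "Q \<noteq> P"
  shows "field_at P z Q u (mmul (\<lambda>x. 1 / (u x - u z)) :: 'g::metric_lie_algebra mero \<Rightarrow> 'g mero)"
  using u z Q mero_fun_recip[OF u z(1)]
  by unfold_locales
     (auto simp: mmul_add mmul_scaleC mmul_lie_left eps_elt_def mmul_const
       intro: regular_at_recip_pole val_recip_pole regular_at_recip regular_at_recip_centre)

text \<open>Passing from \<open>u\<close> to \<open>1 / u\<close> subtracts the constant \<open>c\<close> from \<open>s\<close>.\<close>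
lemma kernel_inverse:
  assumes u: "coordinate P u" and z: "z \<noteq> P" "z \<noteq> Q" and Q: "Q \<noteq> P" "u Q = 0"
    and ut: "ut = (\<lambda>x. 1 / u x)" and c: "c = df z ut / ut z"
  shows "df z ut *\<^sub>C mmul (\<lambda>x. 1 / (ut x - ut z)) \<alpha>
    = df z u *\<^sub>C mmul (\<lambda>x. 1 / (u x - u z)) \<alpha> - c *\<^sub>C \<alpha>"
proof -
  have uz: "u z \<noteq> 0" using coordinate_inj[OF u z(1) Q(1)] Q z by auto
  have d: "df z ut = - df z u / (u z)^2"
    unfolding ut by (rule df_recip[OF coordinate_holo_at[OF u z(1)] uz])
  have "df z ut * - ((u z)^2) = df z u"
    using uz by (simp add: d)
  moreover have "df z ut * u z = c"
    unfolding c by (simp add: ut)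
  ultimately show ?thesis
    unfolding ut
    by (simp only: mmul_recip_inverse(2)[OF u z Q] clie.scale_right_diff_distrib scaleC_scaleC)
qed

lemma field_at_inverse:
  assumes u: "coordinate P u" and z: "z \<noteq> P" "z \<noteq> Q" and Q: "Q \<noteq> P" "u Q = 0"
    and ut: "ut = (\<lambda>x. 1 / u x)"
  shows "field_at Q z P ut (mmul (\<lambda>x. 1 / (ut x - ut z)) :: 'g::metric_lie_algebra mero \<Rightarrow> 'g mero)"
proof -
  have uz: "u z \<noteq> 0" using coordinate_inj[OF u z(1) Q(1)] Q z by auto
  let ?t = "\<lambda>x. 1 / (u x - u z)" and ?t' = "\<lambda>x. 1 / (ut x - ut z)"
  have eq: "mmul ?t' \<alpha> = (- ((u z)^2)) *\<^sub>C mmul ?t \<alpha> - u z *\<^sub>C \<alpha>" for \<alpha> :: "'g mero"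
    unfolding ut by (rule mmul_recip_inverse(2)[OF u z Q])
  have t': "mero_fun ?t'" unfolding ut by (rule mmul_recip_inverse(1)[OF u z Q])
  show ?thesis
  proof
    fix \<alpha> :: "'g mero"
    show "regular_at Q (mmul ?t' \<alpha>)" if "regular_at Q \<alpha>"
      using that z Q unfolding eq
      by (intro regular_at_diff regular_at_scaleC regular_at_recip[OF u z(1)]) auto
    show "val (mmul ?t' \<alpha>) Q = 0" if "regular_at Q \<alpha>"
    proof -
      note r = regular_at_recip[OF u z(1) that Q(1) z(2)[symmetric]]
      have "val (mmul ?t' \<alpha>) Q = (- ((u z)^2)) *\<^sub>C (1 / (u Q - u z)) *\<^sub>C val \<alpha> Q - u z *\<^sub>C val \<alpha> Q"
        unfolding eq val_diff[OF regular_at_scaleC[OF r] regular_at_scaleC[OF that]]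
          val_scaleC[OF r] val_scaleC[OF that] val_recip[OF u z(1) that Q(1) z(2)[symmetric]] by (rule refl)
      also have "(- ((u z)^2)) *\<^sub>C (1 / (u Q - u z)) *\<^sub>C val \<alpha> Q = u z *\<^sub>C val \<alpha> Q"
        using uz Q by (simp add: scaleC_scaleC power2_eq_square)
      finally show ?thesis by simp
    qed
    show "regular_at P (mmul ?t' \<alpha>)" if "regular_at P \<alpha>"
      unfolding eq using that
      by (intro regular_at_diff regular_at_scaleC regular_at_recip_pole[OF u z(1)])
    show "regular_at z (df z ut *\<^sub>C mmul ?t' \<alpha>)" if "regular_at z \<alpha>" "val \<alpha> z = 0"
      unfolding kernel_inverse[OF u z Q ut refl] using that
      by (intro regular_at_diff regular_at_scaleC regular_at_recip_centre[OF u z(1)])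
  qed (auto simp: mmul_add mmul_scaleC mmul_lie_left eps_elt_def mmul_const[OF t'])
qed

theorem theorem11p6:
  fixes P Q z :: cp1
    and u ut :: "cp1 \<Rightarrow> complex"
    and \<nu> :: "'g::metric_lie_algebra mero"
    and a :: 'g and c :: complex
  assumes "P \<noteq> Q"
    and "coordinate P u" and "u Q = 0"
    and "ut = (\<lambda>x. 1 / u x)"
    and "z \<noteq> P" and "z \<noteq> Q" and "regular_at z \<nu>"
    and "a = val \<nu> z"
    and "c = df z ut / ut z"
  shows
    "restricts P {} {} {P, Q} {P, Q} (eps P u z a) \<and>
     restricts Q {} {} {P, Q} {P, Q} (eps Q ut z a) \<and>
     (\<forall>X\<in>vac {P, Q}.
        restrict_op Q {} {} {P, Q} (eps Q ut z a) X =
        restrict_op P {} {} {P, Q} (eps P u z a) X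
          \<ominus> lmul (vac_ideal {P, Q}) (scal c * gen (const_map a)) X) \<and>

     restricts P {z} {z} {P, Q, z} {P, Q, z} (iota P u z a) \<and>
     restricts Q {z} {z} {P, Q, z} {P, Q, z} (iota Q ut z a) \<and>
     (\<forall>X\<in>vac {P, Q, z}.
        restrict_op Q {z} {z} {P, Q, z} (iota Q ut z a) X =
        restrict_op P {z} {z} {P, Q, z} (iota P u z a) X
          + lmul (vac_ideal {P, Q, z}) (scal c * gen (const_map a)) X) \<and>

     restricts P {z} {} {P, Q, z} {P, Q} (cur P u z a) \<and>
     restricts Q {z} {} {P, Q, z} {P, Q} (cur Q ut z a) \<and>
     (\<forall>X\<in>vac {P, Q, z}.
        restrict_op Q {z} {} {P, Q} (cur Q ut z a) X =
        restrict_op P {z} {} {P, Q} (cur P u z a) X)"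
proof -
  note u = assms(2) and z = assms(5,6) and Q = assms(1)[symmetric] assms(3) and ut = assms(4) and c = assms(9)
  let ?T = "mmul (\<lambda>x. 1 / (u x - u z)) :: 'g mero \<Rightarrow> 'g mero"
  let ?T' = "mmul (\<lambda>x. 1 / (ut x - ut z)) :: 'g mero \<Rightarrow> 'g mero"
  interpret F: field_at P z Q u ?T by (rule field_at_coordinate[OF u z Q(1)])
  interpret F': field_at Q z P ut ?T' by (rule field_at_inverse[OF u z Q ut])
  have K': "F'.K \<alpha> = F.K \<alpha> - c *\<^sub>C \<alpha>" for \<alpha>
    unfolding F'.K_def F.K_def by (rule kernel_inverse[OF u z Q ut c])
  have PQ: "{Q, P} = {P, Q}" "{Q, P, z} = {P, Q, z}" by auto
  let ?V = "vac_ideal {P, Q} :: 'g mero free_alg set" and ?Vz = "vac_ideal {P, Q, z} :: 'g mero free_alg set"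
  let ?e = "eps_elt u z a" and ?e' = "eps_elt ut z a" and ?ca = "const_map a"
  define d where "d = scal c * gen ?ca"

  have e: "?e' - (?e - d) \<in> env_ideal (maps {P, Q})"
  proof -
    note L = lie_sub_maps[of "{P, Q}"]
    have T: "?T ?ca \<in> maps {P, Q}" "?T' ?ca \<in> maps {P, Q}"
      by (simp_all add: maps_def F.T_P F.T_Q F'.T_P F'.T_Q)
    have K: "F.K ?ca \<in> maps {P, Q}" unfolding F.K_def by (rule lie_sub_scaleC[OF L T(1)])
    have "(gen (F.K ?ca - c *\<^sub>C ?ca) - (gen (F.K ?ca) - gen (c *\<^sub>C ?ca)))
        - (gen (c *\<^sub>C ?ca) - scal c * gen ?ca)
        + (gen (F.K ?ca) - ?e) - (gen (F'.K ?ca) - ?e') \<in> env_ideal (maps {P, Q})"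
      using K T
      by (intro env_ideal_closed(2) env_ideal_closed(5) gen_diff_env[OF L] gen_scaleC_env
          F.eps_elt_env F'.eps_elt_env lie_sub_scaleC[OF L]) auto
    then show ?thesis by (simp add: K' d_def algebra_simps)
  qed
  have i: "ann_op F'.K z a p - (ann_op F.K z a p + d * p) \<in> ?Vz" if "p \<in> free_on (maps {P, Q, z})" for p
    unfolding vac_ideal_def d_def
    by (rule ann_op_change_kernel[OF F.kernel_on_maps_Q _ K' _ that])
       (use F'.kernel_on_maps_Q[unfolded PQ] in auto)

  have d_free: "d \<in> free_on (maps S)" for S
    unfolding d_def by (intro free_on_mult) auto
  have lmul: "lmul (vac_ideal S) d (p +o vac_ideal S) = d * p +o vac_ideal S" for S and p :: "'g mero free_alg"
    by (rule lmul_coset[OF vac_ideal_lsub]) (rule vac_ideal_mult[OF _ d_free])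

  have "restrict_op Q {} {} {P, Q} (eps Q ut z a) X =
      restrict_op P {} {} {P, Q} (eps P u z a) X \<ominus> lmul ?V d X" if "X \<in> vac {P, Q}" for X
  proof -
    obtain p where p: "p \<in> free_on (maps {P, Q})" "X = p +o ?V" using \<open>X \<in> vac {P, Q}\<close> by (auto simp: vac_def)
    have "(?e' - (?e - d)) * p \<in> ?V"
      by (intro env_ideal_vac_ideal env_ideal_mult_right e p)
    then show ?thesis
      using p F.eps_restrict(2)[OF p(1), of a] F'.eps_restrict(2)[unfolded PQ, OF p(1), of a]
      by (simp add: lmul coset_diff[OF vac_ideal_lsub] coset_eq_iff[OF vac_ideal_lsub] algebra_simps)
  qed
  moreover have "restrict_op Q {z} {z} {P, Q, z} (iota Q ut z a) X =
      restrict_op P {z} {z} {P, Q, z} (iota P u z a) X + lmul ?Vz d X" if "X \<in> vac {P, Q, z}" for X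
  proof -
    obtain p where p: "p \<in> free_on (maps {P, Q, z})" "X = p +o ?Vz" using \<open>X \<in> vac {P, Q, z}\<close> by (auto simp: vac_def)
    show ?thesis
      using p F.iota_restrict(2)[OF p(1), of a] F'.iota_restrict(2)[unfolded PQ, OF p(1), of a] i[OF p(1)]
      by (simp add: lmul coset_add[OF vac_ideal_lsub] coset_eq_iff[OF vac_ideal_lsub])
  qed
  moreover have "restrict_op Q {z} {} {P, Q} (cur Q ut z a) X =
      restrict_op P {z} {} {P, Q} (cur P u z a) X" if "X \<in> vac {P, Q, z}" for X
  proof -
    obtain p where p: "p \<in> free_on (maps {P, Q, z})" "X = p +o ?Vz" using \<open>X \<in> vac {P, Q, z}\<close> by (auto simp: vac_def)
    have p': "p \<in> free_on (maps {P, Q})"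
      using p(1) free_on_mono[OF maps_mono[of "{P, Q}" "{P, Q, z}"]] by auto
    have "(?e' - (?e - d)) * p \<in> ?V"
      by (intro env_ideal_vac_ideal env_ideal_mult_right e p')
    moreover have "ann_op F'.K z a p - (ann_op F.K z a p + d * p) \<in> ?V"
      using i[OF p(1)] vac_ideal_mono[of "{P, Q}" "{P, Q, z}"] by auto
    ultimately have "(?e' - (?e - d)) * p + (ann_op F'.K z a p - (ann_op F.K z a p + d * p)) \<in> ?V"
      by (rule lsub_add[OF vac_ideal_lsub])
    then show ?thesis
      using p F.cur_restrict(2)[OF p(1), of a] F'.cur_restrict(2)[unfolded PQ, OF p(1), of a]
      by (simp add: coset_eq_iff[OF vac_ideal_lsub] algebra_simps)
  qed
  ultimately show ?thesis
    using F.eps_restrict(1) F'.eps_restrict(1)[unfolded PQ] F.iota_restrict(1) F'.iota_restrict(1)[unfolded PQ]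
      F.cur_restrict(1) F'.cur_restrict(1)[unfolded PQ]
    unfolding d_def by blast
qed

end
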